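(* Let $P$ be a finitary polynomial endofunctor represented by a diagram of sets $I \leftarrow E \to B \to I$. Let $\mathbf{T}$, $\overline{\mathbf{T}}$, $\overline{\mathbf{T}}^{\bullet}$ be the sets of isomorphism classes of $P$-trees, of $P$-trees with a cut, and of $P$-trees with a pointed cut, and let $m, r:\overline{\mathbf{T}}\to\mathbf{T}$, $p:\overline{\mathbf{T}}^{\bullet}\to\overline{\mathbf{T}}$, $f:\overline{\mathbf{T}}^{\bullet}\to\mathbf{T}$, $e:I\to\mathbf{T}$ be the maps defined in the context. Let $\mathbb{A}^{\mathbf{T}}$ be the category of $\mathbf{T}$-indexed families of finite sets. Then the polynomial functor $M:\mathbb{A}^{\mathbf{T}}\times\mathbb{A}^{\mathbf{T}}\simeq \mathbb{A}^{\mathbf{T}+\mathbf{T}}\to\mathbb{A}^{\mathbf{T}}$ represented by $$\mathbf{T}+\mathbf{T}\xleftarrow{\ f+r\ }\overline{\mathbf{T}}^{\bullet}+\overline{\mathbf{T}}\xrightarrow{\ \langle p,\mathrm{id}_{\overline{\mathbf{T}}}\rangle\ }\overline{\mathbf{T}}\xrightarrow{\ m\ }\mathbf{T}$$ is (the tensor product of) a monoidal structure on $\mathbb{A}^{\mathbf{T}}$. Its unit is the functor $U:1\simeq\mathbb{A}^{0}\to\mathbb{A}^{\mathbf{T}}$ represented by $$0\leftarrow 0\to I\xrightarrow{\ e\ }\mathbf{T}.$$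
   Context: **Polynomial functors.** $+$ and $\sum$ denote disjoint union of sets, $0$ is the empty set and $1$ a singleton. For a set $I$, $\mathbb{A}^I$ is the category of functors from the discrete category $I$ to finite sets, i.e. $I$-indexed families of finite sets; $\mathbb{A}^{I_1}\times\mathbb{A}^{I_2}\simeq\mathbb{A}^{I_1+I_2}$ and $\mathbb{A}^0\simeq 1$. A diagram of sets $I\xleftarrow{s}E\xrightarrow{p}B\xrightarrow{t}J$ represents the polynomial functor $$(X_i\mid i\in I)\longmapsto\Big(\sum_{b\in B_j}\ \prod_{e\in E_b}X_{s(e)}\ \Big|\ j\in J\Big),$$ where $B_j=t^{-1}(j)$ and $E_b=p^{-1}(b)$. When $p$ and $t$ have finite fibres this is a functor $\mathbb{A}^I\to\mathbb{A}^J$. A polynomial endofunctor $I\leftarrow E\to B\to I$ is finitary when $E\to B$ has finite fibres. **Trees.** An (operadic) tree is a diagram of finite sets $A\xleftarrow{s}M\xrightarrow{p}N\xrightarrow{t}A$ such that (1) $t$ is injective; (2) $s$ is injective with singleton complement, whose element is called the root; (3) writing $\sigma:A\to A$ for the function fixing the root and sending $s(x)$ to $t(p(x))$ for $x\in M$, for every $a\in A$ there is $k\in\mathbb{N}$ such that $\sigma^k(a)$ is the root. Elements of $A$ are edges, elements of $N$ are nodes; $t(b)$ is the output edge of a node $b$, and the elements of $p^{-1}(b)$ (identified with their images under $s$) are the input edges of $b$. Edges not in the image of $t$ are leaves. The trivial tree is $1\leftarrow 0\to 0\to 1$ (one edge, no nodes). A morphism of trees (tree embedding) is a triple of maps $A'\to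 A$, $M'\to M$, $N'\to N$ commuting with the structure maps and such that the square formed by $M'\to N'$ and $M\to N$ is a pullback (it is automatically injective); so a subtree containing a node contains all its incident edges. A subtree is root-preserving if it contains the root as its root. For an edge $a$ of a tree, the ideal subtree generated by $a$ has $a$ as root and consists of $a$ and all its descendant edges and nodes. **$P$-trees.** For $P$ given by $I\leftarrow E\to B\to I$, a $P$-tree is a tree $A\leftarrow M\to N\to A$ together with maps $A\to I$, $M\to E$, $N\to B$ making the diagram to $I\leftarrow E\to B\to I$ commute, with the middle square (of $M\to N$ over $E\to B$) a pullback. Isomorphisms of $P$-trees are tree isomorphisms compatible with these maps. Subtrees of a $P$-tree inherit $P$-tree structures. For $i\in I$ there is the trivial $P$-tree whose single edge is decorated by $i$. **Cuts and the sets and maps involved.** A cut of a $P$-tree $T$ is a root-preserving subtree $R\subset T$ (including the subtree consisting of the root edge only, and $T$ itself). A pointed cut is a cut $R\subset T$ together with a chosen leaf of $R$. - $\mathbf{T}$: the set of isomorphism classes of $P$-trees. - $\overline{\mathbf{T}}$: the set of isomorphism classes of $P$-trees with a cut $(R\subset T)$. - $\overline{\mathbf{T}}^{\bullet}$: the set of isomorphism classes of $P$-trees with a pointed cut $(R\subset T, a)$, $a$ a leaf of $R$. - $m:\overline{\mathbf{T}}\to\mathbf{T}$, $(R\subset T)\mapsto T$ (forget the cut). - $r:\overline{\mathbf{T}}\to\mathbf{T}$, $(R\subset T)\mapsto R$ (the tree below the cut). - $p:\overline{\mathbf{T}}^{\bullet}\to\overline{\mathbf{T}}$ forgets the marked leaf.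 - $f:\overline{\mathbf{T}}^{\bullet}\to\mathbf{T}$ sends $(R\subset T,a)$ to the ideal subtree of $T$ generated by the edge $a$. - $e:I\to\mathbf{T}$ sends $i$ to the trivial $P$-tree with edge decorated by $i$. - $\langle p,\mathrm{id}_{\overline{\mathbf{T}}}\rangle$ is the map out of the disjoint union which is $p$ on the first summand and the identity on the second; $f+r$ is the disjoint sum of the two maps. The first argument of $M$ corresponds to the first summand of $\mathbf{T}+\mathbf{T}$, the second argument to the second summand. "Monoidal structure" has the usual meaning (associativity and unit isomorphisms, natural and coherent). *)

theory Defs
  imports "HOL-Library.FuncSet" "HOL-Library.Infinite_Typeclass"
begin

section \<open>Categories, functors, monoidal categories\<close>

record ('o, 'a) cat =
  Obj :: "'o set"
  Arr :: "'a set"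
  Dom :: "'a \<Rightarrow> 'o"
  Cod :: "'a \<Rightarrow> 'o"
  Idn :: "'o \<Rightarrow> 'a"
  Cmp :: "'a \<Rightarrow> 'a \<Rightarrow> 'a"

definition hom_set :: "('o, 'a) cat \<Rightarrow> 'o \<Rightarrow> 'o \<Rightarrow> 'a set" where
  "hom_set C X Y = {f \<in> Arr C. Dom C f = X \<and> Cod C f = Y}"

locale category =
  fixes C :: "('o, 'a) cat"
  assumes dom_obj: "f \<in> Arr C \<Longrightarrow> Dom C f \<in> Obj C"
    and cod_obj: "f \<in> Arr C \<Longrightarrow> Cod C f \<in> Obj C"
    and idn_hom: "X \<in> Obj C \<Longrightarrow> Idn C X \<in> hom_set C X X"
    and cmp_hom: "\<lbrakk>f \<in> hom_set C X Y; g \<in> hom_set C Y Z\<rbrakk> \<Longrightarrow> Cmp C g f \<in> hom_set C X Z"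
    and cmp_idn_right: "f \<in> hom_set C X Y \<Longrightarrow> Cmp C f (Idn C X) = f"
    and cmp_idn_left: "f \<in> hom_set C X Y \<Longrightarrow> Cmp C (Idn C Y) f = f"
    and cmp_assoc: "\<lbrakk>f \<in> hom_set C W X; g \<in> hom_set C X Y; h \<in> hom_set C Y Z\<rbrakk>
        \<Longrightarrow> Cmp C h (Cmp C g f) = Cmp C (Cmp C h g) f"

definition iso_arr :: "('o, 'a) cat \<Rightarrow> 'o \<Rightarrow> 'o \<Rightarrow> 'a \<Rightarrow> bool" where
  "iso_arr C X Y f \<longleftrightarrow> f \<in> hom_set C X Y \<and>
     (\<exists>g \<in> hom_set C Y X. Cmp C g f = Idn C X \<and> Cmp C f g = Idn C Y)"

definition prod_cat :: "('o1, 'a1) cat \<Rightarrow> ('o2, 'a2) cat \<Rightarrow> ('o1 \<times> 'o2, 'a1 \<times> 'a2) cat" where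
  "prod_cat C D =
     \<lparr>Obj = Obj C \<times> Obj D, Arr = Arr C \<times> Arr D,
      Dom = (\<lambda>(f, g). (Dom C f, Dom D g)), Cod = (\<lambda>(f, g). (Cod C f, Cod D g)),
      Idn = (\<lambda>(X, Y). (Idn C X, Idn D Y)),
      Cmp = (\<lambda>(f', g') (f, g). (Cmp C f' f, Cmp D g' g))\<rparr>"

record ('o1, 'a1, 'o2, 'a2) fctr =
  on_obj :: "'o1 \<Rightarrow> 'o2"
  on_arr :: "'a1 \<Rightarrow> 'a2"

definition fctr_comp ::
  "('o2, 'a2, 'o3, 'a3) fctr \<Rightarrow> ('o1, 'a1, 'o2, 'a2) fctr \<Rightarrow> ('o1, 'a1, 'o3, 'a3) fctr" where
  "fctr_comp G F = \<lparr>on_obj = on_obj G \<circ> on_obj F, on_arr = on_arr G \<circ> on_arr F\<rparr>"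

locale cat_functor = dom_cat: category C + cod_cat: category D
  for C :: "('o1, 'a1) cat" and D :: "('o2, 'a2) cat" +
  fixes F :: "('o1, 'a1, 'o2, 'a2) fctr"
  assumes obj_map: "X \<in> Obj C \<Longrightarrow> on_obj F X \<in> Obj D"
    and arr_map: "f \<in> hom_set C X Y \<Longrightarrow> on_arr F f \<in> hom_set D (on_obj F X) (on_obj F Y)"
    and map_idn: "X \<in> Obj C \<Longrightarrow> on_arr F (Idn C X) = Idn D (on_obj F X)"
    and map_cmp: "\<lbrakk>f \<in> hom_set C X Y; g \<in> hom_set C Y Z\<rbrakk>
        \<Longrightarrow> on_arr F (Cmp C g f) = Cmp D (on_arr F g) (on_arr F f)"

locale category_with_tensor = category C + cat_functor "prod_cat C C" C T
  for C :: "('o, 'a) cat" and T :: "('o \<times> 'o, 'a \<times> 'a, 'o, 'a) fctr"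
begin

abbreviation cmp (infixr "\<cdot>" 65) where "g \<cdot> f \<equiv> Cmp C g f"
abbreviation idn where "idn X \<equiv> Idn C X"
abbreviation tensor_obj (infixr "\<otimes>" 70) where "X \<otimes> Y \<equiv> on_obj T (X, Y)"
abbreviation tensor_arr (infixr "\<otimes>\<^sub>a" 70) where "f \<otimes>\<^sub>a g \<equiv> on_arr T (f, g)"

end

locale monoidal_category = category_with_tensor C T
  for C :: "('o, 'a) cat" and T :: "('o \<times> 'o, 'a \<times> 'a, 'o, 'a) fctr" +
  fixes U :: 'o
    and assoc :: "'o \<Rightarrow> 'o \<Rightarrow> 'o \<Rightarrow> 'a"
    and lunit :: "'o \<Rightarrow> 'a"
    and runit :: "'o \<Rightarrow> 'a"
  assumes unit_obj: "U \<in> Obj C"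
    and assoc_iso: "\<lbrakk>X \<in> Obj C; Y \<in> Obj C; Z \<in> Obj C\<rbrakk>
        \<Longrightarrow> iso_arr C ((X \<otimes> Y) \<otimes> Z) (X \<otimes> (Y \<otimes> Z)) (assoc X Y Z)"
    and lunit_iso: "X \<in> Obj C \<Longrightarrow> iso_arr C (U \<otimes> X) X (lunit X)"
    and runit_iso: "X \<in> Obj C \<Longrightarrow> iso_arr C (X \<otimes> U) X (runit X)"
    and assoc_natural:
      "\<lbrakk>f \<in> hom_set C X X'; g \<in> hom_set C Y Y'; h \<in> hom_set C Z Z'\<rbrakk>
        \<Longrightarrow> assoc X' Y' Z' \<cdot> ((f \<otimes>\<^sub>a g) \<otimes>\<^sub>a h) = (f \<otimes>\<^sub>a (g \<otimes>\<^sub>a h)) \<cdot> assoc X Y Z"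
    and lunit_natural: "f \<in> hom_set C X X' \<Longrightarrow> lunit X' \<cdot> (idn U \<otimes>\<^sub>a f) = f \<cdot> lunit X"
    and runit_natural: "f \<in> hom_set C X X' \<Longrightarrow> runit X' \<cdot> (f \<otimes>\<^sub>a idn U) = f \<cdot> runit X"
    and pentagon:
      "\<lbrakk>W \<in> Obj C; X \<in> Obj C; Y \<in> Obj C; Z \<in> Obj C\<rbrakk>
        \<Longrightarrow> assoc W X (Y \<otimes> Z) \<cdot> assoc (W \<otimes> X) Y Z =
            (idn W \<otimes>\<^sub>a assoc X Y Z) \<cdot> assoc W (X \<otimes> Y) Z \<cdot> (assoc W X Y \<otimes>\<^sub>a idn Z)"
    and triangle:
      "\<lbrakk>X \<in> Obj C; Y \<in> Obj C\<rbrakk>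
        \<Longrightarrow> (idn X \<otimes>\<^sub>a lunit Y) \<cdot> assoc X U Y = runit X \<otimes>\<^sub>a idn Y"


section \<open>Families of finite sets and polynomial functors\<close>

text \<open>
  Finite sets are the finite subsets of a fixed infinite type \<open>'u\<close>, which form a category
  equivalent to that of all finite sets. A finite set \<open>S\<close> over any other type is regarded as an
  object of it through a chosen copy \<open>code S ` S\<close>, where \<open>code S\<close> is injective on \<open>S\<close>.
  An arrow is a triple (domain, family of extensional maps, codomain).
\<close>

type_synonym ('j, 'u) family = "'j \<Rightarrow> 'u set"
type_synonym ('j, 'u) family_map = "('j, 'u) family \<times> ('j \<Rightarrow> 'u \<Rightarrow> 'u) \<times> ('j, 'u) family"

definition families :: "'j set \<Rightarrow> ('j, 'u) family set" where
  "families J = (\<Pi>\<^sub>E j\<in>J. {S. finite S})"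

definition family_cat :: "'j set \<Rightarrow> (('j, 'u) family, ('j, 'u) family_map) cat" where
  "family_cat J =
     \<lparr>Obj = families J,
      Arr = {(X, \<phi>, Y). X \<in> families J \<and> Y \<in> families J \<and> \<phi> \<in> (\<Pi>\<^sub>E j\<in>J. X j \<rightarrow>\<^sub>E Y j)},
      Dom = (\<lambda>(X, \<phi>, Y). X),
      Cod = (\<lambda>(X, \<phi>, Y). Y),
      Idn = (\<lambda>X. (X, (\<lambda>j\<in>J. \<lambda>x\<in>X j. x), X)),
      Cmp = (\<lambda>(Y, \<psi>, Z) (X, \<phi>, Y'). (X, (\<lambda>j\<in>J. \<lambda>x\<in>X j. \<psi> j (\<phi> j x)), Z))\<rparr>"

definition code :: "'a set \<Rightarrow> 'a \<Rightarrow> 'u::infinite" where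
  "code S = (SOME c. inj_on c S)"

definition decode :: "'a set \<Rightarrow> 'u::infinite \<Rightarrow> 'a" where
  "decode S = the_inv_into S (code S)"

text \<open>Diagrams \<open>I \<leftarrow> E \<rightarrow> B \<rightarrow> J\<close> with maps \<open>s\<close>, \<open>p\<close>, \<open>t\<close>.\<close>

record ('i, 'e, 'b, 'j) diagram =
  dI :: "'i set"
  dE :: "'e set"
  dB :: "'b set"
  dJ :: "'j set"
  ds :: "'e \<Rightarrow> 'i"
  dp :: "'e \<Rightarrow> 'b"
  dt :: "'b \<Rightarrow> 'j"

definition is_diagram :: "('i, 'e, 'b, 'j) diagram \<Rightarrow> bool" where
  "is_diagram D \<longleftrightarrow> ds D \<in> dE D \<rightarrow> dI D \<and> dp D \<in> dE D \<rightarrow> dB D \<and> dt D \<in> dB D \<rightarrow> dJ D"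

definition fib_E :: "('i, 'e, 'b, 'j) diagram \<Rightarrow> 'b \<Rightarrow> 'e set" where
  "fib_E D b = {e \<in> dE D. dp D e = b}"

definition fib_B :: "('i, 'e, 'b, 'j) diagram \<Rightarrow> 'j \<Rightarrow> 'b set" where
  "fib_B D j = {b \<in> dB D. dt D b = j}"

definition finite_fibre_diagram :: "('i, 'e, 'b, 'j) diagram \<Rightarrow> bool" where
  "finite_fibre_diagram D \<longleftrightarrow> is_diagram D \<and>
     (\<forall>b\<in>dB D. finite (fib_E D b)) \<and> (\<forall>j\<in>dJ D. finite (fib_B D j))"

definition finitary_endo :: "('i, 'e, 'b, 'i) diagram \<Rightarrow> bool" where
  "finitary_endo P \<longleftrightarrow> is_diagram P \<and> dI P = dJ P \<and> (\<forall>b\<in>dB P. finite (fib_E P b))"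

definition sum_prod :: "('i, 'e, 'b, 'j) diagram \<Rightarrow> ('i, 'u) family \<Rightarrow> 'j \<Rightarrow> ('b \<times> ('e \<Rightarrow> 'u)) set" where
  "sum_prod D X j = (SIGMA b : fib_B D j. \<Pi>\<^sub>E e\<in>fib_E D b. X (ds D e))"

definition poly_obj ::
  "('i, 'e, 'b, 'j) diagram \<Rightarrow> ('i, 'u::infinite) family \<Rightarrow> ('j, 'u) family" where
  "poly_obj D X = (\<lambda>j\<in>dJ D. code (sum_prod D X j) ` sum_prod D X j)"

definition poly_functor :: "('i, 'e, 'b, 'j) diagram \<Rightarrow>
    (('i, 'u::infinite) family, ('i, 'u) family_map, ('j, 'u) family, ('j, 'u) family_map) fctr" where
  "poly_functor D =
     \<lparr>on_obj = poly_obj D,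
      on_arr = (\<lambda>(X, \<phi>, Y).
        (poly_obj D X,
         (\<lambda>j\<in>dJ D. \<lambda>u\<in>poly_obj D X j.
            case decode (sum_prod D X j) u of
              (b, x) \<Rightarrow> code (sum_prod D Y j) (b, \<lambda>e\<in>fib_E D b. \<phi> (ds D e) (x e))),
         poly_obj D Y))\<rparr>"

text \<open>The equivalence between pairs of families and families indexed by the disjoint union.\<close>

definition pair_family :: "'i set \<Rightarrow> 'k set \<Rightarrow> ('i \<Rightarrow> 'c) \<Rightarrow> ('k \<Rightarrow> 'c) \<Rightarrow> 'i + 'k \<Rightarrow> 'c" where
  "pair_family I K X Y = restrict (case_sum X Y) (I <+> K)"

definition pairing :: "'i set \<Rightarrow> 'k set \<Rightarrow>
    (('i, 'u) family \<times> ('k, 'u) family, ('i, 'u) family_map \<times> ('k, 'u) family_map,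
     ('i + 'k, 'u) family, ('i + 'k, 'u) family_map) fctr" where
  "pairing I K =
     \<lparr>on_obj = (\<lambda>(X, Y). pair_family I K X Y),
      on_arr = (\<lambda>((X, \<phi>, X'), (Y, \<psi>, Y')).
        (pair_family I K X Y, pair_family I K \<phi> \<psi>, pair_family I K X' Y'))\<rparr>"


section \<open>Trees\<close>

text \<open>
  For diagrams with \<open>dI = dJ\<close>. The last conjunct says that the middle square is a pullback.
\<close>

definition cartesian_map :: "('a, 'm, 'n, 'a) diagram \<Rightarrow> ('i, 'e, 'b, 'i) diagram \<Rightarrow>
    ('a \<Rightarrow> 'i) \<Rightarrow> ('m \<Rightarrow> 'e) \<Rightarrow> ('n \<Rightarrow> 'b) \<Rightarrow> bool" where
  "cartesian_map D D' g0 g1 g2 \<longleftrightarrow>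
     g0 \<in> dI D \<rightarrow> dI D' \<and> g1 \<in> dE D \<rightarrow> dE D' \<and> g2 \<in> dB D \<rightarrow> dB D' \<and>
     (\<forall>x\<in>dE D. ds D' (g1 x) = g0 (ds D x) \<and> dp D' (g1 x) = g2 (dp D x)) \<and>
     (\<forall>n\<in>dB D. dt D' (g2 n) = g0 (dt D n)) \<and>
     bij_betw (\<lambda>x. (dp D x, g1 x)) (dE D) {(n, y). n \<in> dB D \<and> y \<in> dE D' \<and> g2 n = dp D' y}"

definition tree_root :: "('a, 'm, 'n, 'a) diagram \<Rightarrow> 'a" where
  "tree_root T = (THE a. dI T - ds T ` dE T = {a})"

definition sigma :: "('a, 'm, 'n, 'a) diagram \<Rightarrow> 'a \<Rightarrow> 'a" where
  "sigma T a = (if a = tree_root T then a else dt T (dp T (the_inv_into (dE T) (ds T) a)))"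

definition is_tree :: "('a, 'm, 'n, 'a) diagram \<Rightarrow> bool" where
  "is_tree T \<longleftrightarrow> is_diagram T \<and> dI T = dJ T \<and>
     finite (dI T) \<and> finite (dE T) \<and> finite (dB T) \<and>
     inj_on (dt T) (dB T) \<and>
     inj_on (ds T) (dE T) \<and> (\<exists>a. dI T - ds T ` dE T = {a}) \<and>
     (\<forall>a\<in>dI T. \<exists>k. (sigma T ^^ k) a = tree_root T)"

definition leaves :: "('a, 'm, 'n, 'a) diagram \<Rightarrow> 'a set" where
  "leaves T = dI T - dt T ` dB T"

definition restrict_diagram ::
  "('a, 'm, 'n, 'a) diagram \<Rightarrow> 'a set \<times> 'm set \<times> 'n set \<Rightarrow> ('a, 'm, 'n, 'a) diagram" where
  "restrict_diagram T = (\<lambda>(A, M, N). T\<lparr>dI := A, dE := M, dB := N, dJ := A\<rparr>)"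

text \<open>Subtrees are given by their sets of edges, of input slots and of nodes.\<close>

definition is_subtree :: "('a, 'm, 'n, 'a) diagram \<Rightarrow> 'a set \<times> 'm set \<times> 'n set \<Rightarrow> bool" where
  "is_subtree T S \<longleftrightarrow> is_tree (restrict_diagram T S) \<and>
     cartesian_map (restrict_diagram T S) T id id id"

definition is_cut :: "('a, 'm, 'n, 'a) diagram \<Rightarrow> 'a set \<times> 'm set \<times> 'n set \<Rightarrow> bool" where
  "is_cut T S \<longleftrightarrow> is_subtree T S \<and> tree_root (restrict_diagram T S) = tree_root T"

definition descendants :: "('a, 'm, 'n, 'a) diagram \<Rightarrow> 'a \<Rightarrow> 'a set" where
  "descendants T a = {c \<in> dI T. \<exists>k. (sigma T ^^ k) c = a}"

definition ideal :: "('a, 'm, 'n, 'a) diagram \<Rightarrow> 'a \<Rightarrow> 'a set \<times> 'm set \<times> 'n set" where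
  "ideal T a =
     (descendants T a,
      {x \<in> dE T. dt T (dp T x) \<in> descendants T a},
      {n \<in> dB T. dt T n \<in> descendants T a})"


section \<open>\<open>P\<close>-trees and cuts, up to isomorphism\<close>

text \<open>
  The underlying trees are taken on sets of natural numbers; every finite tree is isomorphic to
  such a tree, so the isomorphism classes are those of all \<open>P\<close>-trees.
\<close>

record ('i, 'e, 'b) ptree =
  shape :: "(nat, nat, nat, nat) diagram"
  decI :: "nat \<Rightarrow> 'i"
  decE :: "nat \<Rightarrow> 'e"
  decB :: "nat \<Rightarrow> 'b"

type_synonym sub = "nat set \<times> nat set \<times> nat set"

definition is_ptree :: "('i, 'e, 'b, 'i) diagram \<Rightarrow> ('i, 'e, 'b) ptree \<Rightarrow> bool" where
  "is_ptree P T \<longleftrightarrow> is_tree (shape T) \<and> cartesian_map (shape T) P (decI T) (decE T) (decB T)"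

definition ptree_iso :: "('i, 'e, 'b) ptree \<Rightarrow> ('i, 'e, 'b) ptree \<Rightarrow>
    (nat \<Rightarrow> nat) \<Rightarrow> (nat \<Rightarrow> nat) \<Rightarrow> (nat \<Rightarrow> nat) \<Rightarrow> bool" where
  "ptree_iso T T' g0 g1 g2 \<longleftrightarrow>
     cartesian_map (shape T) (shape T') g0 g1 g2 \<and>
     bij_betw g0 (dI (shape T)) (dI (shape T')) \<and>
     bij_betw g1 (dE (shape T)) (dE (shape T')) \<and>
     bij_betw g2 (dB (shape T)) (dB (shape T')) \<and>
     (\<forall>a\<in>dI (shape T). decI T' (g0 a) = decI T a) \<and>
     (\<forall>x\<in>dE (shape T). decE T' (g1 x) = decE T x) \<and>
     (\<forall>n\<in>dB (shape T). decB T' (g2 n) = decB T n)"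

definition sub_ptree :: "('i, 'e, 'b) ptree \<Rightarrow> sub \<Rightarrow> ('i, 'e, 'b) ptree" where
  "sub_ptree T S = T\<lparr>shape := restrict_diagram (shape T) S\<rparr>"

definition trivial_ptree :: "'i \<Rightarrow> ('i, 'e, 'b) ptree" where
  "trivial_ptree i =
     \<lparr>shape = \<lparr>dI = {0}, dE = {}, dB = {}, dJ = {0}, ds = id, dp = id, dt = id\<rparr>,
      decI = (\<lambda>_. i), decE = (\<lambda>_. undefined), decB = (\<lambda>_. undefined)\<rparr>"

definition ptrees :: "('i, 'e, 'b, 'i) diagram \<Rightarrow> ('i, 'e, 'b) ptree set" where
  "ptrees P = {T. is_ptree P T}"

definition ptree_rel :: "('i, 'e, 'b, 'i) diagram \<Rightarrow> ('i, 'e, 'b) ptree rel" where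
  "ptree_rel P = {(T, T'). T \<in> ptrees P \<and> T' \<in> ptrees P \<and> (\<exists>g0 g1 g2. ptree_iso T T' g0 g1 g2)}"

definition cuts :: "('i, 'e, 'b, 'i) diagram \<Rightarrow> (('i, 'e, 'b) ptree \<times> sub) set" where
  "cuts P = {(T, S). T \<in> ptrees P \<and> is_cut (shape T) S}"

definition cut_rel :: "('i, 'e, 'b, 'i) diagram \<Rightarrow> (('i, 'e, 'b) ptree \<times> sub) rel" where
  "cut_rel P = {((T, (A, M, N)), (T', S')). (T, (A, M, N)) \<in> cuts P \<and> (T', S') \<in> cuts P \<and>
     (\<exists>g0 g1 g2. ptree_iso T T' g0 g1 g2 \<and> S' = (g0 ` A, g1 ` M, g2 ` N))}"

definition pcuts :: "('i, 'e, 'b, 'i) diagram \<Rightarrow> (('i, 'e, 'b) ptree \<times> sub \<times> nat) set" where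
  "pcuts P = {(T, S, a). (T, S) \<in> cuts P \<and> a \<in> leaves (restrict_diagram (shape T) S)}"

definition pcut_rel :: "('i, 'e, 'b, 'i) diagram \<Rightarrow> (('i, 'e, 'b) ptree \<times> sub \<times> nat) rel" where
  "pcut_rel P = {((T, (A, M, N), a), (T', S', a')).
     (T, (A, M, N), a) \<in> pcuts P \<and> (T', S', a') \<in> pcuts P \<and>
     (\<exists>g0 g1 g2. ptree_iso T T' g0 g1 g2 \<and> S' = (g0 ` A, g1 ` M, g2 ` N) \<and> a' = g0 a)}"

type_synonym ('i, 'e, 'b) tclass = "('i, 'e, 'b) ptree set"
type_synonym ('i, 'e, 'b) cclass = "(('i, 'e, 'b) ptree \<times> sub) set"
type_synonym ('i, 'e, 'b) pclass = "(('i, 'e, 'b) ptree \<times> sub \<times> nat) set"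

definition TT :: "('i, 'e, 'b, 'i) diagram \<Rightarrow> ('i, 'e, 'b) tclass set" where
  "TT P = ptrees P // ptree_rel P"

definition TTcut :: "('i, 'e, 'b, 'i) diagram \<Rightarrow> ('i, 'e, 'b) cclass set" where
  "TTcut P = cuts P // cut_rel P"

definition TTpcut :: "('i, 'e, 'b, 'i) diagram \<Rightarrow> ('i, 'e, 'b) pclass set" where
  "TTpcut P = pcuts P // pcut_rel P"

text \<open>
  Maps out of a quotient are given, as in \<open>HOL.Equiv_Relations\<close>, by the union over the members
  of a class of the classes of their images.
\<close>

definition m_map :: "('i, 'e, 'b, 'i) diagram \<Rightarrow> ('i, 'e, 'b) cclass \<Rightarrow> ('i, 'e, 'b) tclass" where
  "m_map P c = (\<Union>(T, S)\<in>c. ptree_rel P `` {T})"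

definition r_map :: "('i, 'e, 'b, 'i) diagram \<Rightarrow> ('i, 'e, 'b) cclass \<Rightarrow> ('i, 'e, 'b) tclass" where
  "r_map P c = (\<Union>(T, S)\<in>c. ptree_rel P `` {sub_ptree T S})"

definition p_map :: "('i, 'e, 'b, 'i) diagram \<Rightarrow> ('i, 'e, 'b) pclass \<Rightarrow> ('i, 'e, 'b) cclass" where
  "p_map P c = (\<Union>(T, S, a)\<in>c. cut_rel P `` {(T, S)})"

definition f_map :: "('i, 'e, 'b, 'i) diagram \<Rightarrow> ('i, 'e, 'b) pclass \<Rightarrow> ('i, 'e, 'b) tclass" where
  "f_map P c = (\<Union>(T, S, a)\<in>c. ptree_rel P `` {sub_ptree T (ideal (shape T) a)})"

definition e_map :: "('i, 'e, 'b, 'i) diagram \<Rightarrow> 'i \<Rightarrow> ('i, 'e, 'b) tclass" where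
  "e_map P i = ptree_rel P `` {trivial_ptree i}"


section \<open>The tensor product and the unit\<close>

definition M_diagram :: "('i, 'e, 'b, 'i) diagram \<Rightarrow>
    (('i, 'e, 'b) tclass + ('i, 'e, 'b) tclass, ('i, 'e, 'b) pclass + ('i, 'e, 'b) cclass,
     ('i, 'e, 'b) cclass, ('i, 'e, 'b) tclass) diagram" where
  "M_diagram P =
     \<lparr>dI = TT P <+> TT P, dE = TTpcut P <+> TTcut P, dB = TTcut P, dJ = TT P,
      ds = map_sum (f_map P) (r_map P), dp = case_sum (p_map P) id, dt = m_map P\<rparr>"

definition U_diagram ::
  "('i, 'e, 'b, 'i) diagram \<Rightarrow> (unit, unit, 'i, ('i, 'e, 'b) tclass) diagram" where
  "U_diagram P =
     \<lparr>dI = {}, dE = {}, dB = dI P, dJ = TT P,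
      ds = (\<lambda>_. undefined), dp = (\<lambda>_. undefined), dt = e_map P\<rparr>"

definition M_functor :: "('i, 'e, 'b, 'i) diagram \<Rightarrow>
    ((('i, 'e, 'b) tclass, 'u::infinite) family \<times> (('i, 'e, 'b) tclass, 'u) family,
     (('i, 'e, 'b) tclass, 'u) family_map \<times> (('i, 'e, 'b) tclass, 'u) family_map,
     (('i, 'e, 'b) tclass, 'u) family, (('i, 'e, 'b) tclass, 'u) family_map) fctr" where
  "M_functor P = fctr_comp (poly_functor (M_diagram P)) (pairing (TT P) (TT P))"

text \<open>
  \<open>\<lambda>_. undefined\<close> is the only object of \<open>family_cat {}\<close>; this is the object picked out by the
  functor from the terminal category.
\<close>

definition U_object :: "('i, 'e, 'b, 'i) diagram \<Rightarrow> (('i, 'e, 'b) tclass, 'u::infinite) family" where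
  "U_object P = on_obj (poly_functor (U_diagram P)) (\<lambda>_. undefined)"

end

(*
  A P-tree has no automorphisms, because the inputs of a node are labelled by a fibre of E -> B. So
  a P-tree up to isomorphism is a prefix-closed set of positions (lists of elements of E) labelled
  in B, a cut is a pair r <= t of such sets with the same root colour, and a pointed cut is such a
  pair with a leaf p of r; the maps m, r and f give t, r and the tree t/p above p. Hence
    M(X,Y)(t) = sum over r <= t of (prod over leaves p of r of X(t/p)) * Y(r).
  The associator comes from the two ways to read a chain r <= s <= t: as a cut r of t with the cuts
  s/p of the trees t/p, or as a cut s of t with a cut r of s. The coherence laws follow from
  (t/p)/q = t/(p @ q) and the associativity of @.
*)

theory Submission
  imports Defs
begin

section \<open>Categories of families\<close>

text \<open>Rigidity is what allows the polynomial diagram to be formed from isomorphism classes: an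
  automorphism of a tree could identify two of its cuts, or two leaves of one cut, and the fibres of
  \<open>m_map\<close> and \<open>p_map\<close> would then count orbits instead of cuts and leaves.
  The obstacle on the categorical side is that \<open>poly_functor\<close> stores its values in
  \<open>'u\<close> through arbitrary injections, so an iterated tensor product consists of codes of
  terms that again contain codes. The locale \<open>cut_tensor\<close> therefore keeps only that the
  encoding is injective on terms and how the functor acts on encoded terms; the coherence laws
  become identities between terms. The combinatorics enters through the axioms of
  \<open>cut_structure\<close> alone. They are proved for position trees, where they concern sets of
  lists, and are carried to the classes along the bijection \<open>tree_class\<close>.\<close>

lemma category_prod_cat:
  assumes "category C" and "category D"
  shows "category (prod_cat C D)"
proof -
  interpret C: category C by fact
  interpret D: category D by fact
  have C: "Cmp C g f \<in> Arr C" "Dom C (Cmp C g f) = Dom C f" "Cod C (Cmp C g f) = Cod C g"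
    if "f \<in> Arr C" "g \<in> Arr C" "Dom C g = Cod C f" for f g
    using C.cmp_hom[of f "Dom C f" "Cod C f" g "Cod C g"] that by (auto simp: hom_set_def)
  have D: "Cmp D g f \<in> Arr D" "Dom D (Cmp D g f) = Dom D f" "Cod D (Cmp D g f) = Cod D g"
    if "f \<in> Arr D" "g \<in> Arr D" "Dom D g = Cod D f" for f g
    using D.cmp_hom[of f "Dom D f" "Cod D f" g "Cod D g"] that by (auto simp: hom_set_def)
  show ?thesis
    by unfold_locales
      (auto simp: prod_cat_def hom_set_def C.dom_obj C.cod_obj D.dom_obj D.cod_obj C D
        C.cmp_idn_left[unfolded hom_set_def] C.cmp_idn_right[unfolded hom_set_def]
        D.cmp_idn_left[unfolded hom_set_def] D.cmp_idn_right[unfolded hom_set_def]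
        C.cmp_assoc[unfolded hom_set_def] D.cmp_assoc[unfolded hom_set_def]
        dest: C.idn_hom[unfolded hom_set_def] D.idn_hom[unfolded hom_set_def])
qed

lemma hom_set_prod_cat:
  "(f, g) \<in> hom_set (prod_cat C D) (X, Y) (X', Y') \<longleftrightarrow>
     f \<in> hom_set C X X' \<and> g \<in> hom_set D Y Y'"
  by (auto simp: hom_set_def prod_cat_def)

definition app :: "('j, 'u) family_map \<Rightarrow> 'j \<Rightarrow> 'u \<Rightarrow> 'u" where
  "app f = fst (snd f)"

definition mk_arr ::
  "'j set \<Rightarrow> ('j, 'u) family \<Rightarrow> ('j \<Rightarrow> 'u \<Rightarrow> 'u) \<Rightarrow> ('j, 'u) family \<Rightarrow> ('j, 'u) family_map" where
  "mk_arr J X F Y = (X, (\<lambda>j\<in>J. \<lambda>x\<in>X j. F j x), Y)"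

lemma Obj_family_cat [simp]: "Obj (family_cat J) = families J"
  by (simp add: family_cat_def)

lemma Idn_family_cat: "Idn (family_cat J) X = (X, (\<lambda>j\<in>J. \<lambda>x\<in>X j. x), X)"
  by (simp add: family_cat_def)

lemma Cmp_family_cat:
  "Cmp (family_cat J) (Y', \<psi>, Z) (X, \<phi>, Y) = (X, (\<lambda>j\<in>J. \<lambda>x\<in>X j. \<psi> j (\<phi> j x)), Z)"
  by (simp add: family_cat_def)

lemma hom_set_family_cat:
  "f \<in> hom_set (family_cat J) X Y \<longleftrightarrow>
     (\<exists>\<phi>. f = (X, \<phi>, Y) \<and> X \<in> families J \<and> Y \<in> families J \<and> \<phi> \<in> (\<Pi>\<^sub>E j\<in>J. X j \<rightarrow>\<^sub>E Y j))"
  by (auto simp: hom_set_def family_cat_def)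

lemma hom_families:
  assumes "f \<in> hom_set (family_cat J) X Y"
  shows "X \<in> families J" and "Y \<in> families J"
  using assms by (auto simp: hom_set_family_cat)

lemma app_in:
  assumes "f \<in> hom_set (family_cat J) X Y" and "j \<in> J" and "x \<in> X j"
  shows "app f j x \<in> Y j"
  using assms by (auto simp: hom_set_family_cat app_def PiE_iff)

lemma mk_arr_hom:
  assumes "X \<in> families J" and "Y \<in> families J"
    and "\<And>j x. j \<in> J \<Longrightarrow> x \<in> X j \<Longrightarrow> F j x \<in> Y j"
  shows "mk_arr J X F Y \<in> hom_set (family_cat J) X Y"
  using assms by (auto simp: hom_set_family_cat mk_arr_def)

lemma app_mk_arr [simp]: "j \<in> J \<Longrightarrow> x \<in> X j \<Longrightarrow> app (mk_arr J X F Y) j x = F j x"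
  by (simp add: app_def mk_arr_def)

lemma app_Idn [simp]: "j \<in> J \<Longrightarrow> x \<in> X j \<Longrightarrow> app (Idn (family_cat J) X) j x = x"
  by (simp add: app_def family_cat_def)

lemma app_Cmp:
  assumes "f \<in> hom_set (family_cat J) X Y" and "g \<in> hom_set (family_cat J) Y Z"
    and "j \<in> J" and "x \<in> X j"
  shows "app (Cmp (family_cat J) g f) j x = app g j (app f j x)"
proof -
  obtain \<phi> \<psi> where "f = (X, \<phi>, Y)" "g = (Y, \<psi>, Z)"
    using assms(1,2) by (auto simp: hom_set_family_cat)
  then show ?thesis using assms(3,4) by (simp add: app_def Cmp_family_cat)
qed

text \<open>Both levels of a family of maps are extensional, so nothing is left to compare outside
  the index set and the sets of the family. Every commuting diagram below is checked by this rule,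
  element by element.\<close>

lemma family_arr_eqI:
  assumes "f \<in> hom_set (family_cat J) X Y" and "g \<in> hom_set (family_cat J) X Y"
    and "\<And>j x. j \<in> J \<Longrightarrow> x \<in> X j \<Longrightarrow> app f j x = app g j x"
  shows "f = g"
proof -
  obtain \<phi> \<psi> where f: "f = (X, \<phi>, Y)" "\<phi> \<in> (\<Pi>\<^sub>E j\<in>J. X j \<rightarrow>\<^sub>E Y j)"
    and g: "g = (X, \<psi>, Y)" "\<psi> \<in> (\<Pi>\<^sub>E j\<in>J. X j \<rightarrow>\<^sub>E Y j)"
    using assms(1,2) by (auto simp: hom_set_family_cat)
  have "\<phi> = \<psi>"
  proof (rule PiE_ext[OF f(2) g(2)])
    fix j assume j: "j \<in> J"
    show "\<phi> j = \<psi> j"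
      by (rule PiE_ext[of _ "X j" "\<lambda>_. Y j"]) (use assms(3) j f g in \<open>auto simp: app_def\<close>)
  qed
  then show ?thesis by (simp add: f g)
qed

lemma Idn_family_hom: "X \<in> families J \<Longrightarrow> Idn (family_cat J) X \<in> hom_set (family_cat J) X X"
  by (auto simp: hom_set_family_cat Idn_family_cat)

lemma Cmp_family_hom:
  assumes "f \<in> hom_set (family_cat J) X Y" and "g \<in> hom_set (family_cat J) Y Z"
  shows "Cmp (family_cat J) g f \<in> hom_set (family_cat J) X Z"
proof -
  obtain \<phi> \<psi> where "f = (X, \<phi>, Y)" "g = (Y, \<psi>, Z)"
    using assms by (auto simp: hom_set_family_cat)
  then show ?thesis
    using assms by (auto simp: hom_set_family_cat Cmp_family_cat intro!: restrict_PiE_iff[THEN iffD2])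
qed

lemma category_family_cat: "category (family_cat J)"
proof
  fix f assume "f \<in> Arr (family_cat J)"
  then show "Dom (family_cat J) f \<in> Obj (family_cat J)" "Cod (family_cat J) f \<in> Obj (family_cat J)"
    by (auto simp: family_cat_def)
next
  fix X assume "X \<in> Obj (family_cat J)"
  then show "Idn (family_cat J) X \<in> hom_set (family_cat J) X X"
    by (simp add: Idn_family_hom)
next
  fix f g X Y Z
  assume "f \<in> hom_set (family_cat J) X Y" "g \<in> hom_set (family_cat J) Y Z"
  then show "Cmp (family_cat J) g f \<in> hom_set (family_cat J) X Z"
    by (rule Cmp_family_hom)
next
  fix f X Y assume f: "f \<in> hom_set (family_cat J) X Y"
  note o = hom_families[OF f]
  show "Cmp (family_cat J) f (Idn (family_cat J) X) = f"
    by (rule family_arr_eqI[OF Cmp_family_hom[OF Idn_family_hom[OF o(1)] f] f])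
      (simp add: app_Cmp[OF Idn_family_hom[OF o(1)] f])
  show "Cmp (family_cat J) (Idn (family_cat J) Y) f = f"
    by (rule family_arr_eqI[OF Cmp_family_hom[OF f Idn_family_hom[OF o(2)]] f])
      (simp add: app_Cmp[OF f Idn_family_hom[OF o(2)]] app_in[OF f])
next
  fix f g h W X Y Z
  assume f: "f \<in> hom_set (family_cat J) W X" and g: "g \<in> hom_set (family_cat J) X Y"
    and h: "h \<in> hom_set (family_cat J) Y Z"
  note fg = Cmp_family_hom[OF f g] and gh = Cmp_family_hom[OF g h]
  show "Cmp (family_cat J) h (Cmp (family_cat J) g f) = Cmp (family_cat J) (Cmp (family_cat J) h g) f"
    by (rule family_arr_eqI[OF Cmp_family_hom[OF fg h] Cmp_family_hom[OF f gh]])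
      (simp add: app_Cmp[OF fg h] app_Cmp[OF f gh] app_Cmp[OF f g] app_Cmp[OF g h] app_in[OF f])
qed

lemma iso_arr_family_cat:
  assumes f: "f \<in> hom_set (family_cat J) X Y"
    and bij: "\<And>j. j \<in> J \<Longrightarrow> bij_betw (app f j) (X j) (Y j)"
  shows "iso_arr (family_cat J) X Y f"
proof -
  define g where "g = mk_arr J Y (\<lambda>j. the_inv_into (X j) (app f j)) X"
  have inj: "inj_on (app f j) (X j)" and im: "app f j ` X j = Y j" if "j \<in> J" for j
    using bij[OF that] by (auto simp: bij_betw_def)
  have g: "g \<in> hom_set (family_cat J) Y X"
    unfolding g_def using hom_families[OF f]
    by (intro mk_arr_hom) (auto intro!: the_inv_into_into inj simp: im)
  have app_g: "app g j y = the_inv_into (X j) (app f j) y" if "j \<in> J" "y \<in> Y j" for j y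
    using that by (simp add: g_def)
  have "Cmp (family_cat J) g f = Idn (family_cat J) X"
    by (rule family_arr_eqI[OF Cmp_family_hom[OF f g] Idn_family_hom[OF hom_families(1)[OF f]]])
      (simp add: app_Cmp[OF f g] app_in[OF f] app_g the_inv_into_f_f[OF inj])
  moreover have "Cmp (family_cat J) f g = Idn (family_cat J) Y"
    by (rule family_arr_eqI[OF Cmp_family_hom[OF g f] Idn_family_hom[OF hom_families(2)[OF f]]])
      (simp add: app_Cmp[OF g f] app_g f_the_inv_into_f[OF inj] im)
  ultimately show ?thesis using f g by (auto simp: iso_arr_def)
qed

section \<open>Monoidal categories from an inverse associator\<close>

definition inv_arr :: "('o, 'a) cat \<Rightarrow> 'o \<Rightarrow> 'o \<Rightarrow> 'a \<Rightarrow> 'a" where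
  "inv_arr C X Y f = (SOME g. g \<in> hom_set C Y X \<and> Cmp C g f = Idn C X \<and> Cmp C f g = Idn C Y)"

lemma inv_arr:
  assumes "iso_arr C X Y f"
  shows "inv_arr C X Y f \<in> hom_set C Y X" and "Cmp C (inv_arr C X Y f) f = Idn C X"
    and "Cmp C f (inv_arr C X Y f) = Idn C Y"
  using someI_ex[of "\<lambda>g. g \<in> hom_set C Y X \<and> Cmp C g f = Idn C X \<and> Cmp C f g = Idn C Y"] assms
  by (auto simp: iso_arr_def inv_arr_def)

lemma iso_arr_inv_arr: "iso_arr C X Y f \<Longrightarrow> iso_arr C Y X (inv_arr C X Y f)"
  using inv_arr[of C X Y f] by (auto simp: iso_arr_def)

context category
begin

text \<open>Insert \<open>a\<close> followed by its inverse before \<open>g\<close>, replace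
  \<open>g\<close> after \<open>a\<close> by \<open>b\<close> after \<open>f\<close>, and cancel
  \<open>b\<close> against its inverse.\<close>

lemma inv_arr_natural:
  assumes a: "iso_arr C X Y a" and b: "iso_arr C X' Y' b"
    and f: "f \<in> hom_set C X X'" and g: "g \<in> hom_set C Y Y'"
    and eq: "Cmp C b f = Cmp C g a"
  shows "Cmp C (inv_arr C X' Y' b) g = Cmp C f (inv_arr C X Y a)"
proof -
  let ?a = "inv_arr C X Y a" and ?b = "inv_arr C X' Y' b"
  note A = inv_arr[OF a] and B = inv_arr[OF b]
  have ah: "a \<in> hom_set C X Y" and bh: "b \<in> hom_set C X' Y'"
    using a b by (auto simp: iso_arr_def)
  have "Cmp C ?b g = Cmp C ?b (Cmp C g (Cmp C a ?a))"
    by (simp add: A cmp_idn_right[OF g])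
  also have "\<dots> = Cmp C ?b (Cmp C (Cmp C b f) ?a)"
    by (simp add: cmp_assoc[OF A(1) ah g] eq)
  also have "\<dots> = Cmp C (Cmp C ?b b) (Cmp C f ?a)"
    using cmp_assoc[OF A(1) f bh] cmp_assoc[OF cmp_hom[OF A(1) f] bh B(1)] by simp
  also have "\<dots> = Cmp C f ?a"
    by (simp add: B cmp_idn_left[OF cmp_hom[OF A(1) f]])
  finally show ?thesis .
qed

lemma cmp_inverse:
  assumes "f \<in> hom_set C X Y" "g \<in> hom_set C Y Z" "f' \<in> hom_set C Y X" "g' \<in> hom_set C Z Y"
    and "Cmp C f' f = Idn C X" and "Cmp C g' g = Idn C Y"
  shows "Cmp C (Cmp C f' g') (Cmp C g f) = Idn C X"
proof -
  have "Cmp C (Cmp C f' g') (Cmp C g f) = Cmp C f' (Cmp C (Cmp C g' g) f)"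
    using cmp_assoc[OF cmp_hom[OF assms(1,2)] assms(4,3)] cmp_assoc[OF assms(1,2,4)] by simp
  then show ?thesis by (simp add: assms cmp_idn_left[OF assms(1)])
qed

text \<open>The composite of \<open>g\<close>, \<open>f\<close> and \<open>h\<close>, bracketed in
  the two possible ways, is \<open>h\<close> and \<open>g\<close>.\<close>

lemma inverse_unique:
  assumes "f \<in> hom_set C X Y" "g \<in> hom_set C Y X" "h \<in> hom_set C Y X"
    and "Cmp C g f = Idn C X" and "Cmp C f h = Idn C Y"
  shows "g = h"
  using cmp_assoc[OF assms(3,1,2)] assms
  by (simp add: cmp_idn_left[OF assms(3)] cmp_idn_right[OF assms(2)])

end

context category_with_tensor
begin

lemma tensor_hom:
  assumes "f \<in> hom_set C X X'" and "g \<in> hom_set C Y Y'"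
  shows "f \<otimes>\<^sub>a g \<in> hom_set C (X \<otimes> Y) (X' \<otimes> Y')"
  using arr_map[of "(f, g)" "(X, Y)" "(X', Y')"] assms by (simp add: hom_set_prod_cat)

lemma tensor_cmp:
  assumes "f \<in> hom_set C X X'" "g \<in> hom_set C Y Y'" "f' \<in> hom_set C X' X''" "g' \<in> hom_set C Y' Y''"
  shows "(f' \<cdot> f) \<otimes>\<^sub>a (g' \<cdot> g) = (f' \<otimes>\<^sub>a g') \<cdot> (f \<otimes>\<^sub>a g)"
  using map_cmp[of "(f, g)" "(X, Y)" "(X', Y')" "(f', g')" "(X'', Y'')"] assms
  by (simp add: hom_set_prod_cat) (simp add: prod_cat_def)

lemma tensor_idn:
  assumes "X \<in> Obj C" and "Y \<in> Obj C"
  shows "idn X \<otimes>\<^sub>a idn Y = idn (X \<otimes> Y)"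
  using map_idn[of "(X, Y)"] assms by (simp add: prod_cat_def)

lemma tensor_obj_closed: "X \<in> Obj C \<Longrightarrow> Y \<in> Obj C \<Longrightarrow> X \<otimes> Y \<in> Obj C"
  using obj_map[of "(X, Y)"] by (simp add: prod_cat_def)

text \<open>Coherence diagrams stay commutative when all their associators are inverted. Hence the
  laws may be checked for isomorphisms in the direction from
  \<open>X \<otimes> (Y \<otimes> Z)\<close> to \<open>(X \<otimes> Y) \<otimes> Z\<close>, which is
  the computable one here.\<close>

lemma monoidal_category_of_inverse_associator:
  assumes unit: "U \<in> Obj C"
    and iso: "\<And>X Y Z. \<lbrakk>X \<in> Obj C; Y \<in> Obj C; Z \<in> Obj C\<rbrakk>
        \<Longrightarrow> iso_arr C (X \<otimes> (Y \<otimes> Z)) ((X \<otimes> Y) \<otimes> Z) (a X Y Z)"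
    and lunit_iso: "\<And>X. X \<in> Obj C \<Longrightarrow> iso_arr C (U \<otimes> X) X (lunit X)"
    and runit_iso: "\<And>X. X \<in> Obj C \<Longrightarrow> iso_arr C (X \<otimes> U) X (runit X)"
    and natural: "\<And>f g h X X' Y Y' Z Z'.
        \<lbrakk>f \<in> hom_set C X X'; g \<in> hom_set C Y Y'; h \<in> hom_set C Z Z'\<rbrakk>
        \<Longrightarrow> a X' Y' Z' \<cdot> (f \<otimes>\<^sub>a (g \<otimes>\<^sub>a h)) = ((f \<otimes>\<^sub>a g) \<otimes>\<^sub>a h) \<cdot> a X Y Z"
    and lunit_natural: "\<And>f X X'. f \<in> hom_set C X X' \<Longrightarrow> lunit X' \<cdot> (idn U \<otimes>\<^sub>a f) = f \<cdot> lunit X"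
    and runit_natural: "\<And>f X X'. f \<in> hom_set C X X' \<Longrightarrow> runit X' \<cdot> (f \<otimes>\<^sub>a idn U) = f \<cdot> runit X"
    and pentagon: "\<And>W X Y Z. \<lbrakk>W \<in> Obj C; X \<in> Obj C; Y \<in> Obj C; Z \<in> Obj C\<rbrakk>
        \<Longrightarrow> a (W \<otimes> X) Y Z \<cdot> a W X (Y \<otimes> Z) =
            ((a W X Y \<otimes>\<^sub>a idn Z) \<cdot> a W (X \<otimes> Y) Z) \<cdot> (idn W \<otimes>\<^sub>a a X Y Z)"
    and triangle: "\<And>X Y. \<lbrakk>X \<in> Obj C; Y \<in> Obj C\<rbrakk>
        \<Longrightarrow> (runit X \<otimes>\<^sub>a idn Y) \<cdot> a X U Y = idn X \<otimes>\<^sub>a lunit Y"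
  shows "\<exists>assoc. monoidal_category C T U assoc lunit runit"
proof
  define b where "b X Y Z = inv_arr C (X \<otimes> (Y \<otimes> Z)) ((X \<otimes> Y) \<otimes> Z) (a X Y Z)" for X Y Z
  have a: "a X Y Z \<in> hom_set C (X \<otimes> (Y \<otimes> Z)) ((X \<otimes> Y) \<otimes> Z)"
    and b: "b X Y Z \<in> hom_set C ((X \<otimes> Y) \<otimes> Z) (X \<otimes> (Y \<otimes> Z))"
    and ba: "b X Y Z \<cdot> a X Y Z = idn (X \<otimes> (Y \<otimes> Z))"
    and ab: "a X Y Z \<cdot> b X Y Z = idn ((X \<otimes> Y) \<otimes> Z)"
    if "X \<in> Obj C" "Y \<in> Obj C" "Z \<in> Obj C" for X Y Z
    using inv_arr[OF iso[OF that]] iso[OF that] by (auto simp: b_def iso_arr_def)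
  note o = tensor_obj_closed
  show "monoidal_category C T U b lunit runit"
  proof
    show "U \<in> Obj C" by (fact unit)
  next
    fix X Y Z assume "X \<in> Obj C" "Y \<in> Obj C" "Z \<in> Obj C"
    then show "iso_arr C ((X \<otimes> Y) \<otimes> Z) (X \<otimes> (Y \<otimes> Z)) (b X Y Z)"
      unfolding b_def by (intro iso_arr_inv_arr iso)
  next
    fix X assume "X \<in> Obj C"
    then show "iso_arr C (U \<otimes> X) X (lunit X)" "iso_arr C (X \<otimes> U) X (runit X)"
      by (fact lunit_iso runit_iso)+
  next
    fix f g h X X' Y Y' Z Z'
    assume h: "f \<in> hom_set C X X'" "g \<in> hom_set C Y Y'" "h \<in> hom_set C Z Z'"
    then have "X \<in> Obj C" "X' \<in> Obj C" "Y \<in> Obj C" "Y' \<in> Obj C" "Z \<in> Obj C" "Z' \<in> Obj C"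
      using dom_cat.dom_obj dom_cat.cod_obj by (auto simp: hom_set_def intro: dom_obj cod_obj)
    then show "b X' Y' Z' \<cdot> ((f \<otimes>\<^sub>a g) \<otimes>\<^sub>a h) = (f \<otimes>\<^sub>a (g \<otimes>\<^sub>a h)) \<cdot> b X Y Z"
      unfolding b_def by (intro inv_arr_natural iso natural tensor_hom h)
  next
    fix f X X' assume f: "f \<in> hom_set C X X'"
    show "lunit X' \<cdot> (idn U \<otimes>\<^sub>a f) = f \<cdot> lunit X" by (rule lunit_natural[OF f])
    show "runit X' \<cdot> (f \<otimes>\<^sub>a idn U) = f \<cdot> runit X" by (rule runit_natural[OF f])
  next
    fix W X Y Z assume O: "W \<in> Obj C" "X \<in> Obj C" "Y \<in> Obj C" "Z \<in> Obj C"
    let ?l = "a (W \<otimes> X) Y Z \<cdot> a W X (Y \<otimes> Z)"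
    let ?s = "W \<otimes> (X \<otimes> (Y \<otimes> Z))" and ?t = "((W \<otimes> X) \<otimes> Y) \<otimes> Z"
    have l: "?l \<in> hom_set C ?s ?t"
      by (rule cmp_hom[OF a a]; intro o O)
    have li: "b W X (Y \<otimes> Z) \<cdot> b (W \<otimes> X) Y Z \<in> hom_set C ?t ?s"
      by (rule cmp_hom[OF b b]; intro o O)
    \<comment> \<open>One side of the wanted pentagon is a left inverse of \<open>?l\<close>. The
      other side is a right inverse (fact \<open>2\<close>), once \<open>?l\<close> has been
      rewritten by the pentagon for \<open>a\<close>. Hence they are equal.\<close>
    have 1: "(b W X (Y \<otimes> Z) \<cdot> b (W \<otimes> X) Y Z) \<cdot> ?l = idn ?s"
      by (rule cmp_inverse[OF a a b b ba ba]) (intro o O)+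
    have wb: "idn W \<otimes>\<^sub>a b X Y Z \<in> hom_set C (W \<otimes> ((X \<otimes> Y) \<otimes> Z)) ?s"
      and wa: "idn W \<otimes>\<^sub>a a X Y Z \<in> hom_set C ?s (W \<otimes> ((X \<otimes> Y) \<otimes> Z))"
      and zb: "b W X Y \<otimes>\<^sub>a idn Z \<in> hom_set C ?t ((W \<otimes> (X \<otimes> Y)) \<otimes> Z)"
      and za: "a W X Y \<otimes>\<^sub>a idn Z \<in> hom_set C ((W \<otimes> (X \<otimes> Y)) \<otimes> Z) ?t"
      by (intro tensor_hom a b o O idn_hom)+
    have mb: "b W (X \<otimes> Y) Z \<in> hom_set C ((W \<otimes> (X \<otimes> Y)) \<otimes> Z) (W \<otimes> ((X \<otimes> Y) \<otimes> Z))"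
      and ma: "a W (X \<otimes> Y) Z \<in> hom_set C (W \<otimes> ((X \<otimes> Y) \<otimes> Z)) ((W \<otimes> (X \<otimes> Y)) \<otimes> Z)"
      by (intro a b o O)+
    have wi: "(idn W \<otimes>\<^sub>a a X Y Z) \<cdot> (idn W \<otimes>\<^sub>a b X Y Z) = idn (W \<otimes> ((X \<otimes> Y) \<otimes> Z))"
      using tensor_cmp[OF idn_hom[OF O(1)] b[OF O(2-4)] idn_hom[OF O(1)] a[OF O(2-4)]] O
      by (simp add: ab cmp_idn_left[OF idn_hom] tensor_idn o)
    have zi: "(a W X Y \<otimes>\<^sub>a idn Z) \<cdot> (b W X Y \<otimes>\<^sub>a idn Z) = idn ?t"
      using tensor_cmp[OF b[OF O(1-3)] idn_hom[OF O(4)] a[OF O(1-3)] idn_hom[OF O(4)]] O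
      by (simp add: ab cmp_idn_left[OF idn_hom] tensor_idn o)
    have 2: "?l \<cdot> ((idn W \<otimes>\<^sub>a b X Y Z) \<cdot> b W (X \<otimes> Y) Z \<cdot> (b W X Y \<otimes>\<^sub>a idn Z)) = idn ?t"
      unfolding pentagon[OF O]
      by (rule cmp_inverse[OF cmp_hom[OF zb mb] wb cmp_hom[OF ma za] wa _ wi])
        (rule cmp_inverse[OF zb mb za ma zi ab], (intro o O)+)
    show "b W X (Y \<otimes> Z) \<cdot> b (W \<otimes> X) Y Z =
        (idn W \<otimes>\<^sub>a b X Y Z) \<cdot> b W (X \<otimes> Y) Z \<cdot> (b W X Y \<otimes>\<^sub>a idn Z)"
      by (rule inverse_unique[OF l li _ 1 2]) (intro cmp_hom[OF _ wb] cmp_hom[OF zb mb])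
  next
    fix X Y assume O: "X \<in> Obj C" "Y \<in> Obj C"
    have r: "runit X \<otimes>\<^sub>a idn Y \<in> hom_set C ((X \<otimes> U) \<otimes> Y) (X \<otimes> Y)"
      using runit_iso O by (intro tensor_hom idn_hom) (auto simp: iso_arr_def)
    show "(idn X \<otimes>\<^sub>a lunit Y) \<cdot> b X U Y = runit X \<otimes>\<^sub>a idn Y"
      using cmp_assoc[OF b[OF O(1) unit O(2)] a[OF O(1) unit O(2)] r] O unit
      by (simp add: triangle[OF O, symmetric] ab cmp_idn_right[OF r])
  qed
qed

end

section \<open>The tensor product of a cut structure\<close>

text \<open>Here \<open>J\<close> stands for the trees, \<open>le r t\<close> for a cut
  \<open>r\<close> of \<open>t\<close>, \<open>lv\<close> for the leaves, \<open>sub t p\<close> for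
  the part of \<open>t\<close> above \<open>p\<close>, and \<open>Tr\<close> for the trivial trees.
  The axioms \<open>graft\<close> and \<open>graft_unique\<close> say that trees between
  \<open>r\<close> and \<open>t\<close> amount to a choice of a cut of \<open>sub t p\<close> at
  every leaf \<open>p\<close> of \<open>r\<close>; with the description of leaves by
  \<open>lv_append\<close>, \<open>lv_split\<close> and \<open>lv_prefix_unique\<close> this makes
  the associator bijective. The left unit rests on \<open>sub_leaf\<close> and
  \<open>le_full\<close>, the right unit on the existence and uniqueness of a trivial cut and on
  \<open>sub_Nil\<close>. Leaves are lists so that passing to a part of a part is concatenation,
  which is strictly associative.\<close>

locale cut_structure =
  fixes J :: "'j set" and le :: "'j \<Rightarrow> 'j \<Rightarrow> bool" and lv :: "'j \<Rightarrow> 'e list set"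
    and sub :: "'j \<Rightarrow> 'e list \<Rightarrow> 'j" and Tr :: "'j set"
  assumes le_closed: "le r t \<Longrightarrow> r \<in> J \<and> t \<in> J"
    and le_refl: "t \<in> J \<Longrightarrow> le t t"
    and le_trans: "\<lbrakk>le r s; le s t\<rbrakk> \<Longrightarrow> le r t"
    and finite_le: "t \<in> J \<Longrightarrow> finite {r. le r t}"
    and finite_lv: "r \<in> J \<Longrightarrow> finite (lv r)"
    and sub_closed: "\<lbrakk>le r t; p \<in> lv r\<rbrakk> \<Longrightarrow> sub t p \<in> J"
    and sub_le: "\<lbrakk>le r s; le s t; p \<in> lv r\<rbrakk> \<Longrightarrow> le (sub s p) (sub t p)"
    and lv_append: "\<lbrakk>le r s; p \<in> lv r; q \<in> lv (sub s p)\<rbrakk> \<Longrightarrow> p @ q \<in> lv s"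
    and lv_split: "\<lbrakk>le r s; l \<in> lv s\<rbrakk> \<Longrightarrow> \<exists>p\<in>lv r. \<exists>q\<in>lv (sub s p). l = p @ q"
    and lv_prefix_unique: "\<lbrakk>r \<in> J; p \<in> lv r; p' \<in> lv r; p @ q = p' @ q'\<rbrakk> \<Longrightarrow> p = p'"
    and sub_sub: "\<lbrakk>le r s; le s t; p \<in> lv r; q \<in> lv (sub s p)\<rbrakk> \<Longrightarrow> sub (sub t p) q = sub t (p @ q)"
    and graft_unique: "\<lbrakk>le r s; le s t; le r s'; le s' t; \<And>p. p \<in> lv r \<Longrightarrow> sub s p = sub s' p\<rbrakk> \<Longrightarrow> s = s'"
    and graft: "\<lbrakk>le r t; \<And>p. p \<in> lv r \<Longrightarrow> le (u p) (sub t p)\<rbrakk>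
        \<Longrightarrow> \<exists>s. le r s \<and> le s t \<and> (\<forall>p\<in>lv r. sub s p = u p)"
    and trivial_closed: "r \<in> Tr \<Longrightarrow> r \<in> J"
    and trivial_le: "t \<in> J \<Longrightarrow> \<exists>r\<in>Tr. le r t"
    and trivial_le_unique: "\<lbrakk>le r t; le r' t; r \<in> Tr; r' \<in> Tr\<rbrakk> \<Longrightarrow> r = r'"
    and lv_trivial: "r \<in> Tr \<Longrightarrow> lv r = {[]}"
    and sub_Nil: "t \<in> J \<Longrightarrow> sub t [] = t"
    and sub_leaf: "\<lbrakk>t \<in> J; p \<in> lv t\<rbrakk> \<Longrightarrow> sub t p \<in> Tr"
    and le_full: "\<lbrakk>le r t; \<And>p. p \<in> lv r \<Longrightarrow> sub t p \<in> Tr\<rbrakk> \<Longrightarrow> r = t"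
begin

definition cut_terms :: "('j, 'u) family \<Rightarrow> ('j, 'u) family \<Rightarrow> 'j \<Rightarrow> ('j \<times> ('e list \<Rightarrow> 'u) \<times> 'u) set" where
  "cut_terms X Y t = {(r, x, y). le r t \<and> x \<in> (\<Pi>\<^sub>E p\<in>lv r. X (sub t p)) \<and> y \<in> Y r}"

lemma finite_cut_terms:
  assumes "X \<in> families J" and "Y \<in> families J" and "t \<in> J"
  shows "finite (cut_terms X Y t)"
proof (rule finite_subset)
  show "cut_terms X Y t \<subseteq> (SIGMA r : {r. le r t}. (\<Pi>\<^sub>E p\<in>lv r. X (sub t p)) \<times> Y r)"
    by (auto simp: cut_terms_def)
  show "finite (SIGMA r : {r. le r t}. (\<Pi>\<^sub>E p\<in>lv r. X (sub t p)) \<times> Y r)"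
    using assms
    by (intro finite_SigmaI finite_le finite_cartesian_product finite_PiE)
      (auto dest: le_closed sub_closed intro: finite_lv simp: families_def PiE_iff)
qed

end

text \<open>An abstract tensor product whose elements are encoded terms. Nothing is assumed about
  \<open>enc\<close> beyond injectivity, since the actual encoding is an arbitrary choice;
  \<open>star t\<close> names the only element of the unit at a trivial tree.\<close>

locale cut_tensor = cut_structure J le lv sub Tr
  for J :: "'j set" and le :: "'j \<Rightarrow> 'j \<Rightarrow> bool" and lv :: "'j \<Rightarrow> 'e list set"
    and sub :: "'j \<Rightarrow> 'e list \<Rightarrow> 'j" and Tr :: "'j set" +
  fixes T :: "(('j, 'u) family \<times> ('j, 'u) family, ('j, 'u) family_map \<times> ('j, 'u) family_map,
      ('j, 'u) family, ('j, 'u) family_map) fctr"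
    and enc :: "('j, 'u) family \<Rightarrow> ('j, 'u) family \<Rightarrow> 'j \<Rightarrow> 'j \<times> ('e list \<Rightarrow> 'u) \<times> 'u \<Rightarrow> 'u"
    and U :: "('j, 'u) family" and star :: "'j \<Rightarrow> 'u"
  assumes enc_inj: "\<lbrakk>X \<in> families J; Y \<in> families J; t \<in> J\<rbrakk> \<Longrightarrow> inj_on (enc X Y t) (cut_terms X Y t)"
    and on_obj_T: "\<lbrakk>X \<in> families J; Y \<in> families J\<rbrakk>
        \<Longrightarrow> on_obj T (X, Y) = (\<lambda>t\<in>J. enc X Y t ` cut_terms X Y t)"
    and on_arr_T: "\<lbrakk>f \<in> hom_set (family_cat J) X X'; g \<in> hom_set (family_cat J) Y Y'\<rbrakk>
        \<Longrightarrow> on_arr T (f, g) \<in> hom_set (family_cat J) (on_obj T (X, Y)) (on_obj T (X', Y'))"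
    and app_on_arr_T: "\<lbrakk>f \<in> hom_set (family_cat J) X X'; g \<in> hom_set (family_cat J) Y Y';
          (r, x, y) \<in> cut_terms X Y t\<rbrakk>
        \<Longrightarrow> app (on_arr T (f, g)) t (enc X Y t (r, x, y)) =
            enc X' Y' t (r, \<lambda>p\<in>lv r. app f (sub t p) (x p), app g r y)"
    and U_families: "U \<in> families J"
    and U_trivial: "t \<in> Tr \<Longrightarrow> U t = {star t}"
    and U_nontrivial: "t \<in> J \<Longrightarrow> t \<notin> Tr \<Longrightarrow> U t = {}"
begin

section \<open>Encoded terms and functoriality of the tensor product\<close>

abbreviation C where "C \<equiv> family_cat J"
abbreviation tensor (infixr "\<otimes>" 70) where "X \<otimes> Y \<equiv> on_obj T (X, Y)"
abbreviation tensor_arr (infixr "\<otimes>\<^sub>a" 70) where "f \<otimes>\<^sub>a g \<equiv> on_arr T (f, g)"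

lemma tensor_families: "X \<in> families J \<Longrightarrow> Y \<in> families J \<Longrightarrow> X \<otimes> Y \<in> families J"
  by (simp add: on_obj_T families_def[of J] PiE_iff) (simp add: families_def finite_cut_terms PiE_iff)

lemma enc_mem:
  assumes "X \<in> families J" "Y \<in> families J" "le r t" "x \<in> (\<Pi>\<^sub>E p\<in>lv r. X (sub t p))" "y \<in> Y r"
  shows "enc X Y t (r, x, y) \<in> (X \<otimes> Y) t"
  using assms le_closed[OF assms(3)] by (auto simp: on_obj_T cut_terms_def)

lemma enc_cases:
  assumes "v \<in> (X \<otimes> Y) t" and "X \<in> families J" and "Y \<in> families J" and "t \<in> J"
  obtains r x y where "v = enc X Y t (r, x, y)" and "le r t"
    and "x \<in> (\<Pi>\<^sub>E p\<in>lv r. X (sub t p))" and "y \<in> Y r"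
  using assms by (auto simp: on_obj_T cut_terms_def)

lemma enc_eq_iff:
  assumes "X \<in> families J" "Y \<in> families J"
    and "le r t" "x \<in> (\<Pi>\<^sub>E p\<in>lv r. X (sub t p))" "y \<in> Y r"
    and "le r' t" "x' \<in> (\<Pi>\<^sub>E p\<in>lv r'. X (sub t p))" "y' \<in> Y r'"
  shows "enc X Y t (r, x, y) = enc X Y t (r', x', y') \<longleftrightarrow> r = r' \<and> x = x' \<and> y = y'"
  using inj_on_eq_iff[OF enc_inj[OF assms(1,2)], of t "(r, x, y)" "(r', x', y')"]
    le_closed[OF assms(3)] assms
  by (auto simp: cut_terms_def)

definition dec where "dec X Y t = the_inv_into (cut_terms X Y t) (enc X Y t)"

lemma dec_enc:
  assumes "X \<in> families J" "Y \<in> families J" "le r t" "x \<in> (\<Pi>\<^sub>E p\<in>lv r. X (sub t p))" "y \<in> Y r"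
  shows "dec X Y t (enc X Y t (r, x, y)) = (r, x, y)"
  unfolding dec_def using assms le_closed[OF assms(3)]
  by (intro the_inv_into_f_f enc_inj) (auto simp: cut_terms_def)

lemma app_tensor_arr:
  assumes "f \<in> hom_set C X X'" "g \<in> hom_set C Y Y'"
    and "le r t" "x \<in> (\<Pi>\<^sub>E p\<in>lv r. X (sub t p))" "y \<in> Y r"
  shows "app (f \<otimes>\<^sub>a g) t (enc X Y t (r, x, y)) =
     enc X' Y' t (r, \<lambda>p\<in>lv r. app f (sub t p) (x p), app g r y)"
  using assms by (intro app_on_arr_T) (auto simp: cut_terms_def)

lemma app_in_PiE:
  assumes "f \<in> hom_set C X X'" and "le r t" and "x \<in> (\<Pi>\<^sub>E p\<in>lv r. X (sub t p))"
  shows "(\<lambda>p\<in>lv r. app f (sub t p) (x p)) \<in> (\<Pi>\<^sub>E p\<in>lv r. X' (sub t p))"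
  using assms by (auto intro!: app_in[OF assms(1)] sub_closed simp: PiE_iff)

lemma category_with_tensor: "category_with_tensor C T"
proof -
  have cat: "category C" by (rule category_family_cat)
  have P: "category (prod_cat C C)" by (intro category_prod_cat cat)
  interpret P: category "prod_cat C C" by fact
  interpret C: category C by fact
  have "cat_functor (prod_cat C C) C T"
  \<comment> \<open>The four cases are \<open>obj_map\<close>, \<open>arr_map\<close>,
    \<open>map_idn\<close> and \<open>map_cmp\<close>, in this order.\<close>
  proof (unfold_locales, goal_cases)
    case (1 X)
    then show ?case by (auto simp: prod_cat_def tensor_families)
  next
    case (2 f X Y)
    then show ?case
      by (cases f; cases X; cases Y) (simp add: hom_set_prod_cat on_arr_T)
  next
    case (3 XY)
    then obtain X Y where XY: "XY = (X, Y)" and X: "X \<in> families J" and Y: "Y \<in> families J"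
      by (auto simp: prod_cat_def)
    note i = Idn_family_hom[OF X] Idn_family_hom[OF Y]
    have "Idn C X \<otimes>\<^sub>a Idn C Y = Idn C (X \<otimes> Y)"
    proof (rule family_arr_eqI[OF on_arr_T[OF i] Idn_family_hom[OF tensor_families[OF X Y]]])
      fix t v assume t: "t \<in> J" and v: "v \<in> (X \<otimes> Y) t"
      obtain r x y where e: "v = enc X Y t (r, x, y)" and r: "le r t"
        and x: "x \<in> (\<Pi>\<^sub>E p\<in>lv r. X (sub t p))" and y: "y \<in> Y r"
        using enc_cases[OF v X Y t] .
      have "(\<lambda>p\<in>lv r. app (Idn C X) (sub t p) (x p)) = x"
        using x sub_closed[OF r] by (intro extensionalityI[of _ "lv r"]) (auto simp: PiE_iff)
      then show "app (Idn C X \<otimes>\<^sub>a Idn C Y) t v = app (Idn C (X \<otimes> Y)) t v"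
        using t v y le_closed[OF r] unfolding e by (simp add: app_tensor_arr[OF i r x y])
    qed
    then show ?case by (simp add: XY prod_cat_def)
  next
    case (4 f X Y g Z)
    obtain f1 f2 g1 g2 X1 X2 Y1 Y2 Z1 Z2 where
      e: "f = (f1, f2)" "g = (g1, g2)" "X = (X1, X2)" "Y = (Y1, Y2)" "Z = (Z1, Z2)"
      by (metis surj_pair)
    have f: "f1 \<in> hom_set C X1 Y1" "f2 \<in> hom_set C X2 Y2"
      and g: "g1 \<in> hom_set C Y1 Z1" "g2 \<in> hom_set C Y2 Z2"
      using 4 by (auto simp: e hom_set_prod_cat)
    note fg = Cmp_family_hom[OF f(1) g(1)] Cmp_family_hom[OF f(2) g(2)]
    note o = hom_families[OF f(1)] hom_families[OF f(2)]
    have "Cmp C g1 f1 \<otimes>\<^sub>a Cmp C g2 f2 = Cmp C (g1 \<otimes>\<^sub>a g2) (f1 \<otimes>\<^sub>a f2)"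
    proof (rule family_arr_eqI[OF on_arr_T[OF fg] Cmp_family_hom[OF on_arr_T[OF f] on_arr_T[OF g]]])
      fix t v assume t: "t \<in> J" and v: "v \<in> (X1 \<otimes> X2) t"
      obtain r x y where e: "v = enc X1 X2 t (r, x, y)" and r: "le r t"
        and x: "x \<in> (\<Pi>\<^sub>E p\<in>lv r. X1 (sub t p))" and y: "y \<in> X2 r"
        using enc_cases[OF v o(1,3) t] .
      have rJ: "r \<in> J" using le_closed[OF r] by simp
      have "(\<lambda>p\<in>lv r. app (Cmp C g1 f1) (sub t p) (x p)) =
          (\<lambda>p\<in>lv r. app g1 (sub t p) ((\<lambda>p\<in>lv r. app f1 (sub t p) (x p)) p))"
        using PiE_mem[OF x] by (intro restrict_ext) (simp add: app_Cmp[OF f(1) g(1)] sub_closed[OF r])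
      then show "app (Cmp C g1 f1 \<otimes>\<^sub>a Cmp C g2 f2) t v = app (Cmp C (g1 \<otimes>\<^sub>a g2) (f1 \<otimes>\<^sub>a f2)) t v"
        using v unfolding e
        by (simp add: app_Cmp[OF on_arr_T[OF f] on_arr_T[OF g] t] app_tensor_arr[OF fg r x y]
          app_tensor_arr[OF f r x y] app_Cmp[OF f(2) g(2) rJ y]
          app_tensor_arr[OF g r app_in_PiE[OF f(1) r x] app_in[OF f(2) rJ y]])
    qed
    then show ?case by (simp add: e prod_cat_def)
  qed
  then show ?thesis using cat by (simp add: category_with_tensor_def)
qed

section \<open>The associator\<close>

definition split_terms where
  "split_terms X Y t s x r y =
     (\<lambda>p\<in>lv r. enc X Y (sub t p) (sub s p, \<lambda>q\<in>lv (sub s p). x (p @ q), y p))"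

text \<open>
  For cuts \<open>r \<le> s \<le> t\<close>, the trees of \<open>t\<close> above \<open>r\<close> are cut by those of \<open>s\<close> above \<open>r\<close>.
  This direction of the associator needs no grafting of trees, so it is the one to compute with.
\<close>

definition unassoc where
  "unassoc X Y Z = mk_arr J (X \<otimes> (Y \<otimes> Z))
     (\<lambda>t v. case dec X (Y \<otimes> Z) t v of (s, x, w) \<Rightarrow> case dec Y Z s w of (r, y, z) \<Rightarrow>
        enc (X \<otimes> Y) Z t (r, split_terms X Y t s x r y, z))
     ((X \<otimes> Y) \<otimes> Z)"

text \<open>The values of \<open>x\<close> at the leaves of \<open>s\<close> above \<open>p\<close>
  decorate the cut \<open>sub s p\<close> of \<open>sub t p\<close>. The index sets agree because
  the part of \<open>sub t p\<close> above \<open>q\<close> is \<open>sub t (p @ q)\<close>.\<close>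

lemma shift_mem:
  assumes s: "le s t" and x: "x \<in> (\<Pi>\<^sub>E p\<in>lv s. X (sub t p))" and r: "le r s" and p: "p \<in> lv r"
  shows "(\<lambda>q\<in>lv (sub s p). x (p @ q)) \<in> (\<Pi>\<^sub>E q\<in>lv (sub s p). X (sub (sub t p) q))"
  using x by (auto simp: sub_sub[OF r s p] lv_append[OF r p])

lemma split_terms_mem:
  assumes "X \<in> families J" "Y \<in> families J"
    and "le s t" "x \<in> (\<Pi>\<^sub>E p\<in>lv s. X (sub t p))" "le r s" "y \<in> (\<Pi>\<^sub>E p\<in>lv r. Y (sub s p))"
  shows "split_terms X Y t s x r y \<in> (\<Pi>\<^sub>E p\<in>lv r. (X \<otimes> Y) (sub t p))"
  unfolding split_terms_def
proof (rule restrict_PiE_iff[THEN iffD2], rule ballI)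
  fix p assume p: "p \<in> lv r"
  show "enc X Y (sub t p) (sub s p, \<lambda>q\<in>lv (sub s p). x (p @ q), y p) \<in> (X \<otimes> Y) (sub t p)"
    by (rule enc_mem[OF assms(1,2) sub_le[OF assms(5,3) p]
        shift_mem[where X = X, OF assms(3,4,5) p] PiE_mem[OF assms(6) p]])
qed

lemma nested_cases:
  assumes v: "v \<in> (X \<otimes> (Y \<otimes> Z)) t" and X: "X \<in> families J" and Y: "Y \<in> families J"
    and Z: "Z \<in> families J" and t: "t \<in> J"
  obtains s x r y z where "v = enc X (Y \<otimes> Z) t (s, x, enc Y Z s (r, y, z))" and "le s t"
    and "x \<in> (\<Pi>\<^sub>E p\<in>lv s. X (sub t p))" and "le r s" and "y \<in> (\<Pi>\<^sub>E p\<in>lv r. Y (sub s p))" and "z \<in> Z r"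
proof -
  obtain s x w where 1: "v = enc X (Y \<otimes> Z) t (s, x, w)" "le s t" "x \<in> (\<Pi>\<^sub>E p\<in>lv s. X (sub t p))"
    and w: "w \<in> (Y \<otimes> Z) s"
    using enc_cases[OF v X tensor_families[OF Y Z] t] .
  have "s \<in> J" using 1 le_closed by blast
  then obtain r y z where "w = enc Y Z s (r, y, z)" "le r s" "y \<in> (\<Pi>\<^sub>E p\<in>lv r. Y (sub s p))" "z \<in> Z r"
    using enc_cases[OF w Y Z] by blast
  with 1 show ?thesis using that by blast
qed

lemma app_unassoc:
  assumes X: "X \<in> families J" and Y: "Y \<in> families J" and Z: "Z \<in> families J"
    and s: "le s t" and x: "x \<in> (\<Pi>\<^sub>E p\<in>lv s. X (sub t p))"
    and r: "le r s" and y: "y \<in> (\<Pi>\<^sub>E p\<in>lv r. Y (sub s p))" and z: "z \<in> Z r"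
  shows "app (unassoc X Y Z) t (enc X (Y \<otimes> Z) t (s, x, enc Y Z s (r, y, z))) =
     enc (X \<otimes> Y) Z t (r, split_terms X Y t s x r y, z)"
proof -
  have w: "enc Y Z s (r, y, z) \<in> (Y \<otimes> Z) s" using enc_mem[OF Y Z r y z] .
  note YZ = tensor_families[OF Y Z]
  show ?thesis
    using le_closed[OF s] enc_mem[OF X YZ s x w]
    by (simp add: unassoc_def dec_enc[OF X YZ s x w] dec_enc[OF Y Z r y z])
qed

lemma unassoc_hom:
  assumes X: "X \<in> families J" and Y: "Y \<in> families J" and Z: "Z \<in> families J"
  shows "unassoc X Y Z \<in> hom_set C (X \<otimes> (Y \<otimes> Z)) ((X \<otimes> Y) \<otimes> Z)"
proof -
  note YZ = tensor_families[OF Y Z] and XY = tensor_families[OF X Y]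
  show ?thesis
    unfolding unassoc_def
  proof (rule mk_arr_hom[OF tensor_families[OF X YZ] tensor_families[OF XY Z]])
    fix t v assume t: "t \<in> J" and v: "v \<in> (X \<otimes> (Y \<otimes> Z)) t"
    from nested_cases[OF v X Y Z t] obtain s x r y z
      where e: "v = enc X (Y \<otimes> Z) t (s, x, enc Y Z s (r, y, z))" and s: "le s t"
        and x: "x \<in> (\<Pi>\<^sub>E p\<in>lv s. X (sub t p))" and r: "le r s"
        and y: "y \<in> (\<Pi>\<^sub>E p\<in>lv r. Y (sub s p))" and z: "z \<in> Z r" .
    show "(case dec X (Y \<otimes> Z) t v of (s, x, w) \<Rightarrow> case dec Y Z s w of (r, y, z) \<Rightarrow>
        enc (X \<otimes> Y) Z t (r, split_terms X Y t s x r y, z)) \<in> ((X \<otimes> Y) \<otimes> Z) t"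
      unfolding e
      by (simp add: dec_enc[OF X YZ s x enc_mem[OF Y Z r y z]] dec_enc[OF Y Z r y z]
        enc_mem[OF XY Z le_trans[OF r s] split_terms_mem[OF X Y s x r y] z])
  qed
qed

text \<open>Equal images have the same \<open>r\<close> and, by injectivity of the inner encoding,
  the same cut \<open>sub s p\<close> with the same decorations over every leaf \<open>p\<close> of
  \<open>r\<close>. Then \<open>graft_unique\<close> recovers \<open>s\<close>, and
  \<open>lv_split\<close> recovers \<open>x\<close>, since each leaf of \<open>s\<close> lies above
  some leaf of \<open>r\<close>.\<close>

lemma unassoc_inj:
  assumes X: "X \<in> families J" and Y: "Y \<in> families J" and Z: "Z \<in> families J" and t: "t \<in> J"
  shows "inj_on (app (unassoc X Y Z) t) ((X \<otimes> (Y \<otimes> Z)) t)"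
proof (rule inj_onI)
  fix v v' assume v: "v \<in> (X \<otimes> (Y \<otimes> Z)) t" and v': "v' \<in> (X \<otimes> (Y \<otimes> Z)) t"
    and eq: "app (unassoc X Y Z) t v = app (unassoc X Y Z) t v'"
  from nested_cases[OF v X Y Z t] obtain s x r y z
    where e: "v = enc X (Y \<otimes> Z) t (s, x, enc Y Z s (r, y, z))" and s: "le s t"
      and x: "x \<in> (\<Pi>\<^sub>E p\<in>lv s. X (sub t p))" and r: "le r s"
      and y: "y \<in> (\<Pi>\<^sub>E p\<in>lv r. Y (sub s p))" and z: "z \<in> Z r" .
  from nested_cases[OF v' X Y Z t] obtain s' x' r' y' z'
    where e': "v' = enc X (Y \<otimes> Z) t (s', x', enc Y Z s' (r', y', z'))" and s': "le s' t"
      and x': "x' \<in> (\<Pi>\<^sub>E p\<in>lv s'. X (sub t p))" and r': "le r' s'"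
      and y': "y' \<in> (\<Pi>\<^sub>E p\<in>lv r'. Y (sub s' p))" and z': "z' \<in> Z r'" .
  have eq1: "r = r'" and eq2: "split_terms X Y t s x r y = split_terms X Y t s' x' r' y'" and "z = z'"
    using eq unfolding e e' app_unassoc[OF X Y Z s x r y z] app_unassoc[OF X Y Z s' x' r' y' z']
      enc_eq_iff[OF tensor_families[OF X Y] Z le_trans[OF r s] split_terms_mem[OF X Y s x r y] z
        le_trans[OF r' s'] split_terms_mem[OF X Y s' x' r' y'] z']
    by auto
  have r'': "le r s'" using r' eq1 by simp
  have *: "sub s p = sub s' p \<and> (\<lambda>q\<in>lv (sub s p). x (p @ q)) = (\<lambda>q\<in>lv (sub s' p). x' (p @ q)) \<and> y p = y' p"
    if p: "p \<in> lv r" for p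
  proof -
    have p': "p \<in> lv r'" using p eq1 by simp
    have "enc X Y (sub t p) (sub s p, \<lambda>q\<in>lv (sub s p). x (p @ q), y p) =
        enc X Y (sub t p) (sub s' p, \<lambda>q\<in>lv (sub s' p). x' (p @ q), y' p)"
      using fun_cong[OF eq2, of p] p p' by (simp add: split_terms_def)
    then show ?thesis
      by (rule enc_eq_iff[THEN iffD1, OF X Y sub_le[OF r s p] shift_mem[where X = X, OF s x r p] PiE_mem[OF y p]
          sub_le[OF r' s' p'] shift_mem[where X = X, OF s' x' r' p'] PiE_mem[OF y' p']])
  qed
  have ss: "s = s'"
    by (rule graft_unique[OF r s r'' s']) (use * in blast)
  have "x = x'"
  proof (rule PiE_ext[OF x])
    show "x' \<in> (\<Pi>\<^sub>E p\<in>lv s. X (sub t p))" using x' ss by simp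
    fix l assume "l \<in> lv s"
    then obtain p q where pq: "p \<in> lv r" "q \<in> lv (sub s p)" "l = p @ q"
      using lv_split[OF r] by blast
    have "(\<lambda>q\<in>lv (sub s p). x (p @ q)) q = (\<lambda>q\<in>lv (sub s' p). x' (p @ q)) q"
      by (rule fun_cong[of _ _ q]) (use *[OF pq(1)] in blast)
    then show "x l = x' l" using pq(2) by (simp add: pq(3) ss)
  qed
  moreover have "y = y'"
  proof (rule PiE_ext[OF y])
    show "y' \<in> (\<Pi>\<^sub>E p\<in>lv r. Y (sub s p))" using y' by (simp add: eq1 ss)
  qed (use * in blast)
  ultimately show "v = v'" using e e' eq1 ss \<open>z = z'\<close> by blast
qed

text \<open>Over each leaf \<open>p\<close> of \<open>r\<close> the given term chooses a cut
  \<open>k p\<close> of \<open>sub t p\<close>. Grafting these cuts onto \<open>r\<close> gives the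
  middle tree \<open>s\<close>, and the decorations \<open>a p\<close> fit together to a decoration
  of the leaves of \<open>s\<close>.\<close>

lemma unassoc_surj:
  assumes X: "X \<in> families J" and Y: "Y \<in> families J" and Z: "Z \<in> families J" and t: "t \<in> J"
    and u: "u \<in> ((X \<otimes> Y) \<otimes> Z) t"
  shows "\<exists>v\<in>(X \<otimes> (Y \<otimes> Z)) t. app (unassoc X Y Z) t v = u"
proof -
  obtain r c z where e: "u = enc (X \<otimes> Y) Z t (r, c, z)" and r: "le r t"
    and c: "c \<in> (\<Pi>\<^sub>E p\<in>lv r. (X \<otimes> Y) (sub t p))" and z: "z \<in> Z r"
    using enc_cases[OF u tensor_families[OF X Y] Z t] .
  have "\<exists>k a b. c p = enc X Y (sub t p) (k, a, b) \<and> le k (sub t p) \<and>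
      a \<in> (\<Pi>\<^sub>E q\<in>lv k. X (sub (sub t p) q)) \<and> b \<in> Y k" if p: "p \<in> lv r" for p
    by (rule enc_cases[OF PiE_mem[OF c p] X Y sub_closed[OF r p]]) blast
  then obtain k a b where c_eq: "\<And>p. p \<in> lv r \<Longrightarrow> c p = enc X Y (sub t p) (k p, a p, b p)"
    and k: "\<And>p. p \<in> lv r \<Longrightarrow> le (k p) (sub t p)"
    and a: "\<And>p. p \<in> lv r \<Longrightarrow> a p \<in> (\<Pi>\<^sub>E q\<in>lv (k p). X (sub (sub t p) q))"
    and b: "\<And>p. p \<in> lv r \<Longrightarrow> b p \<in> Y (k p)"
    by metis
  obtain s where rs: "le r s" and s: "le s t" and sk: "\<And>p. p \<in> lv r \<Longrightarrow> sub s p = k p"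
    using graft[OF r k] by blast
  \<comment> \<open>Splits a leaf of \<open>s\<close> at the leaf of \<open>r\<close> below it. The
    choice is unique because by \<open>lv_prefix_unique\<close> no list extends two leaves of
    \<open>r\<close>.\<close>
  define pre where "pre l = (SOME pq. fst pq \<in> lv r \<and> snd pq \<in> lv (k (fst pq)) \<and> l = fst pq @ snd pq)" for l
  have pre: "pre (p @ q) = (p, q)" if "p \<in> lv r" "q \<in> lv (k p)" for p q
    unfolding pre_def
  proof (rule some_equality)
    fix pq assume *: "fst pq \<in> lv r \<and> snd pq \<in> lv (k (fst pq)) \<and> p @ q = fst pq @ snd pq"
    then have "p = fst pq"
      using lv_prefix_unique[OF _ that(1)] le_closed[OF r] by blast
    with * show "pq = (p, q)" by (cases pq) simp
  qed (use that in simp)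
  define x where "x = (\<lambda>l\<in>lv s. a (fst (pre l)) (snd (pre l)))"
  define y where "y = (\<lambda>p\<in>lv r. b p)"
  have x: "x \<in> (\<Pi>\<^sub>E p\<in>lv s. X (sub t p))"
    unfolding x_def
  proof (rule restrict_PiE_iff[THEN iffD2], rule ballI)
    fix l assume "l \<in> lv s"
    then obtain p q where pq: "p \<in> lv r" "q \<in> lv (sub s p)" "l = p @ q"
      using lv_split[OF rs] by blast
    then have q: "q \<in> lv (k p)" by (simp add: sk)
    show "a (fst (pre l)) (snd (pre l)) \<in> X (sub t l)"
      using PiE_mem[OF a[OF pq(1)] q] by (simp add: pq(3) pre[OF pq(1) q] sub_sub[OF rs s pq(1,2)])
  qed
  have y: "y \<in> (\<Pi>\<^sub>E p\<in>lv r. Y (sub s p))"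
    by (simp add: y_def sk b)
  have "split_terms X Y t s x r y = c"
  proof (rule PiE_ext[OF split_terms_mem[OF X Y s x rs y] c])
    fix p assume p: "p \<in> lv r"
    have "(\<lambda>q\<in>lv (k p). x (p @ q)) = a p"
      by (rule extensionalityI[of _ "lv (k p)"])
        (use a[OF p] p in \<open>auto simp: x_def lv_append[OF rs] sk pre PiE_iff\<close>)
    then show "split_terms X Y t s x r y p = c p"
      by (simp add: split_terms_def c_eq p sk y_def)
  qed
  then show ?thesis
    using app_unassoc[OF X Y Z s x rs y z]
      enc_mem[OF X tensor_families[OF Y Z] s x enc_mem[OF Y Z rs y z]] e by metis
qed

lemma unassoc_iso:
  assumes X: "X \<in> families J" and Y: "Y \<in> families J" and Z: "Z \<in> families J"
  shows "iso_arr C (X \<otimes> (Y \<otimes> Z)) ((X \<otimes> Y) \<otimes> Z) (unassoc X Y Z)"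
proof (rule iso_arr_family_cat[OF unassoc_hom[OF assms]])
  fix t assume t: "t \<in> J"
  show "bij_betw (app (unassoc X Y Z) t) ((X \<otimes> (Y \<otimes> Z)) t) (((X \<otimes> Y) \<otimes> Z) t)"
    using unassoc_inj[OF assms t] unassoc_surj[OF assms t] app_in[OF unassoc_hom[OF assms] t]
    unfolding bij_betw_def by blast
qed

lemma unassoc_natural:
  assumes f: "f \<in> hom_set C X X'" and g: "g \<in> hom_set C Y Y'" and h: "h \<in> hom_set C Z Z'"
  shows "Cmp C (unassoc X' Y' Z') (f \<otimes>\<^sub>a (g \<otimes>\<^sub>a h)) = Cmp C ((f \<otimes>\<^sub>a g) \<otimes>\<^sub>a h) (unassoc X Y Z)"
proof -
  note X = hom_families[OF f] and Y = hom_families[OF g] and Z = hom_families[OF h]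
  note fg = on_arr_T[OF f g] and gh = on_arr_T[OF g h]
  note fgh = on_arr_T[OF f gh] on_arr_T[OF fg h]
  note u = unassoc_hom[OF X(1) Y(1) Z(1)] unassoc_hom[OF X(2) Y(2) Z(2)]
  show ?thesis
  proof (rule family_arr_eqI[OF Cmp_family_hom[OF fgh(1) u(2)] Cmp_family_hom[OF u(1) fgh(2)]])
    fix t v assume t: "t \<in> J" and v: "v \<in> (X \<otimes> (Y \<otimes> Z)) t"
    from nested_cases[OF v X(1) Y(1) Z(1) t] obtain s x r y z
      where e: "v = enc X (Y \<otimes> Z) t (s, x, enc Y Z s (r, y, z))" and s: "le s t"
        and x: "x \<in> (\<Pi>\<^sub>E p\<in>lv s. X (sub t p))" and r: "le r s"
        and y: "y \<in> (\<Pi>\<^sub>E p\<in>lv r. Y (sub s p))" and z: "z \<in> Z r" .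
    have rJ: "r \<in> J" using le_closed[OF r] by simp
    let ?x = "\<lambda>p\<in>lv s. app f (sub t p) (x p)" and ?y = "\<lambda>p\<in>lv r. app g (sub s p) (y p)"
    note m = app_in_PiE[OF f s x] app_in_PiE[OF g r y] app_in[OF h rJ z]
    have "split_terms X' Y' t s ?x r ?y =
        (\<lambda>p\<in>lv r. app (f \<otimes>\<^sub>a g) (sub t p) (split_terms X Y t s x r y p))"
      unfolding split_terms_def
    proof (rule restrict_ext)
      fix p assume p: "p \<in> lv r"
      have "(\<lambda>q\<in>lv (sub s p). ?x (p @ q)) =
          (\<lambda>q\<in>lv (sub s p). app f (sub (sub t p) q) ((\<lambda>q\<in>lv (sub s p). x (p @ q)) q))"
        by (rule restrict_ext) (simp add: sub_sub[OF r s p] lv_append[OF r p])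
      then show "enc X' Y' (sub t p) (sub s p, \<lambda>q\<in>lv (sub s p). ?x (p @ q), ?y p) =
          app (f \<otimes>\<^sub>a g) (sub t p) ((\<lambda>p\<in>lv r. enc X Y (sub t p)
            (sub s p, \<lambda>q\<in>lv (sub s p). x (p @ q), y p)) p)"
        using p by (simp add: app_tensor_arr[OF f g sub_le[OF r s p]
            shift_mem[where X = X, OF s x r p] PiE_mem[OF y p]])
    qed
    then show "app (Cmp C (unassoc X' Y' Z') (f \<otimes>\<^sub>a (g \<otimes>\<^sub>a h))) t v =
        app (Cmp C ((f \<otimes>\<^sub>a g) \<otimes>\<^sub>a h) (unassoc X Y Z)) t v"
      using v unfolding e
      by (simp del: restrict_apply add: app_Cmp[OF fgh(1) u(2) t] app_Cmp[OF u(1) fgh(2) t]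
        app_tensor_arr[OF f gh s x enc_mem[OF Y(1) Z(1) r y z]] app_tensor_arr[OF g h r y z]
        app_unassoc[OF X(2) Y(2) Z(2) s m(1) r m(2,3)] app_unassoc[OF X(1) Y(1) Z(1) s x r y z]
        app_tensor_arr[OF fg h le_trans[OF r s] split_terms_mem[OF X(1) Y(1) s x r y] z])
  qed
qed

text \<open>An element of the source is a chain \<open>r\<close>, \<open>s\<close>,
  \<open>k\<close>, \<open>t\<close> of successive cuts with decorations in the four families. Both
  composites keep \<open>r\<close> and \<open>z\<close> and leave, over each leaf \<open>p\<close>
  of \<open>r\<close>, the chain of the parts of \<open>s\<close>, \<open>k\<close>,
  \<open>t\<close> above \<open>p\<close>. They differ only in how the address of a leaf of
  \<open>k\<close> is bracketed.\<close>

lemma unassoc_pentagon: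
  assumes W: "W \<in> families J" and X: "X \<in> families J" and Y: "Y \<in> families J" and Z: "Z \<in> families J"
  shows "Cmp C (unassoc (W \<otimes> X) Y Z) (unassoc W X (Y \<otimes> Z)) =
    Cmp C (Cmp C (unassoc W X Y \<otimes>\<^sub>a Idn C Z) (unassoc W (X \<otimes> Y) Z)) (Idn C W \<otimes>\<^sub>a unassoc X Y Z)"
proof -
  note WX = tensor_families[OF W X] and XY = tensor_families[OF X Y] and YZ = tensor_families[OF Y Z]
  note iW = Idn_family_hom[OF W] and iZ = Idn_family_hom[OF Z]
  note u = unassoc_hom[OF W X YZ] unassoc_hom[OF WX Y Z] unassoc_hom[OF X Y Z]
    unassoc_hom[OF W XY Z] unassoc_hom[OF W X Y]
  note ti = on_arr_T[OF iW u(3)] and tz = on_arr_T[OF u(5) iZ]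
  note c = Cmp_family_hom[OF u(4) tz]
  show ?thesis
  proof (rule family_arr_eqI[OF Cmp_family_hom[OF u(1,2)] Cmp_family_hom[OF ti c]])
    fix t v assume t: "t \<in> J" and v: "v \<in> (W \<otimes> (X \<otimes> (Y \<otimes> Z))) t"
    from nested_cases[OF v W X YZ t] obtain k w s x v'
      where e: "v = enc W (X \<otimes> (Y \<otimes> Z)) t (k, w, enc X (Y \<otimes> Z) k (s, x, v'))" and k: "le k t"
        and w: "w \<in> (\<Pi>\<^sub>E p\<in>lv k. W (sub t p))" and s: "le s k"
        and x: "x \<in> (\<Pi>\<^sub>E p\<in>lv s. X (sub k p))" and v': "v' \<in> (Y \<otimes> Z) s" .
    have sJ: "s \<in> J" and kJ: "k \<in> J" using le_closed[OF s] by auto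
    from enc_cases[OF v' Y Z sJ] obtain r y z
      where e': "v' = enc Y Z s (r, y, z)" and r: "le r s"
        and y: "y \<in> (\<Pi>\<^sub>E p\<in>lv r. Y (sub s p))" and z: "z \<in> Z r" .
    have rJ: "r \<in> J" using le_closed[OF r] by auto
    note st = le_trans[OF s k] and rk = le_trans[OF r s]
    let ?wx = "split_terms W X t k w s x" and ?xy = "split_terms X Y k s x r y"
    note wx = split_terms_mem[OF W X k w s x] and xy = split_terms_mem[OF X Y s x r y]
    let ?wxy = "split_terms W (X \<otimes> Y) t k w r ?xy"
    note wxy = split_terms_mem[OF W XY k w rk xy]
    have idw: "(\<lambda>p\<in>lv k. app (Idn C W) (sub t p) (w p)) = w"
      using w sub_closed[OF k] by (intro extensionalityI[of _ "lv k"]) (auto simp: PiE_iff)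
    have "split_terms (W \<otimes> X) Y t s ?wx r y =
        (\<lambda>p\<in>lv r. app (unassoc W X Y) (sub t p) (?wxy p))"
      unfolding split_terms_def[of "W \<otimes> X"]
    proof (rule restrict_ext)
      fix p assume p: "p \<in> lv r"
      have wp: "?wxy p = enc W (X \<otimes> Y) (sub t p) (sub k p, \<lambda>q\<in>lv (sub k p). w (p @ q),
          enc X Y (sub k p) (sub s p, \<lambda>q\<in>lv (sub s p). x (p @ q), y p))"
        using p by (simp add: split_terms_def)
      have "(\<lambda>q\<in>lv (sub s p). ?wx (p @ q)) =
          split_terms W X (sub t p) (sub k p) (\<lambda>q\<in>lv (sub k p). w (p @ q)) (sub s p)
            (\<lambda>q\<in>lv (sub s p). x (p @ q))"
        unfolding split_terms_def[of W X "sub t p"]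
      proof (rule restrict_ext)
        fix q assume q: "q \<in> lv (sub s p)"
        have pq: "p @ q \<in> lv s" by (rule lv_append[OF r p q])
        have k1: "sub (sub k p) q = sub k (p @ q)" by (rule sub_sub[OF r s p q])
        have k2: "sub (sub t p) q = sub t (p @ q)" by (rule sub_sub[OF r st p q])
        \<comment> \<open>The associativity of \<open>@\<close> settles the pentagon here;
          \<open>lv_append\<close> ensures that \<open>q @ q'\<close> is in the domain of the inner
          restricted function.\<close>
        have "(\<lambda>q'\<in>lv (sub k (p @ q)). w ((p @ q) @ q')) =
            (\<lambda>q'\<in>lv (sub k (p @ q)). (\<lambda>q\<in>lv (sub k p). w (p @ q)) (q @ q'))"
          by (rule restrict_ext)
            (use lv_append[OF sub_le[OF r s p] q] in \<open>simp add: k1\<close>)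
        then show "?wx (p @ q) = enc W X (sub (sub t p) q) (sub (sub k p) q,
            \<lambda>q'\<in>lv (sub (sub k p) q). (\<lambda>q\<in>lv (sub k p). w (p @ q)) (q @ q'),
            (\<lambda>q\<in>lv (sub s p). x (p @ q)) q)"
          using q pq by (simp add: split_terms_def k1 k2)
      qed
      then show "enc (W \<otimes> X) Y (sub t p) (sub s p, \<lambda>q\<in>lv (sub s p). ?wx (p @ q), y p) =
          app (unassoc W X Y) (sub t p) (?wxy p)"
        unfolding wp
        by (simp del: restrict_apply add: app_unassoc[OF W X Y sub_le[OF rk k p] shift_mem[where X = W, OF k w rk p]
            sub_le[OF r s p] shift_mem[where X = X, OF s x r p] PiE_mem[OF y p]])
    qed
    then show "app (Cmp C (unassoc (W \<otimes> X) Y Z) (unassoc W X (Y \<otimes> Z))) t v =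
        app (Cmp C (Cmp C (unassoc W X Y \<otimes>\<^sub>a Idn C Z) (unassoc W (X \<otimes> Y) Z))
          (Idn C W \<otimes>\<^sub>a unassoc X Y Z)) t v"
      using v unfolding e e'
      by (simp add: app_Cmp[OF u(1,2) t] app_Cmp[OF ti c t] app_Cmp[OF u(4) tz t]
        enc_mem[OF W tensor_families[OF XY Z] k w enc_mem[OF XY Z rk xy z]]
        app_unassoc[OF W X YZ k w s x enc_mem[OF Y Z r y z]]
        app_unassoc[OF WX Y Z st wx r y z]
        app_tensor_arr[OF iW u(3) k w enc_mem[OF X YZ s x enc_mem[OF Y Z r y z]]] idw
        app_unassoc[OF X Y Z s x r y z]
        app_unassoc[OF W XY Z k w rk xy z]
        app_tensor_arr[OF u(5) iZ le_trans[OF rk k] wxy z] app_Idn[of _ _ _ Z] rJ z)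
  qed
qed

section \<open>The unitors and the triangle\<close>

definition lunitor where
  "lunitor X = mk_arr J (U \<otimes> X) (\<lambda>t v. case dec U X t v of (r, u, x) \<Rightarrow> x) X"

definition runitor where
  "runitor X = mk_arr J (X \<otimes> U) (\<lambda>t v. case dec X U t v of (r, x, u) \<Rightarrow> x []) X"

lemma U_D: "u \<in> U t \<Longrightarrow> t \<in> J \<Longrightarrow> t \<in> Tr \<and> u = star t"
  using U_trivial U_nontrivial by (cases "t \<in> Tr") auto

text \<open>An element of the unit above every leaf of \<open>r\<close> forces all parts of
  \<open>t\<close> above \<open>r\<close> to be trivial, so \<open>le_full\<close> gives
  \<open>r = t\<close>. Thus the full cut is the only one that contributes to
  \<open>U \<otimes> X\<close>, with exactly one decoration of its leaves.\<close>

lemma U_PiE_unique: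
  assumes r: "le r t" and u: "u \<in> (\<Pi>\<^sub>E p\<in>lv r. U (sub t p))"
  shows "r = t" and "u = (\<lambda>p\<in>lv t. star (sub t p))"
proof -
  have *: "sub t p \<in> Tr \<and> u p = star (sub t p)" if p: "p \<in> lv r" for p
    by (rule U_D[OF PiE_mem[OF u p] sub_closed[OF r p]])
  show rt: "r = t" by (rule le_full[OF r]) (simp add: *)
  show "u = (\<lambda>p\<in>lv t. star (sub t p))"
    by (rule extensionalityI[of _ "lv t"]) (use u * rt in \<open>auto simp: PiE_iff\<close>)
qed

lemma U_PiE_mem: "t \<in> J \<Longrightarrow> (\<lambda>p\<in>lv t. star (sub t p)) \<in> (\<Pi>\<^sub>E p\<in>lv t. U (sub t p))"
  by (simp add: U_trivial sub_leaf)

lemma app_lunitor: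
  assumes "X \<in> families J" "le r t" "u \<in> (\<Pi>\<^sub>E p\<in>lv r. U (sub t p))" "x \<in> X r"
  shows "app (lunitor X) t (enc U X t (r, u, x)) = x"
  using assms le_closed[OF assms(2)]
  by (simp add: lunitor_def enc_mem U_families dec_enc)

lemma lunitor_iso:
  assumes X: "X \<in> families J"
  shows "iso_arr C (U \<otimes> X) X (lunitor X)"
proof (rule iso_arr_family_cat)
  note UX = tensor_families[OF U_families X]
  show "lunitor X \<in> hom_set C (U \<otimes> X) X"
    unfolding lunitor_def
  proof (rule mk_arr_hom[OF UX X])
    fix t v assume t: "t \<in> J" and "v \<in> (U \<otimes> X) t"
    then show "(case dec U X t v of (r, u, x) \<Rightarrow> x) \<in> X t"
      by (elim enc_cases[OF _ U_families X]) (auto simp: dec_enc U_families X dest: U_PiE_unique(1))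
  qed
  fix t assume t: "t \<in> J"
  show "bij_betw (app (lunitor X) t) ((U \<otimes> X) t) (X t)"
  proof (rule bij_betw_byWitness[where f' = "\<lambda>x. enc U X t (t, \<lambda>p\<in>lv t. star (sub t p), x)"])
    note m = le_refl[OF t] U_PiE_mem[OF t]
    show "\<forall>v\<in>(U \<otimes> X) t. enc U X t (t, \<lambda>p\<in>lv t. star (sub t p), app (lunitor X) t v) = v"
    proof
      fix v assume "v \<in> (U \<otimes> X) t"
      then obtain r u x where "v = enc U X t (r, u, x)" "le r t" "u \<in> (\<Pi>\<^sub>E p\<in>lv r. U (sub t p))" "x \<in> X r"
        using enc_cases[OF _ U_families X t] by metis
      then show "enc U X t (t, \<lambda>p\<in>lv t. star (sub t p), app (lunitor X) t v) = v"
        using U_PiE_unique[of r t u] app_lunitor[OF X, of r t u x] by simp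
    qed
    show "\<forall>x\<in>X t. app (lunitor X) t (enc U X t (t, \<lambda>p\<in>lv t. star (sub t p), x)) = x"
      using app_lunitor[OF X m] by blast
    show "app (lunitor X) t ` (U \<otimes> X) t \<subseteq> X t"
      using app_in[OF \<open>lunitor X \<in> hom_set C (U \<otimes> X) X\<close> t] by blast
    show "(\<lambda>x. enc U X t (t, \<lambda>p\<in>lv t. star (sub t p), x)) ` X t \<subseteq> (U \<otimes> X) t"
      using enc_mem[OF U_families X m] by blast
  qed
qed

lemma lunitor_hom: "X \<in> families J \<Longrightarrow> lunitor X \<in> hom_set C (U \<otimes> X) X"
  using lunitor_iso by (simp add: iso_arr_def)

lemma lunitor_natural:
  assumes f: "f \<in> hom_set C X X'"
  shows "Cmp C (lunitor X') (Idn C U \<otimes>\<^sub>a f) = Cmp C f (lunitor X)"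
proof -
  note X = hom_families[OF f]
  note l = lunitor_hom[OF X(1)] lunitor_hom[OF X(2)]
  note iU = Idn_family_hom[OF U_families]
  note Uf = on_arr_T[OF iU f]
  show ?thesis
  proof (rule family_arr_eqI[OF Cmp_family_hom[OF Uf l(2)] Cmp_family_hom[OF l(1) f]])
    fix t v assume t: "t \<in> J" and v: "v \<in> (U \<otimes> X) t"
    obtain r u x where e: "v = enc U X t (r, u, x)" and r: "le r t"
      and u: "u \<in> (\<Pi>\<^sub>E p\<in>lv r. U (sub t p))" and x: "x \<in> X r"
      using enc_cases[OF v U_families X(1) t] .
    have rt: "r = t" by (rule U_PiE_unique(1)[OF r u])
    have xt: "x \<in> X t" using x rt by simp
    show "app (Cmp C (lunitor X') (Idn C U \<otimes>\<^sub>a f)) t v = app (Cmp C f (lunitor X)) t v"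
      using v unfolding e app_Cmp[OF Uf l(2) t v[unfolded e]] app_Cmp[OF l(1) f t v[unfolded e]]
        app_tensor_arr[OF iU f r u x] app_lunitor[OF X(1) r u x]
      using app_lunitor[OF X(2) r app_in_PiE[OF iU r u], of "app f r x"] app_in[OF f t xt]
      by (simp add: rt)
  qed
qed

lemma U_root:
  assumes r: "le r t" and u: "u \<in> U r"
  shows "r \<in> Tr" and "u = star r" and "lv r = {[]}"
  using U_D[OF u] le_closed[OF r] lv_trivial by auto

lemma app_runitor:
  assumes "X \<in> families J" "le r t" "x \<in> (\<Pi>\<^sub>E p\<in>lv r. X (sub t p))" "u \<in> U r"
  shows "app (runitor X) t (enc X U t (r, x, u)) = x []" and "x [] \<in> X t"
  using assms le_closed[OF assms(2)] U_root(3)[OF assms(2,4)] sub_Nil[of t]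
  by (auto simp: runitor_def enc_mem U_families dec_enc PiE_iff)

text \<open>An element of the unit at the cut forces the cut to be trivial, hence equal to the
  unique trivial cut \<open>k\<close> (the root edge). Its only leaf is \<open>[]\<close>, above
  which lies all of \<open>t\<close>, so a term amounts to an element of \<open>X t\<close>.\<close>

lemma runitor_iso:
  assumes X: "X \<in> families J"
  shows "iso_arr C (X \<otimes> U) X (runitor X)"
proof (rule iso_arr_family_cat)
  note XU = tensor_families[OF X U_families]
  show h: "runitor X \<in> hom_set C (X \<otimes> U) X"
    unfolding runitor_def
  proof (rule mk_arr_hom[OF XU X])
    fix t v assume t: "t \<in> J" and "v \<in> (X \<otimes> U) t"
    then show "(case dec X U t v of (r, x, u) \<Rightarrow> x []) \<in> X t"
      by (elim enc_cases[OF _ X U_families]) (auto simp: dec_enc U_families X dest: app_runitor(2)[OF X])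
  qed
  fix t assume t: "t \<in> J"
  obtain k where k: "k \<in> Tr" "le k t" using trivial_le[OF t] by blast
  have lvk: "lv k = {[]}" and Uk: "U k = {star k}" using k lv_trivial U_trivial by auto
  have m: "(\<lambda>p\<in>lv k. x) \<in> (\<Pi>\<^sub>E p\<in>lv k. X (sub t p))" if "x \<in> X t" for x
    using that by (simp add: lvk sub_Nil[OF t])
  show "bij_betw (app (runitor X) t) ((X \<otimes> U) t) (X t)"
  proof (rule bij_betw_byWitness[where f' = "\<lambda>x. enc X U t (k, \<lambda>p\<in>lv k. x, star k)"])
    show "\<forall>v\<in>(X \<otimes> U) t. enc X U t (k, \<lambda>p\<in>lv k. app (runitor X) t v, star k) = v"
    proof
      fix v assume "v \<in> (X \<otimes> U) t"
      then obtain r x u where e: "v = enc X U t (r, x, u)" and r: "le r t"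
        and x: "x \<in> (\<Pi>\<^sub>E p\<in>lv r. X (sub t p))" and u: "u \<in> U r"
        using enc_cases[OF _ X U_families t] by metis
      note rt = U_root[OF r u]
      have rk: "r = k" by (rule trivial_le_unique[OF r k(2) rt(1) k(1)])
      have "(\<lambda>p\<in>lv k. x []) = x"
        by (rule extensionalityI[of _ "lv k"]) (use x in \<open>auto simp: lvk rk PiE_iff\<close>)
      then show "enc X U t (k, \<lambda>p\<in>lv k. app (runitor X) t v, star k) = v"
        by (simp only: e app_runitor(1)[OF X r x u]) (simp add: rt(2) rk)
    qed
    show "\<forall>x\<in>X t. app (runitor X) t (enc X U t (k, \<lambda>p\<in>lv k. x, star k)) = x"
      using app_runitor(1)[OF X k(2) m, of _ "star k"] Uk lvk
      by (simp add: restrict_apply' del: restrict_apply)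
    show "app (runitor X) t ` (X \<otimes> U) t \<subseteq> X t"
      using app_in[OF h t] by blast
    show "(\<lambda>x. enc X U t (k, \<lambda>p\<in>lv k. x, star k)) ` X t \<subseteq> (X \<otimes> U) t"
      using enc_mem[OF X U_families k(2) m] Uk by blast
  qed
qed

lemma runitor_hom: "X \<in> families J \<Longrightarrow> runitor X \<in> hom_set C (X \<otimes> U) X"
  using runitor_iso by (simp add: iso_arr_def)

lemma runitor_natural:
  assumes f: "f \<in> hom_set C X X'"
  shows "Cmp C (runitor X') (f \<otimes>\<^sub>a Idn C U) = Cmp C f (runitor X)"
proof -
  note X = hom_families[OF f]
  note l = runitor_hom[OF X(1)] runitor_hom[OF X(2)]
  note iU = Idn_family_hom[OF U_families]
  note fU = on_arr_T[OF f iU]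
  show ?thesis
  proof (rule family_arr_eqI[OF Cmp_family_hom[OF fU l(2)] Cmp_family_hom[OF l(1) f]])
    fix t v assume t: "t \<in> J" and v: "v \<in> (X \<otimes> U) t"
    obtain r x u where e: "v = enc X U t (r, x, u)" and r: "le r t"
      and x: "x \<in> (\<Pi>\<^sub>E p\<in>lv r. X (sub t p))" and u: "u \<in> U r"
      using enc_cases[OF v X(1) U_families t] .
    have rJ: "r \<in> J" using le_closed[OF r] by simp
    show "app (Cmp C (runitor X') (f \<otimes>\<^sub>a Idn C U)) t v = app (Cmp C f (runitor X)) t v"
      unfolding e app_Cmp[OF fU l(2) t v[unfolded e]] app_Cmp[OF l(1) f t v[unfolded e]]
        app_tensor_arr[OF f iU r x u] app_runitor(1)[OF X(1) r x u]
        app_runitor(1)[OF X(2) r app_in_PiE[OF f r x] app_in[OF iU rJ u]]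
      by (simp add: U_root(3)[OF r u] sub_Nil[OF t])
  qed
qed

text \<open>The unit in the middle forces \<open>k = s\<close>, so the parts of \<open>s\<close>
  above the leaves of \<open>k\<close> are trivial. Over such a leaf \<open>p\<close> the right
  unitor reads off the value of \<open>x\<close> at \<open>p @ []\<close>, that is,
  \<open>x p\<close>.\<close>

lemma unassoc_triangle:
  assumes X: "X \<in> families J" and Y: "Y \<in> families J"
  shows "Cmp C (runitor X \<otimes>\<^sub>a Idn C Y) (unassoc X U Y) = Idn C X \<otimes>\<^sub>a lunitor Y"
proof -
  note iX = Idn_family_hom[OF X] and iY = Idn_family_hom[OF Y]
  note u = unassoc_hom[OF X U_families Y]
  note r = on_arr_T[OF runitor_hom[OF X] iY] and l = on_arr_T[OF iX lunitor_hom[OF Y]]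
  note XU = tensor_families[OF X U_families]
  show ?thesis
  proof (rule family_arr_eqI[OF Cmp_family_hom[OF u r] l])
    fix t v assume t: "t \<in> J" and v: "v \<in> (X \<otimes> (U \<otimes> Y)) t"
    from nested_cases[OF v X U_families Y t] obtain s x k w z
      where e: "v = enc X (U \<otimes> Y) t (s, x, enc U Y s (k, w, z))" and s: "le s t"
        and x: "x \<in> (\<Pi>\<^sub>E p\<in>lv s. X (sub t p))" and k: "le k s"
        and w: "w \<in> (\<Pi>\<^sub>E p\<in>lv k. U (sub s p))" and z: "z \<in> Y k" .
    have ks: "k = s" by (rule U_PiE_unique(1)[OF k w])
    have kJ: "k \<in> J" using le_closed[OF k] by simp
    have "app (runitor X) (sub t p) (split_terms X U t s x k w p) = app (Idn C X) (sub t p) (x p)"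
      if p: "p \<in> lv k" for p
    proof -
      note a = app_runitor[OF X sub_le[OF k s p] shift_mem[where X = X, OF s x k p] PiE_mem[OF w p]]
      \<comment> \<open>The value at \<open>[]\<close> of the function restricted to
        \<open>lv (sub s p)\<close> is a genuine one only because \<open>sub s p\<close> is
        trivial.\<close>
      have "[] \<in> lv (sub s p)"
        using U_root(3)[OF le_refl PiE_mem[OF w p]] sub_closed[OF k p] by simp
      then show ?thesis
        using p a PiE_mem[OF x, of p] ks sub_closed[OF s]
        by (simp add: split_terms_def restrict_apply' del: restrict_apply)
    qed
    then have "(\<lambda>p\<in>lv k. app (runitor X) (sub t p) (split_terms X U t s x k w p)) =
        (\<lambda>p\<in>lv k. app (Idn C X) (sub t p) (x p))"
      by (intro restrict_ext)
    then show "app (Cmp C (runitor X \<otimes>\<^sub>a Idn C Y) (unassoc X U Y)) t v =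
        app (Idn C X \<otimes>\<^sub>a lunitor Y) t v"
      unfolding e app_Cmp[OF u r t v[unfolded e]] app_unassoc[OF X U_families Y s x k w z]
        app_tensor_arr[OF runitor_hom[OF X] iY le_trans[OF k s] split_terms_mem[OF X U_families s x k w] z]
        app_tensor_arr[OF iX lunitor_hom[OF Y] s x enc_mem[OF U_families Y k w z]]
        app_lunitor[OF Y k w z]
      using kJ z ks by simp
  qed
qed

theorem monoidal: "\<exists>assoc. monoidal_category C T U assoc lunitor runitor"
  by (rule category_with_tensor.monoidal_category_of_inverse_associator[OF category_with_tensor,
        of U unassoc])
    (simp_all add: U_families unassoc_iso lunitor_iso runitor_iso unassoc_natural
      lunitor_natural runitor_natural unassoc_pentagon unassoc_triangle)

end

lemma (in cut_structure) transport:
  assumes inv: "\<And>t. t \<in> J \<Longrightarrow> h (g t) = t"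
  shows "cut_structure (g ` J) (\<lambda>a b. a \<in> g ` J \<and> b \<in> g ` J \<and> le (h a) (h b)) (\<lambda>a. lv (h a))
    (\<lambda>a p. g (sub (h a) p)) (g ` Tr)"
proof -
  define ge where "ge a b \<longleftrightarrow> a \<in> g ` J \<and> b \<in> g ` J \<and> le (h a) (h b)" for a b
  have hJ: "a \<in> g ` J \<Longrightarrow> h a \<in> J" and gh: "a \<in> g ` J \<Longrightarrow> g (h a) = a" for a
    using inv by auto
  have ge: "le (h a) (h b)" "a \<in> g ` J" "b \<in> g ` J" if "ge a b" for a b
    using that by (auto simp: ge_def)
  have hsub: "h (g (sub t p)) = sub t p" if "le r t" "p \<in> lv r" for r t p
    by (rule inv[OF sub_closed[OF that]])
  have geI: "ge (g s) (g t)" if "le s t" for s t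
    using that le_closed[OF that] by (auto simp: ge_def inv)
  have Tr: "a \<in> g ` Tr \<longleftrightarrow> a \<in> g ` J \<and> h a \<in> Tr" for a
    using inv trivial_closed by auto
  have "cut_structure (g ` J) ge (\<lambda>a. lv (h a)) (\<lambda>a p. g (sub (h a) p)) (g ` Tr)"
  proof
    fix a b c p q
    show "ge a b \<Longrightarrow> a \<in> g ` J \<and> b \<in> g ` J" by (simp add: ge_def)
    show "a \<in> g ` J \<Longrightarrow> ge a a" by (simp add: ge_def hJ le_refl)
    show "\<lbrakk>ge a b; ge b c\<rbrakk> \<Longrightarrow> ge a c" unfolding ge_def using le_trans by blast
    show "finite {a. ge a b}" if "b \<in> g ` J"
    proof (rule finite_subset)
      show "{a. ge a b} \<subseteq> g ` {r. le r (h b)}"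
      proof
        fix a assume "a \<in> {a. ge a b}"
        then have "ge a b" by simp
        then show "a \<in> g ` {r. le r (h b)}"
          using ge(1,2)[of a b] gh[of a] by (intro image_eqI[of _ _ "h a"]) auto
      qed
      show "finite (g ` {r. le r (h b)})" by (rule finite_imageI[OF finite_le[OF hJ[OF that]]])
    qed
    show "a \<in> g ` J \<Longrightarrow> finite (lv (h a))" by (simp add: finite_lv hJ)
    show "\<lbrakk>ge a b; p \<in> lv (h a)\<rbrakk> \<Longrightarrow> g (sub (h b) p) \<in> g ` J"
      using sub_closed ge(1) by blast
    show "\<lbrakk>ge a b; ge b c; p \<in> lv (h a)\<rbrakk> \<Longrightarrow> ge (g (sub (h b) p)) (g (sub (h c) p))"
      by (intro geI sub_le[of "h a"] ge(1))
    show "\<lbrakk>ge a b; p \<in> lv (h a); q \<in> lv (h (g (sub (h b) p)))\<rbrakk> \<Longrightarrow> p @ q \<in> lv (h b)"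
      using lv_append[OF ge(1), of a b p q] hsub[OF ge(1), of a b p] by simp
    show "g (sub (h (g (sub (h c) p))) q) = g (sub (h c) (p @ q))"
      if "ge a b" "ge b c" "p \<in> lv (h a)" "q \<in> lv (h (g (sub (h b) p)))"
      using that sub_sub[OF ge(1)[OF that(1)] ge(1)[OF that(2)]] hsub[OF ge(1)[OF that(1)]]
        hsub[OF le_trans[OF ge(1)[OF that(1)] ge(1)[OF that(2)]]] by simp
    show "\<exists>p\<in>lv (h a). \<exists>q\<in>lv (h (g (sub (h b) p))). l = p @ q" if "ge a b" "l \<in> lv (h b)" for l
      using lv_split[OF ge(1)[OF that(1)] that(2)] hsub[OF ge(1)[OF that(1)]] by auto
  next
    show "\<lbrakk>a \<in> g ` J; p \<in> lv (h a); p' \<in> lv (h a); p @ q = p' @ q'\<rbrakk> \<Longrightarrow> p = p'" for a p p' q q'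
      using lv_prefix_unique[OF hJ] .
    show "b = b'" if "ge a b" "ge b c" "ge a b'" "ge b' c"
      and eq: "\<And>p. p \<in> lv (h a) \<Longrightarrow> g (sub (h b) p) = g (sub (h b') p)" for a b b' c
    proof -
      have "sub (h b) p = sub (h b') p" if "p \<in> lv (h a)" for p
        using eq[OF that] hsub[OF ge(1) that, of b] hsub[OF ge(1) that, of b'] \<open>ge a b\<close> \<open>ge a b'\<close>
        by metis
      then have "h b = h b'" using graft_unique that(1-4)[THEN ge(1)] by blast
      then show ?thesis using gh that(1,3)[THEN ge(3)] by metis
    qed
    show "\<exists>s. ge a s \<and> ge s b \<and> (\<forall>p\<in>lv (h a). g (sub (h s) p) = u p)"
      if ab: "ge a b" and u: "\<And>p. p \<in> lv (h a) \<Longrightarrow> ge (u p) (g (sub (h b) p))" for a b u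
    proof -
      have "le (h (u p)) (sub (h b) p)" if "p \<in> lv (h a)" for p
        using ge(1)[OF u[OF that]] hsub[OF ge(1)[OF ab] that] by simp
      then obtain s where s: "le (h a) s" "le s (h b)" "\<forall>p\<in>lv (h a). sub s p = h (u p)"
        using graft[OF ge(1)[OF ab], of "\<lambda>p. h (u p)"] by blast
      have "ge a (g s)" "ge (g s) b"
        using geI[OF s(1)] geI[OF s(2)] gh ge(2,3)[OF ab] by auto
      moreover have "h (g s) = s" using le_closed[OF s(2)] inv by blast
      moreover have "g (h (u p)) = u p" if "p \<in> lv (h a)" for p
        by (rule gh[OF ge(2)[OF u[OF that]]])
      ultimately show ?thesis using s(3) by (intro exI[of _ "g s"]) simp
    qed
    show "r \<in> g ` Tr \<Longrightarrow> r \<in> g ` J" for r using trivial_closed by blast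
  next
    fix t assume t: "t \<in> g ` J"
    obtain r where "r \<in> Tr" "le r (h t)" using trivial_le[OF hJ[OF t]] by blast
    then show "\<exists>r\<in>g ` Tr. ge r t" using geI[of r "h t"] gh[OF t] by auto
    show "g (sub (h t) []) = t" by (simp add: sub_Nil hJ gh t)
    show "p \<in> lv (h t) \<Longrightarrow> g (sub (h t) p) \<in> g ` Tr" for p
      using sub_leaf[OF hJ[OF t]] by blast
  next
    show "r \<in> g ` Tr \<Longrightarrow> lv (h r) = {[]}" for r using Tr lv_trivial by blast
    show "\<lbrakk>ge r t; ge r' t; r \<in> g ` Tr; r' \<in> g ` Tr\<rbrakk> \<Longrightarrow> r = r'" for r r' t
      using trivial_le_unique[OF ge(1) ge(1)] Tr gh by metis
    show "r = t" if r: "ge r t" and "\<And>p. p \<in> lv (h r) \<Longrightarrow> g (sub (h t) p) \<in> g ` Tr" for r t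
    proof -
      have "h r = h t"
        using le_full[OF ge(1)[OF r]] that(2) Tr hsub[OF ge(1)[OF r]] by metis
      then show ?thesis using gh ge(2,3)[OF r] by metis
    qed
  qed
  then show ?thesis by (simp add: ge_def[abs_def])
qed

section \<open>Trees as prefix-closed sets of labelled positions\<close>

text \<open>
  The colour of the root, and the positions of the nodes with their labels in \<open>B\<close>. The colours of
  the other edges are read off the last element of their position.
\<close>

type_synonym ('i, 'e, 'b) pos_tree = "'i \<times> ('e list \<times> 'b) set"

definition colour :: "('i, 'e, 'b, 'i) diagram \<Rightarrow> 'i \<Rightarrow> 'e list \<Rightarrow> 'i" where
  "colour P i p = (if p = [] then i else ds P (last p))"

text \<open>The last condition combines prefix-closure with typing: a node at \<open>p @ [e]\<close>
  needs a node at \<open>p\<close> that has \<open>e\<close> among its inputs. The root colour is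
  stored separately because a trivial tree has no node from which to read it.\<close>

definition pos_trees :: "('i, 'e, 'b, 'i) diagram \<Rightarrow> ('i, 'e, 'b) pos_tree set" where
  "pos_trees P = {(i, G). i \<in> dI P \<and> finite G \<and> single_valued G \<and>
     (\<forall>p b. (p, b) \<in> G \<longrightarrow> b \<in> dB P \<and> dt P b = colour P i p) \<and>
     (\<forall>p e b. (p @ [e], b) \<in> G \<longrightarrow> e \<in> dE P \<and> (p, dp P e) \<in> G)}"

text \<open>These are the edges, whereas \<open>Domain (snd t)\<close> gives the nodes: a node has
  the position of its output edge. Edges are not stored, since the label of a node determines its
  inputs.\<close>

definition positions :: "('i, 'e, 'b, 'i) diagram \<Rightarrow> ('i, 'e, 'b) pos_tree \<Rightarrow> 'e list set" where
  "positions P t = insert [] {p @ [e] | p e. e \<in> dE P \<and> (p, dp P e) \<in> snd t}"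

definition leaf_positions :: "('i, 'e, 'b, 'i) diagram \<Rightarrow> ('i, 'e, 'b) pos_tree \<Rightarrow> 'e list set" where
  "leaf_positions P t = positions P t - Domain (snd t)"

definition upper :: "('i, 'e, 'b, 'i) diagram \<Rightarrow> ('i, 'e, 'b) pos_tree \<Rightarrow> 'e list \<Rightarrow> ('i, 'e, 'b) pos_tree" where
  "upper P t p = (colour P (fst t) p, {(q, b). (p @ q, b) \<in> snd t})"

text \<open>Inclusion of labelled nodes suffices: as the edges are derived from the labels, a lower
  tree automatically contains all input edges of its nodes.\<close>

definition lower :: "('i, 'e, 'b, 'i) diagram \<Rightarrow> ('i, 'e, 'b) pos_tree \<Rightarrow> ('i, 'e, 'b) pos_tree \<Rightarrow> bool" where
  "lower P r t \<longleftrightarrow> r \<in> pos_trees P \<and> t \<in> pos_trees P \<and> fst r = fst t \<and> snd r \<subseteq> snd t"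

lemma colour_append [simp]: "colour P (colour P i p) q = colour P i (p @ q)"
  by (simp add: colour_def)

lemma colour_Nil [simp]: "colour P i [] = i"
  by (simp add: colour_def)

lemma upper_upper: "upper P (upper P t p) q = upper P t (p @ q)"
  by (simp add: upper_def)

lemma upper_Nil: "upper P t [] = t"
  by (simp add: upper_def prod_eq_iff)

lemma pos_treeI:
  assumes "i \<in> dI P" and "finite G"
    and "\<And>p b. (p, b) \<in> G \<Longrightarrow> b \<in> dB P"
    and "\<And>p b. (p, b) \<in> G \<Longrightarrow> dt P b = colour P i p"
    and "\<And>p b b'. (p, b) \<in> G \<Longrightarrow> (p, b') \<in> G \<Longrightarrow> b = b'"
    and "\<And>p e b. (p @ [e], b) \<in> G \<Longrightarrow> e \<in> dE P"
    and "\<And>p e b. (p @ [e], b) \<in> G \<Longrightarrow> (p, dp P e) \<in> G"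
  shows "(i, G) \<in> pos_trees P"
  using assms unfolding pos_trees_def single_valued_def by blast

lemma pos_treeD:
  assumes "t \<in> pos_trees P"
  shows "fst t \<in> dI P" and "finite (snd t)"
    and "\<And>p b. (p, b) \<in> snd t \<Longrightarrow> b \<in> dB P"
    and "\<And>p b. (p, b) \<in> snd t \<Longrightarrow> dt P b = colour P (fst t) p"
    and "\<And>p b b'. (p, b) \<in> snd t \<Longrightarrow> (p, b') \<in> snd t \<Longrightarrow> b = b'"
    and "\<And>p e b. (p @ [e], b) \<in> snd t \<Longrightarrow> e \<in> dE P"
    and "\<And>p e b. (p @ [e], b) \<in> snd t \<Longrightarrow> (p, dp P e) \<in> snd t"
  using assms unfolding pos_trees_def single_valued_def by (cases t; simp; blast)+

lemma lowerD:
  assumes "lower P r t"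
  shows "r \<in> pos_trees P" and "t \<in> pos_trees P" and "fst r = fst t"
    and "\<And>p b. (p, b) \<in> snd r \<Longrightarrow> (p, b) \<in> snd t"
  using assms by (auto simp: lower_def)

lemma Domain_prefix:
  assumes "t \<in> pos_trees P"
  shows "p @ q \<in> Domain (snd t) \<Longrightarrow> p \<in> Domain (snd t)"
proof (induction q rule: rev_induct)
  case (snoc e q)
  then obtain b where "((p @ q) @ [e], b) \<in> snd t" by auto
  then show ?case using snoc.IH pos_treeD(7)[OF assms] by blast
qed simp

lemma position_snoc: "p @ [e] \<in> positions P t \<longleftrightarrow> e \<in> dE P \<and> (p, dp P e) \<in> snd t"
  by (auto simp: positions_def)

lemma Nil_position [simp]: "[] \<in> positions P t"
  by (simp add: positions_def)

lemma Domain_subset_positions: "t \<in> pos_trees P \<Longrightarrow> p \<in> Domain (snd t) \<Longrightarrow> p \<in> positions P t"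
  by (cases p rule: rev_cases) (auto simp: position_snoc dest: pos_treeD)

lemma position_prefix:
  assumes "t \<in> pos_trees P" and "p @ q \<in> positions P t" and "q \<noteq> []"
  shows "p \<in> Domain (snd t)"
proof -
  obtain q' e where q: "q = q' @ [e]" using assms(3) by (cases q rule: rev_cases) auto
  then have "p @ q' \<in> Domain (snd t)"
    using assms(2) position_snoc[of "p @ q'" e P t] by auto
  then show ?thesis by (rule Domain_prefix[OF assms(1)])
qed

text \<open>For nonempty \<open>q\<close> both sides ask for the same node below the last edge. The
  hypothesis handles \<open>q = []\<close>, which is a position of every tree.\<close>

lemma positions_upper:
  assumes "p \<in> positions P t"
  shows "q \<in> positions P (upper P t p) \<longleftrightarrow> p @ q \<in> positions P t"
proof (cases q rule: rev_cases)
  case (snoc q' e)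
  then show ?thesis
    using position_snoc[of q' e P "upper P t p"] position_snoc[of "p @ q'" e P t]
    by (simp add: upper_def)
qed (use assms in simp)

lemma Domain_upper: "q \<in> Domain (snd (upper P t p)) \<longleftrightarrow> p @ q \<in> Domain (snd t)"
  by (auto simp: upper_def)

lemma leaf_positions_upper:
  "p \<in> positions P t \<Longrightarrow> q \<in> leaf_positions P (upper P t p) \<longleftrightarrow> p @ q \<in> leaf_positions P t"
  by (simp add: leaf_positions_def positions_upper Domain_upper)

lemma positions_mono: "lower P r t \<Longrightarrow> p \<in> positions P r \<Longrightarrow> p \<in> positions P t"
  by (auto simp: lower_def positions_def)

lemma pos_trees_subset:
  assumes t: "t \<in> pos_trees P" and "G \<subseteq> snd t"
    and "\<And>p e b. (p @ [e], b) \<in> G \<Longrightarrow> (p, dp P e) \<in> G"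
  shows "(fst t, G) \<in> pos_trees P"
  by (rule pos_treeI) (use assms(2,3) pos_treeD[OF t] finite_subset[OF assms(2)] in blast)+

text \<open>Climb along \<open>l\<close>. At a node of \<open>r\<close> the label in
  \<open>t\<close> is the label in \<open>r\<close>, so the next edge belongs to \<open>r\<close>
  and is either a leaf of \<open>r\<close> or the output of another node of \<open>r\<close>. Once a
  leaf of \<open>r\<close> has been passed, it stays a prefix.\<close>

lemma position_decomp:
  assumes "lower P r t"
  shows "l \<in> positions P t \<Longrightarrow> l \<in> Domain (snd r) \<or> (\<exists>p\<in>leaf_positions P r. \<exists>q. l = p @ q)"
proof (induction l rule: rev_induct)
  case Nil
  show ?case
    using Nil_position[of P r] by (auto simp: leaf_positions_def)
next
  case (snoc e l)
  note D = lowerD[OF assms]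
  have le: "e \<in> dE P" "(l, dp P e) \<in> snd t" using snoc.prems by (auto simp: position_snoc)
  then have "l \<in> positions P t" by (blast intro: Domain_subset_positions[OF D(2)])
  with snoc.IH consider b where "(l, b) \<in> snd r" | p q where "p \<in> leaf_positions P r" "l = p @ q"
    by blast
  then show ?case
  proof cases
    case 1
    then have "(l, dp P e) \<in> snd r" using le D(4) pos_treeD(5)[OF D(2)] by metis
    then have "l @ [e] \<in> positions P r" using le by (simp add: position_snoc)
    then show ?thesis
      by (cases "l @ [e] \<in> Domain (snd r)") (auto simp: leaf_positions_def intro: exI[of _ "[]"])
  next
    case 2
    then show ?thesis by (metis append.assoc)
  qed
qed

text \<open>Of two prefixes of one list one extends the other, and a proper extension of a leaf is
  not a position, since it would require a node at the leaf.\<close>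

lemma leaf_prefix_unique:
  assumes "r \<in> pos_trees P" and p: "p \<in> leaf_positions P r" and p': "p' \<in> leaf_positions P r"
    and "p @ q = p' @ q'"
  shows "p = p'"
proof -
  have *: "us = []" if "p1 \<in> leaf_positions P r" "p1 @ us \<in> leaf_positions P r" for p1 us
    using that position_prefix[OF assms(1), of p1 us] by (auto simp: leaf_positions_def)
  from assms(4) obtain us where "p = p' @ us \<or> p @ us = p'"
    unfolding append_eq_append_conv2 by blast
  then show ?thesis using * p p' by fastforce
qed

text \<open>A node of \<open>s\<close> either sits at a position of a node of \<open>r\<close>, and
  then its label is that of \<open>r\<close>, or lies above a leaf of \<open>r\<close>, where the
  upper parts of \<open>s\<close> and \<open>s'\<close> agree. By symmetry this inclusion yields
  \<open>graft_unique\<close>.\<close>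

lemma lower_eq_on_upper:
  assumes "lower P r s" "lower P r s'" and s: "lower P s t" and s': "lower P s' t"
    and eq: "\<And>p. p \<in> leaf_positions P r \<Longrightarrow> upper P s p = upper P s' p"
  shows "snd s \<subseteq> snd s'"
proof clarify
  fix l b assume lb: "(l, b) \<in> snd s"
  then have "l \<in> positions P s"
    by (blast intro: Domain_subset_positions[OF lowerD(1)[OF s]])
  then consider c where "(l, c) \<in> snd r" | p q where "p \<in> leaf_positions P r" "l = p @ q"
    using position_decomp[OF assms(1)] by blast
  then show "(l, b) \<in> snd s'"
  proof cases
    case 1
    then show ?thesis
      using lb pos_treeD(5)[OF lowerD(2)[OF assms(1)]] lowerD(4)[OF assms(1)] lowerD(4)[OF assms(2)]
      by blast
  next
    case 2
    then have "(q, b) \<in> snd (upper P s p)" using lb by (simp add: upper_def)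
    then show ?thesis unfolding eq[OF 2(1)] by (simp add: upper_def 2)
  qed
qed

context
  fixes P :: "('i, 'e, 'b, 'i) diagram"
  assumes P: "finitary_endo P"
begin

lemma upper_pos_tree:
  assumes t: "t \<in> pos_trees P" and p: "p \<in> positions P t"
  shows "upper P t p \<in> pos_trees P"
proof -
  have "colour P (fst t) p \<in> dI P"
    using pos_treeD(1)[OF t] p P
    by (cases p rule: rev_cases) (auto simp: colour_def position_snoc finitary_endo_def is_diagram_def)
  moreover have "finite {(q, b). (p @ q, b) \<in> snd t}"
    using finite_vimageI[OF pos_treeD(2)[OF t], of "\<lambda>(q, b). (p @ q, b)"]
    by (simp add: vimage_def inj_def case_prod_unfold prod_eq_iff)
  ultimately show ?thesis
    unfolding upper_def
    by (rule pos_treeI)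
      (use pos_treeD(3-5)[OF t] pos_treeD(6,7)[OF t, where p = "p @ q" for q] in auto)
qed

text \<open>There are finitely many nodes, and each has finitely many inputs because
  \<open>P\<close> is finitary.\<close>

lemma finite_positions:
  assumes t: "t \<in> pos_trees P"
  shows "finite (positions P t)"
proof (rule finite_subset)
  show "positions P t \<subseteq> insert [] (\<Union>(p, b)\<in>snd t. (\<lambda>e. p @ [e]) ` fib_E P b)"
    by (auto simp: positions_def fib_E_def)
  show "finite (insert [] (\<Union>(p, b)\<in>snd t. (\<lambda>e. p @ [e]) ` fib_E P b))"
    using pos_treeD(2,3)[OF t] P by (auto simp: finitary_endo_def)
qed

text \<open>The nodes of the grafted tree are those of \<open>r\<close> together with those of each
  \<open>u p\<close>, moved up by the prefix \<open>p\<close>.\<close>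

lemma graft_exists:
  assumes r: "lower P r t" and u: "\<And>p. p \<in> leaf_positions P r \<Longrightarrow> lower P (u p) (upper P t p)"
  shows "\<exists>s. lower P r s \<and> lower P s t \<and> (\<forall>p\<in>leaf_positions P r. upper P s p = u p)"
proof -
  define G where "G = snd r \<union> {(p @ q, b) | p q b. p \<in> leaf_positions P r \<and> (q, b) \<in> snd (u p)}"
  note D = lowerD[OF r]
  have sub: "G \<subseteq> snd t"
    using D(4) lowerD(4)[OF u] unfolding G_def upper_def by force
  have G: "(fst t, G) \<in> pos_trees P"
  proof (rule pos_trees_subset[OF D(2) sub])
    fix x e b assume "(x @ [e], b) \<in> G"
    then consider "(x @ [e], b) \<in> snd r"
      | p q where "x @ [e] = p @ q" "p \<in> leaf_positions P r" "(q, b) \<in> snd (u p)"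
      by (auto simp: G_def)
    then show "(x, dp P e) \<in> G"
    proof cases
      case 1
      then show ?thesis using pos_treeD(7)[OF D(1)] by (auto simp: G_def)
    next
      case 2
      show ?thesis
      proof (cases q rule: rev_cases)
        \<comment> \<open>The junction: the root node of \<open>u p\<close> sits on a leaf edge of
          \<open>r\<close>, and the node below this edge belongs to \<open>r\<close>.\<close>
        case Nil
        then have "x @ [e] \<in> positions P r" using 2 by (simp add: leaf_positions_def)
        then show ?thesis by (simp add: position_snoc G_def)
      next
        case (snoc q' e')
        then have "(q', dp P e) \<in> snd (u p)" and "x = p @ q'"
          using 2 pos_treeD(7)[OF lowerD(1)[OF u[OF 2(2)]]] by auto
        then show ?thesis using 2 by (auto simp: G_def)
      qed
    qed
  qed
  have "upper P (fst t, G) p = u p" if p: "p \<in> leaf_positions P r" for p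
  proof -
    \<comment> \<open>No node of \<open>r\<close> is at or above the leaf \<open>p\<close>, so the
      part of the grafted tree above \<open>p\<close> consists of grafted nodes only; by
      \<open>leaf_prefix_unique\<close> they all come from \<open>u p\<close>.\<close>
    have nd: "p @ q \<notin> Domain (snd r)" for q
      using p Domain_prefix[OF D(1)] by (auto simp: leaf_positions_def)
    have eq: "(p @ q, b) \<in> G \<longleftrightarrow> (q, b) \<in> snd (u p)" for q b
    proof
      assume *: "(p @ q, b) \<in> G"
      have "(p @ q, b) \<notin> snd r" using nd by blast
      with * obtain p' q' where 1: "p @ q = p' @ q'" "p' \<in> leaf_positions P r" "(q', b) \<in> snd (u p')"
        unfolding G_def by blast
      moreover have "p = p'" by (rule leaf_prefix_unique[OF D(1) p 1(2,1)])
      ultimately show "(q, b) \<in> snd (u p)" by simp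
    qed (use p in \<open>unfold G_def, blast\<close>)
    then show ?thesis
      using lowerD(3)[OF u[OF p]] by (simp add: upper_def prod_eq_iff eq)
  qed
  moreover have "lower P r (fst t, G)" "lower P (fst t, G) t"
    using G sub D by (auto simp: lower_def G_def)
  ultimately show ?thesis by blast
qed

lemma cut_structure_pos_trees:
  "cut_structure (pos_trees P) (lower P) (leaf_positions P) (upper P) {t \<in> pos_trees P. snd t = {}}"
proof
  fix r s t p q
  show "r \<in> {t \<in> pos_trees P. snd t = {}} \<Longrightarrow> r \<in> pos_trees P" by simp
  show "lower P r t \<Longrightarrow> r \<in> pos_trees P \<and> t \<in> pos_trees P" by (simp add: lower_def)
  show "t \<in> pos_trees P \<Longrightarrow> lower P t t" by (simp add: lower_def)
  show "\<lbrakk>lower P r s; lower P s t\<rbrakk> \<Longrightarrow> lower P r t" by (auto simp: lower_def)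
  show "finite {r. lower P r t}" if "t \<in> pos_trees P"
    by (rule finite_subset[of _ "{fst t} \<times> Pow (snd t)"])
      (use pos_treeD(2)[OF that] in \<open>auto simp: lower_def\<close>)
  show "finite (leaf_positions P r)" if "r \<in> pos_trees P"
    using finite_positions[OF that] by (simp add: leaf_positions_def)
  have pos: "p \<in> positions P t" if "lower P r t" "p \<in> leaf_positions P r" for r t p
    using that positions_mono[OF that(1)] by (simp add: leaf_positions_def)
  show "upper P t p \<in> pos_trees P" if "lower P r t" "p \<in> leaf_positions P r"
    using that lowerD(2)[OF that(1)] by (intro upper_pos_tree pos)
  show "lower P (upper P s p) (upper P t p)" if "lower P r s" "lower P s t" "p \<in> leaf_positions P r"
    using upper_pos_tree[OF lowerD(1)[OF that(2)] pos[OF that(1,3)]]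
      upper_pos_tree[OF lowerD(2)[OF that(2)] positions_mono[OF that(2) pos[OF that(1,3)]]] that(2)
    by (auto simp: lower_def upper_def)
  show "p @ q \<in> leaf_positions P s"
    if "lower P r s" "p \<in> leaf_positions P r" "q \<in> leaf_positions P (upper P s p)"
    using that(3) leaf_positions_upper[OF pos[OF that(1,2)]] by simp
  show "upper P (upper P t p) q = upper P t (p @ q)" by (rule upper_upper)
  show "\<exists>p\<in>leaf_positions P r. \<exists>q\<in>leaf_positions P (upper P s p). l = p @ q"
    if rs: "lower P r s" and ls: "l \<in> leaf_positions P s" for l
  proof -
    have l: "l \<in> positions P s" "l \<notin> Domain (snd s)" using ls by (auto simp: leaf_positions_def)
    then have "l \<notin> Domain (snd r)" using rs by (auto simp: lower_def)
    then obtain p q where p: "p \<in> leaf_positions P r" and "l = p @ q"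
      using position_decomp[OF rs l(1)] by blast
    then show ?thesis
      using ls leaf_positions_upper[OF pos[OF rs p]] by blast
  qed
next
  show "\<lbrakk>r \<in> pos_trees P; p \<in> leaf_positions P r; p' \<in> leaf_positions P r; p @ q = p' @ q'\<rbrakk> \<Longrightarrow> p = p'"
    for r p p' q q' by (rule leaf_prefix_unique)
  show "s = s'" if "lower P r s" "lower P s t" "lower P r s'" "lower P s' t"
    "\<And>p. p \<in> leaf_positions P r \<Longrightarrow> upper P s p = upper P s' p" for r s s' t
    using lower_eq_on_upper[OF that(1,3,2,4) that(5)] lower_eq_on_upper[OF that(3,1,4,2) that(5)[symmetric]]
      lowerD(3)[OF that(2)] lowerD(3)[OF that(4)] by (auto simp: prod_eq_iff)
  show "\<exists>s. lower P r s \<and> lower P s t \<and> (\<forall>p\<in>leaf_positions P r. upper P s p = u p)"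
    if "lower P r t" "\<And>p. p \<in> leaf_positions P r \<Longrightarrow> lower P (u p) (upper P t p)" for r t u
    using that by (rule graft_exists)
next
  fix t assume t: "t \<in> pos_trees P"
  then have "(fst t, {}) \<in> pos_trees P" by (intro pos_trees_subset) auto
  with t show "\<exists>r\<in>{t \<in> pos_trees P. snd t = {}}. lower P r t"
    by (intro bexI[of _ "(fst t, {})"]) (auto simp: lower_def)
  show "upper P t [] = t" by (rule upper_Nil)
  fix p assume p: "p \<in> leaf_positions P t"
  then have "p @ q \<notin> Domain (snd t)" for q
    using Domain_prefix[OF t] by (auto simp: leaf_positions_def)
  then show "upper P t p \<in> {t \<in> pos_trees P. snd t = {}}"
    using p upper_pos_tree[OF t, of p] by (auto simp: leaf_positions_def upper_def)
next
  show "\<lbrakk>lower P r t; lower P r' t; r \<in> {t \<in> pos_trees P. snd t = {}};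
      r' \<in> {t \<in> pos_trees P. snd t = {}}\<rbrakk> \<Longrightarrow> r = r'" for r r' t
    by (auto simp: lower_def prod_eq_iff)
  show "r \<in> {t \<in> pos_trees P. snd t = {}} \<Longrightarrow> leaf_positions P r = {[]}" for r
    by (auto simp: leaf_positions_def positions_def)
  show "r = t" if r: "lower P r t"
    and tr: "\<And>p. p \<in> leaf_positions P r \<Longrightarrow> upper P t p \<in> {t \<in> pos_trees P. snd t = {}}" for r t
  proof -
    note D = lowerD[OF r]
    have "(l, b) \<in> snd r" if lb: "(l, b) \<in> snd t" for l b
    proof -
      \<comment> \<open>A node of \<open>t\<close> above a leaf of \<open>r\<close> would make the
        part of \<open>t\<close> above that leaf nontrivial.\<close>
      have "\<nexists>p q. p \<in> leaf_positions P r \<and> l = p @ q"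
        using tr lb by (auto simp: upper_def)
      then obtain c where "(l, c) \<in> snd r"
        using position_decomp[OF r, of l] Domain_subset_positions[OF D(2), of l] lb by blast
      then show ?thesis using pos_treeD(5)[OF D(2) lb] D(4) by blast
    qed
    then show ?thesis using D(3,4) by (auto simp: prod_eq_iff)
  qed
qed

end

section \<open>Positions of the edges of a decorated tree\<close>

text \<open>The list is the address of the final edge as seen from \<open>r\<close>: the decorations
  of the slots passed while climbing away from \<open>r\<close>. A relation is used because an
  address need not lead anywhere, and leads to only one edge by virtue of the tree and pullback
  conditions.\<close>

inductive walk :: "('a, 'm, 'n, 'a) diagram \<Rightarrow> ('m \<Rightarrow> 'e) \<Rightarrow> 'a \<Rightarrow> 'e list \<Rightarrow> 'a \<Rightarrow> bool"
  for D :: "('a, 'm, 'n, 'a) diagram" and g :: "'m \<Rightarrow> 'e" and r :: 'a where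
  walk_Nil: "walk D g r [] r"
| walk_snoc: "\<lbrakk>walk D g r p (dt D (dp D x)); x \<in> dE D\<rbrakk> \<Longrightarrow> walk D g r (p @ [g x]) (ds D x)"

lemma walk_Nil_iff [simp]: "walk D g r [] a \<longleftrightarrow> a = r"
  by (subst walk.simps) auto

lemma walk_snoc_iff:
  "walk D g r (p @ [e]) a \<longleftrightarrow> (\<exists>x\<in>dE D. e = g x \<and> a = ds D x \<and> walk D g r p (dt D (dp D x)))"
  by (subst walk.simps) auto

lemma walk_append_iff: "walk D g r (p @ q) a \<longleftrightarrow> (\<exists>b. walk D g r p b \<and> walk D g b q a)"
proof (induction q arbitrary: a rule: rev_induct)
  case (snoc e q)
  show ?case
    unfolding append_assoc[symmetric] walk_snoc_iff snoc.IH by blast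
qed simp

definition position_tree ::
  "('a, 'm, 'n, 'a) diagram \<Rightarrow> ('a \<Rightarrow> 'i) \<Rightarrow> ('m \<Rightarrow> 'e) \<Rightarrow> ('n \<Rightarrow> 'b) \<Rightarrow> ('i, 'e, 'b) pos_tree" where
  "position_tree D gI gE gB = (gI (tree_root D),
     {(p, gB n) | p n. n \<in> dB D \<and> walk D gE (tree_root D) p (dt D n)})"

lemma restrict_diagram_simps [simp]:
  "dI (restrict_diagram D (A, M, N)) = A" "dE (restrict_diagram D (A, M, N)) = M"
  "dB (restrict_diagram D (A, M, N)) = N" "dJ (restrict_diagram D (A, M, N)) = A"
  "ds (restrict_diagram D S) = ds D" "dp (restrict_diagram D S) = dp D" "dt (restrict_diagram D S) = dt D"
  by (simp_all add: restrict_diagram_def split: prod.splits)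

lemma tree_rootI: "dI D - ds D ` dE D = {r} \<Longrightarrow> tree_root D = r"
  by (simp add: tree_root_def)

lemma sigma_ds:
  assumes "inj_on (ds D) (dE D)" and "dI D - ds D ` dE D = {r}" and "x \<in> dE D"
  shows "sigma D (ds D x) = dt D (dp D x)"
  using assms tree_rootI[OF assms(2)] by (auto simp: sigma_def the_inv_into_f_f)

text \<open>Each step of a walk is undone by one application of \<open>sigma\<close>.\<close>

lemma walk_funpow_sigma:
  assumes "inj_on (ds D) (dE D)" and "dI D - ds D ` dE D = {r}"
  shows "walk D g a p c \<Longrightarrow> \<exists>k. (sigma D ^^ k) c = a"
proof (induction rule: walk.induct)
  case walk_Nil
  show ?case by (rule exI[of _ 0]) simp
next
  case (walk_snoc p x)
  then obtain k where "(sigma D ^^ k) (dt D (dp D x)) = a" by blast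
  then have "(sigma D ^^ Suc k) (ds D x) = a"
    by (simp only: funpow_Suc_right o_apply sigma_ds[OF assms walk_snoc.hyps(2)])
  then show ?case by blast
qed

text \<open>Replaces the condition on iterates of \<open>sigma\<close> by the existence of walks
  from the root, with any labelling \<open>g\<close> of the slots.\<close>

lemma is_treeI:
  assumes "is_diagram D" "dI D = dJ D" "finite (dI D)" "finite (dE D)" "finite (dB D)"
    and "inj_on (dt D) (dB D)" and s: "inj_on (ds D) (dE D)" "dI D - ds D ` dE D = {r}"
    and "\<And>a. a \<in> dI D \<Longrightarrow> \<exists>p. walk D g r p a"
  shows "is_tree D"
  unfolding is_tree_def
  using assms walk_funpow_sigma[OF s] by (simp add: tree_rootI) blast

locale decorated_tree =
  fixes P :: "('i, 'e, 'b, 'i) diagram" and D :: "('a, 'm, 'n, 'a) diagram"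
    and gI :: "'a \<Rightarrow> 'i" and gE :: "'m \<Rightarrow> 'e" and gB :: "'n \<Rightarrow> 'b"
  assumes tree: "is_tree D" and cart: "cartesian_map D P gI gE gB"
begin

abbreviation root where "root \<equiv> tree_root D"
abbreviation pos where "pos \<equiv> position_tree D gI gE gB"

lemma diagram: "x \<in> dE D \<Longrightarrow> ds D x \<in> dI D" "x \<in> dE D \<Longrightarrow> dp D x \<in> dB D" "n \<in> dB D \<Longrightarrow> dt D n \<in> dI D"
  using tree by (auto simp: is_tree_def is_diagram_def)

lemma inj_dt: "inj_on (dt D) (dB D)" and inj_ds: "inj_on (ds D) (dE D)"
  and finite_dI: "finite (dI D)" and finite_dE: "finite (dE D)" and finite_dB: "finite (dB D)"
  and dJ: "dJ D = dI D"
  using tree by (auto simp: is_tree_def)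

lemma root_compl: "dI D - ds D ` dE D = {root}"
proof -
  obtain a where "dI D - ds D ` dE D = {a}" using tree by (auto simp: is_tree_def)
  then show ?thesis using tree_rootI by metis
qed

lemma root_in: "root \<in> dI D" and ds_neq_root: "x \<in> dE D \<Longrightarrow> ds D x \<noteq> root"
  and edge_cases: "a \<in> dI D \<Longrightarrow> a = root \<or> (\<exists>x\<in>dE D. a = ds D x)"
  using root_compl by auto

lemma maps: "a \<in> dI D \<Longrightarrow> gI a \<in> dI P" "x \<in> dE D \<Longrightarrow> gE x \<in> dE P" "n \<in> dB D \<Longrightarrow> gB n \<in> dB P"
  and commute: "x \<in> dE D \<Longrightarrow> ds P (gE x) = gI (ds D x)" "x \<in> dE D \<Longrightarrow> dp P (gE x) = gB (dp D x)"
    "n \<in> dB D \<Longrightarrow> dt P (gB n) = gI (dt D n)"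
  and pullback: "bij_betw (\<lambda>x. (dp D x, gE x)) (dE D) {(n, y). n \<in> dB D \<and> y \<in> dE P \<and> gB n = dp P y}"
  using cart by (auto simp: cartesian_map_def)

text \<open>The injective half of the pullback condition, and the source of rigidity: decorations
  tell the inputs of a node apart. The surjective half is \<open>slot_exists\<close>.\<close>

lemma slot_eqI: "\<lbrakk>x \<in> dE D; y \<in> dE D; dp D x = dp D y; gE x = gE y\<rbrakk> \<Longrightarrow> x = y"
  using pullback by (auto simp: bij_betw_def inj_on_def)

lemma slot_exists:
  assumes "n \<in> dB D" "e \<in> dE P" "gB n = dp P e"
  shows "\<exists>x\<in>dE D. dp D x = n \<and> gE x = e"
proof -
  have "(n, e) \<in> (\<lambda>x. (dp D x, gE x)) ` dE D"
    using pullback assms by (simp add: bij_betw_def)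
  then show ?thesis by auto
qed

lemma walk_in: "walk D gE a p c \<Longrightarrow> a \<in> dI D \<Longrightarrow> c \<in> dI D"
  by (induction rule: walk.induct) (auto simp: diagram)

text \<open>The edge reached so far determines the node above it, because \<open>dt D\<close> is
  injective, and the next decoration determines the slot of that node.\<close>

lemma walk_functional: "walk D gE a p c \<Longrightarrow> walk D gE a p d \<Longrightarrow> c = d"
proof (induction p arbitrary: c d rule: rev_induct)
  case (snoc e p)
  then show ?case
    using inj_onD[OF inj_dt] diagram(2) slot_eqI unfolding walk_snoc_iff by metis
qed simp

text \<open>The way down from an edge is forced: \<open>ds D\<close> is injective, and the root is
  the only edge outside its image.\<close>

lemma walk_root_unique: "walk D gE root p c \<Longrightarrow> walk D gE root q c \<Longrightarrow> p = q"
proof (induction p arbitrary: c q rule: rev_induct)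
  case Nil
  then show ?case
    by (cases q rule: rev_cases) (auto simp: walk_snoc_iff dest: ds_neq_root)
next
  case (snoc e p)
  then obtain x where x: "x \<in> dE D" "e = gE x" "c = ds D x" "walk D gE root p (dt D (dp D x))"
    unfolding walk_snoc_iff by blast
  then have "q \<noteq> []" using snoc.prems(2) ds_neq_root by auto
  then obtain q' e' where q: "q = q' @ [e']" by (cases q rule: rev_cases) auto
  then obtain y where "y \<in> dE D" "e' = gE y" "c = ds D y" "walk D gE root q' (dt D (dp D y))"
    using snoc.prems(2) unfolding q walk_snoc_iff by blast
  moreover from this x have "x = y" using inj_onD[OF inj_ds] by metis
  ultimately show ?case using snoc.IH x q by blast
qed

lemma funpow_sigma_walk:
  "c \<in> dI D \<Longrightarrow> (sigma D ^^ k) c = a \<Longrightarrow> \<exists>p. walk D gE a p c"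
proof (induction k arbitrary: c)
  case 0
  then show ?case by (auto intro: exI[of _ "[]"])
next
  case (Suc k)
  have k: "(sigma D ^^ k) (sigma D c) = a"
    using Suc.prems(2) by (simp only: funpow_Suc_right o_apply)
  from edge_cases[OF Suc.prems(1)] show ?case
  proof
    \<comment> \<open>\<open>sigma\<close> fixes the root, so this iteration contributes no step to
      the walk.\<close>
    assume "c = root"
    then have "sigma D c = c" by (simp add: sigma_def)
    then show ?thesis using Suc.IH[OF Suc.prems(1)] k by simp
  next
    assume "\<exists>x\<in>dE D. c = ds D x"
    then obtain x where x: "x \<in> dE D" "c = ds D x" by blast
    then have "sigma D c = dt D (dp D x)" by (simp add: sigma_ds[OF inj_ds root_compl])
    then obtain p where "walk D gE a p (dt D (dp D x))"
      using Suc.IH[of "dt D (dp D x)"] k x diagram by auto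
    from walk_snoc[OF this x(1)] show ?thesis using x by blast
  qed
qed

lemma walk_exists: "a \<in> dI D \<Longrightarrow> \<exists>p. walk D gE root p a"
  using tree funpow_sigma_walk unfolding is_tree_def by metis

lemma descendants_iff: "a \<in> dI D \<Longrightarrow> c \<in> descendants D a \<longleftrightarrow> (\<exists>p. walk D gE a p c)"
  using funpow_sigma_walk walk_funpow_sigma[OF inj_ds root_compl] walk_in
  by (fastforce simp: descendants_def)

text \<open>The edge of a slot has the colour prescribed by the decoration of the slot; this is why
  position trees need not store colours above the root.\<close>

lemma gI_walk: "walk D gE a p c \<Longrightarrow> gI c = colour P (gI a) p"
  by (induction rule: walk.induct) (auto simp: colour_def commute)

lemma pos_fst: "fst pos = gI root"
  by (simp add: position_tree_def)

lemma pos_snd_iff: "(p, b) \<in> snd pos \<longleftrightarrow> (\<exists>n\<in>dB D. b = gB n \<and> walk D gE root p (dt D n))"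
  by (auto simp: position_tree_def)

lemma pos_label: "(p, b) \<in> snd pos \<Longrightarrow> n \<in> dB D \<Longrightarrow> walk D gE root p (dt D n) \<Longrightarrow> b = gB n"
  using walk_functional inj_onD[OF inj_dt] unfolding pos_snd_iff by metis

text \<open>That every position is the address of an edge is the surjective half of the pullback:
  each input of the label of a node occurs as a slot of this node.\<close>

lemma positions_pos: "p \<in> positions P pos \<longleftrightarrow> (\<exists>a. walk D gE root p a)"
proof (cases p rule: rev_cases)
  case (snoc q e)
  have "(e \<in> dE P \<and> (q, dp P e) \<in> snd pos) \<longleftrightarrow>
      (\<exists>x\<in>dE D. e = gE x \<and> walk D gE root q (dt D (dp D x)))"
  proof
    assume "e \<in> dE P \<and> (q, dp P e) \<in> snd pos"
    then obtain n where n: "e \<in> dE P" "n \<in> dB D" "gB n = dp P e" "walk D gE root q (dt D n)"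
      unfolding pos_snd_iff by metis
    then show "\<exists>x\<in>dE D. e = gE x \<and> walk D gE root q (dt D (dp D x))"
      using slot_exists[OF n(2,1,3)] by blast
  qed (auto simp: pos_snd_iff maps commute diagram)
  then show ?thesis by (auto simp: snoc position_snoc walk_snoc_iff)
qed auto

lemma pos_in: "pos \<in> pos_trees P"
proof -
  have fin: "finite (snd pos)"
  proof (rule finite_subset)
    show "snd pos \<subseteq> (\<lambda>n. (THE p. walk D gE root p (dt D n), gB n)) ` dB D"
    proof clarify
      fix p b assume "(p, b) \<in> snd pos"
      then obtain n where n: "n \<in> dB D" "b = gB n" "walk D gE root p (dt D n)"
        unfolding pos_snd_iff by blast
      moreover from n(3) have "(THE p. walk D gE root p (dt D n)) = p"
        by (rule the_equality) (rule walk_root_unique[OF _ n(3)])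
      ultimately show "(p, b) \<in> (\<lambda>n. (THE p. walk D gE root p (dt D n), gB n)) ` dB D" by force
    qed
  qed (simp add: finite_dB)
  have "(gI root, snd pos) \<in> pos_trees P"
  proof (rule pos_treeI[OF maps(1)[OF root_in] fin])
    fix p b assume "(p, b) \<in> snd pos"
    then obtain n where n: "n \<in> dB D" "b = gB n" "walk D gE root p (dt D n)"
      unfolding pos_snd_iff by blast
    then show "b \<in> dB P" "dt P b = colour P (gI root) p"
      using gI_walk[OF n(3)] by (auto simp: maps commute)
    fix b' assume "(p, b') \<in> snd pos"
    then show "b = b'" using pos_label n by auto
  next
    fix p e b assume "(p @ [e], b) \<in> snd pos"
    then have "p @ [e] \<in> positions P pos" unfolding positions_pos pos_snd_iff by blast
    then show "e \<in> dE P" "(p, dp P e) \<in> snd pos" by (simp_all add: position_snoc)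
  qed
  then show ?thesis by (simp add: pos_fst[symmetric])
qed

lemma Domain_pos: "p \<in> Domain (snd pos) \<longleftrightarrow> (\<exists>n\<in>dB D. walk D gE root p (dt D n))"
  by (auto simp: pos_snd_iff Domain_iff)

lemma leaf_positions_pos:
  assumes "walk D gE root p a"
  shows "p \<in> leaf_positions P pos \<longleftrightarrow> a \<in> leaves D"
  using assms walk_functional[OF assms] walk_in[OF assms root_in]
  unfolding leaf_positions_def leaves_def Diff_iff positions_pos Domain_pos by blast

text \<open>Taking \<open>M\<close> to consist of all slots over \<open>N\<close> is the pullback
  condition for the inclusion; the walks inside the restricted diagram make every edge descend to
  \<open>r\<close>.\<close>

lemma subtreeI:
  assumes N: "N \<subseteq> dB D" and M: "M = {x \<in> dE D. dp D x \<in> N}" and A: "A = insert r (ds D ` M)"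
    and r: "r \<in> dI D" "r \<notin> ds D ` M" and tN: "dt D ` N \<subseteq> A"
    and walk: "\<And>a. a \<in> A \<Longrightarrow> \<exists>p. walk (restrict_diagram D (A, M, N)) gE r p a"
  shows "is_subtree D (A, M, N) \<and> tree_root (restrict_diagram D (A, M, N)) = r"
proof
  let ?R = "restrict_diagram D (A, M, N)"
  have sub: "M \<subseteq> dE D" "A \<subseteq> dI D" using M A r diagram by auto
  have compl: "dI ?R - ds ?R ` dE ?R = {r}" using A r by auto
  show "tree_root ?R = r" by (rule tree_rootI[OF compl])
  have "is_tree ?R"
  proof (rule is_treeI[OF _ _ _ _ _ _ _ compl])
    show "is_diagram ?R" using A M tN by (auto simp: is_diagram_def)
    show "\<And>a. a \<in> dI ?R \<Longrightarrow> \<exists>p. walk ?R gE r p a" using walk by simp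
  qed (use finite_subset[OF sub(1) finite_dE] finite_subset[OF sub(2) finite_dI]
      finite_subset[OF N finite_dB] inj_on_subset[OF inj_dt N] inj_on_subset[OF inj_ds sub(1)] in auto)
  moreover have "cartesian_map ?R D id id id"
    using N sub M by (auto simp: cartesian_map_def bij_betw_def inj_on_def)
  ultimately show "is_subtree D (A, M, N)" by (simp add: is_subtree_def)
qed

lemma subtreeD:
  assumes "is_subtree D (A, M, N)"
  shows "N \<subseteq> dB D" and "M = {x \<in> dE D. dp D x \<in> N}"
    and "A = insert (tree_root (restrict_diagram D (A, M, N))) (ds D ` M)"
    and "dt D ` N \<subseteq> A" and "A \<subseteq> dI D"
    and "decorated_tree P (restrict_diagram D (A, M, N)) gI gE gB"
proof -
  let ?R = "restrict_diagram D (A, M, N)"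
  have tree: "is_tree ?R" and c: "cartesian_map ?R D id id id"
    using assms by (auto simp: is_subtree_def)
  show N: "N \<subseteq> dB D" and sub: "A \<subseteq> dI D" using c by (auto simp: cartesian_map_def)
  have "(\<lambda>x. (dp D x, x)) ` M = {(n, y). n \<in> N \<and> y \<in> dE D \<and> n = dp D y}"
    using c by (simp add: cartesian_map_def bij_betw_def)
  \<comment> \<open>For an inclusion the pullback consists of the slots of \<open>D\<close> over
    \<open>N\<close>; the second projection turns the bijection into an equation for
    \<open>M\<close>.\<close>
  then have "snd ` (\<lambda>x. (dp D x, x)) ` M = snd ` {(n, y). n \<in> N \<and> y \<in> dE D \<and> n = dp D y}"
    by simp
  then show M: "M = {x \<in> dE D. dp D x \<in> N}" by (simp add: image_image) force
  obtain r where r: "A - ds D ` M = {r}" using tree by (auto simp: is_tree_def)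
  have s: "ds D ` M \<subseteq> A" and tN: "dt D ` N \<subseteq> A"
    using tree by (auto simp: is_tree_def is_diagram_def)
  then show "dt D ` N \<subseteq> A" by simp
  show "A = insert (tree_root ?R) (ds D ` M)"
    using r s tree_rootI[of ?R r] by auto
  have "bij_betw (\<lambda>x. (dp D x, gE x)) M {(n, y). n \<in> N \<and> y \<in> dE P \<and> gB n = dp P y}"
    unfolding bij_betw_def
  proof
    show "inj_on (\<lambda>x. (dp D x, gE x)) M"
      using slot_eqI by (auto simp: inj_on_def M)
    show "(\<lambda>x. (dp D x, gE x)) ` M = {(n, y). n \<in> N \<and> y \<in> dE P \<and> gB n = dp P y}"
      using N slot_exists by (fastforce simp: M maps commute)
  qed
  then have "cartesian_map ?R P gI gE gB"
    using N sub by (auto simp: cartesian_map_def M maps commute)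
  with tree show "decorated_tree P ?R gI gE gB" by unfold_locales
qed

text \<open>An edge of \<open>A\<close> other than the root comes from a slot in \<open>M\<close>,
  which by injectivity of \<open>ds D\<close> is the slot through which the walk arrives. Its node
  and the output edge of that node are again in the cut, so a walk that ends in the cut never left
  it.\<close>

lemma walk_restrict_cut:
  assumes "is_cut D (A, M, N)"
  shows "walk (restrict_diagram D (A, M, N)) gE root p a \<longleftrightarrow> walk D gE root p a \<and> a \<in> A"
proof -
  let ?R = "restrict_diagram D (A, M, N)"
  have S: "is_subtree D (A, M, N)" and r: "tree_root ?R = root"
    using assms by (auto simp: is_cut_def)
  note S = subtreeD[OF S]
  have A: "A = insert root (ds D ` M)" using S(3) r by simp
  show ?thesis
  proof (induction p arbitrary: a rule: rev_induct)
    case Nil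
    then show ?case using A by auto
  next
    case (snoc e p)
    have "walk ?R gE root (p @ [e]) a \<longleftrightarrow>
        (\<exists>x\<in>M. e = gE x \<and> a = ds D x \<and> walk D gE root p (dt D (dp D x)) \<and> dt D (dp D x) \<in> A)"
      by (simp add: walk_snoc_iff snoc.IH)
    also have "\<dots> \<longleftrightarrow> (\<exists>x\<in>M. e = gE x \<and> a = ds D x \<and> walk D gE root p (dt D (dp D x)))"
      using S(2,4) by blast
    also have "\<dots> \<longleftrightarrow> (\<exists>x\<in>dE D. e = gE x \<and> a = ds D x \<and> walk D gE root p (dt D (dp D x)) \<and> a \<in> A)"
    proof
      assume "\<exists>x\<in>dE D. e = gE x \<and> a = ds D x \<and> walk D gE root p (dt D (dp D x)) \<and> a \<in> A"
      then obtain x where x: "x \<in> dE D" "e = gE x" "a = ds D x" "walk D gE root p (dt D (dp D x))" "a \<in> A"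
        by blast
      have "x \<in> M"
      proof -
        have "a \<noteq> root" using ds_neq_root x by simp
        then obtain y where "y \<in> M" "a = ds D y" using x(5) A by blast
        then show ?thesis using inj_onD[OF inj_ds, of x y] x S(2) by auto
      qed
      with x show "\<exists>x\<in>M. e = gE x \<and> a = ds D x \<and> walk D gE root p (dt D (dp D x))" by blast
    qed (use S(2) A in auto)
    finally show ?case by (auto simp: walk_snoc_iff)
  qed
qed

text \<open>The inverse of \<open>pos_sub\<close> between the cuts of \<open>D\<close> and the trees
  lower than \<open>pos\<close>; that both composites are identities is part of
  \<open>cut_lower\<close> and \<open>cut_at_cut\<close>.\<close>

definition cut_at :: "('i, 'e, 'b) pos_tree \<Rightarrow> 'a set \<times> 'm set \<times> 'n set" where
  "cut_at r =
     ({a \<in> dI D. \<exists>p\<in>positions P r. walk D gE root p a},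
      {x \<in> dE D. \<exists>p\<in>Domain (snd r). walk D gE root p (dt D (dp D x))},
      {n \<in> dB D. \<exists>p\<in>Domain (snd r). walk D gE root p (dt D n)})"

abbreviation pos_sub where "pos_sub S \<equiv> position_tree (restrict_diagram D S) gI gE gB"

lemma pos_sub_cut:
  assumes "is_cut D (A, M, N)"
  shows "pos_sub (A, M, N) = (gI root, {(p, gB n) | p n. n \<in> N \<and> walk D gE root p (dt D n)})"
proof -
  have "dt D ` N \<subseteq> A" and "tree_root (restrict_diagram D (A, M, N)) = root"
    using subtreeD(4)[of A M N] assms by (auto simp: is_cut_def)
  then show ?thesis
    by (auto simp: position_tree_def walk_restrict_cut[OF assms])
qed

text \<open>The cut is recovered from its position tree because an address leads to at most one
  edge, and an edge is the output of at most one node.\<close>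

lemma cut_lower:
  assumes S: "is_cut D S"
  shows "lower P (pos_sub S) pos" and "cut_at (pos_sub S) = S"
proof -
  obtain A M N where e: "S = (A, M, N)" by (cases S)
  let ?R = "restrict_diagram D S"
  have sub: "is_subtree D (A, M, N)" and r: "tree_root ?R = root"
    using S by (auto simp: is_cut_def e)
  note SD = subtreeD[OF sub]
  interpret R: decorated_tree P ?R gI gE gB unfolding e by (rule SD(6))
  note ps = pos_sub_cut[OF S[unfolded e], folded e]
  have "snd (pos_sub S) \<subseteq> snd pos"
    using SD(1) unfolding ps by (auto simp: position_tree_def)
  then show "lower P (pos_sub S) pos"
    using R.pos_in pos_in by (simp add: lower_def pos_fst ps)
  have pp: "p \<in> positions P (pos_sub S) \<longleftrightarrow> (\<exists>a\<in>A. walk D gE root p a)" for p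
    unfolding R.positions_pos r unfolding e walk_restrict_cut[OF S[unfolded e]] by blast
  have dd: "p \<in> Domain (snd (pos_sub S)) \<longleftrightarrow> (\<exists>n\<in>N. walk D gE root p (dt D n))" for p
    unfolding ps by auto
  have "{a \<in> dI D. \<exists>p\<in>positions P (pos_sub S). walk D gE root p a} = A"
  proof (intro equalityI subsetI)
    fix a assume "a \<in> {a \<in> dI D. \<exists>p\<in>positions P (pos_sub S). walk D gE root p a}"
    then obtain p c where "c \<in> A" "walk D gE root p c" "walk D gE root p a" by (auto simp: pp)
    then show "a \<in> A" using walk_functional by blast
  next
    fix a assume "a \<in> A"
    moreover from this obtain p where "walk D gE root p a" using SD(5) walk_exists by blast
    ultimately show "a \<in> {a \<in> dI D. \<exists>p\<in>positions P (pos_sub S). walk D gE root p a}"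
      using SD(5) pp by blast
  qed
  moreover have N: "{n \<in> dB D. \<exists>p\<in>Domain (snd (pos_sub S)). walk D gE root p (dt D n)} = N"
  proof (intro equalityI subsetI)
    fix n assume "n \<in> {n \<in> dB D. \<exists>p\<in>Domain (snd (pos_sub S)). walk D gE root p (dt D n)}"
    then obtain p where p: "n \<in> dB D" "p \<in> Domain (snd (pos_sub S))" "walk D gE root p (dt D n)"
      by blast
    from p(2) obtain n' where n': "n' \<in> N" "walk D gE root p (dt D n')" unfolding dd by blast
    have "n = n'" using inj_onD[OF inj_dt walk_functional[OF p(3) n'(2)] p(1)] n'(1) SD(1) by blast
    with n' show "n \<in> N" by simp
  next
    fix n assume "n \<in> N"
    then show "n \<in> {n \<in> dB D. \<exists>p\<in>Domain (snd (pos_sub S)). walk D gE root p (dt D n)}"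
      using SD(1) walk_exists[OF diagram(3), of n] dd by blast
  qed
  moreover have "{x \<in> dE D. \<exists>p\<in>Domain (snd (pos_sub S)). walk D gE root p (dt D (dp D x))} = M"
    using N SD(2) diagram(2) by blast
  ultimately show "cut_at (pos_sub S) = S" by (simp add: cut_at_def e)
qed

lemma cut_at_cut:
  assumes r: "lower P r pos"
  shows "is_cut D (cut_at r)" and "pos_sub (cut_at r) = r"
proof -
  note L = lowerD[OF r]
  define A where "A = {a \<in> dI D. \<exists>p\<in>positions P r. walk D gE root p a}"
  define N where "N = {n \<in> dB D. \<exists>p\<in>Domain (snd r). walk D gE root p (dt D n)}"
  define M where "M = {x \<in> dE D. dp D x \<in> N}"
  have e: "cut_at r = (A, M, N)"
    using diagram(2) by (auto simp: cut_at_def A_def M_def N_def)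
  let ?R = "restrict_diagram D (A, M, N)"
  \<comment> \<open>As \<open>r\<close> is lower than \<open>pos\<close>, its label at
    \<open>q\<close> is the decoration of the actual node, so every slot of this node is an input in
    \<open>r\<close> too.\<close>
  have step: "q @ [gE x] \<in> positions P r"
    if x: "x \<in> dE D" and q: "q \<in> Domain (snd r)" and w: "walk D gE root q (dt D (dp D x))" for x q
  proof -
    obtain b where b: "(q, b) \<in> snd r" using q by blast
    then have "b = gB (dp D x)" using pos_label[OF L(4)[OF b] diagram(2)[OF x] w] by simp
    then show ?thesis using b x by (simp add: position_snoc maps commute)
  qed
  have AM: "A = insert root (ds D ` M)"
  proof (intro equalityI subsetI)
    fix a assume "a \<in> A"
    then obtain p where p: "p \<in> positions P r" "walk D gE root p a" by (auto simp: A_def)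
    show "a \<in> insert root (ds D ` M)"
    proof (cases p rule: rev_cases)
      case (snoc q e)
      with p(2) obtain x where x: "x \<in> dE D" "a = ds D x" "walk D gE root q (dt D (dp D x))"
        unfolding snoc walk_snoc_iff by blast
      moreover have "q \<in> Domain (snd r)" using p(1) by (auto simp: snoc position_snoc)
      ultimately show ?thesis using diagram(2) by (auto simp: M_def N_def)
    qed (use p in simp)
  next
    fix a assume "a \<in> insert root (ds D ` M)"
    then consider "a = root" | x where "x \<in> M" "a = ds D x" by blast
    then show "a \<in> A"
    proof cases
      case 1
      then show ?thesis by (auto simp: A_def root_in intro: bexI[of _ "[]"])
    next
      case 2
      then obtain q where q: "x \<in> dE D" "q \<in> Domain (snd r)" "walk D gE root q (dt D (dp D x))"
        by (auto simp: M_def N_def)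
      then show ?thesis
        using step[OF q] walk_snoc[OF q(3,1)] diagram(1) by (auto simp: A_def 2)
    qed
  qed
  have walkR: "walk ?R gE root p a" if "p \<in> positions P r" "walk D gE root p a" for p a
    using that
  proof (induction p arbitrary: a rule: rev_induct)
    case (snoc e p)
    then obtain x where x: "x \<in> dE D" "e = gE x" "a = ds D x" "walk D gE root p (dt D (dp D x))"
      unfolding walk_snoc_iff by blast
    have "p \<in> Domain (snd r)" using snoc.prems(1) by (auto simp: position_snoc)
    then have "p \<in> positions P r" "x \<in> M"
      using x diagram(2) Domain_subset_positions[OF L(1)] by (auto simp: M_def N_def)
    then show ?case using snoc.IH x by (auto simp: walk_snoc_iff)
  qed simp
  have "is_subtree D (A, M, N) \<and> tree_root ?R = root"
  proof (rule subtreeI)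
    show "N \<subseteq> dB D" by (auto simp: N_def)
    show "root \<notin> ds D ` M" using ds_neq_root by (force simp: M_def)
    show "dt D ` N \<subseteq> A"
      using Domain_subset_positions[OF L(1)] diagram(3) by (auto simp: N_def A_def)
    show "\<exists>p. walk ?R gE root p a" if "a \<in> A" for a
      using that walkR by (auto simp: A_def)
  qed (simp_all add: M_def AM root_in)
  then show cut: "is_cut D (cut_at r)" by (simp add: is_cut_def e)
  have iff: "(\<exists>n. b = gB n \<and> n \<in> N \<and> walk D gE root p (dt D n)) \<longleftrightarrow> (p, b) \<in> snd r" for p b
  proof
    assume "\<exists>n. b = gB n \<and> n \<in> N \<and> walk D gE root p (dt D n)"
    then obtain n q c where n: "b = gB n" "n \<in> dB D" "walk D gE root p (dt D n)"
      "(q, c) \<in> snd r" "walk D gE root q (dt D n)" by (auto simp: N_def)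
    then have "p = q" using walk_root_unique by blast
    moreover have "c = b" using pos_label[OF L(4)[OF n(4)]] n by blast
    ultimately show "(p, b) \<in> snd r" using n by simp
  next
    assume b: "(p, b) \<in> snd r"
    then obtain n where "n \<in> dB D" "b = gB n" "walk D gE root p (dt D n)"
      using L(4) pos_snd_iff by blast
    then show "\<exists>n. b = gB n \<and> n \<in> N \<and> walk D gE root p (dt D n)" using b by (auto simp: N_def)
  qed
  have "{(p, gB n) | p n. n \<in> N \<and> walk D gE root p (dt D n)} = snd r"
    using iff by (intro set_eqI) (simp only: mem_Collect_eq split_paired_all Pair_inject, blast)
  then show "pos_sub (cut_at r) = r"
    unfolding e pos_sub_cut[OF cut[unfolded e]] using L(3) pos_fst by (simp add: prod_eq_iff)
qed

text \<open>Descendants of \<open>a\<close> are the edges reached by walks from \<open>a\<close>,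
  and the address of such an edge from the root is \<open>p\<close> followed by its address from
  \<open>a\<close>.\<close>

lemma ideal_subtree:
  assumes a: "walk D gE root p a"
  shows "is_subtree D (ideal D a)" and "pos_sub (ideal D a) = upper P pos p"
proof -
  have aI: "a \<in> dI D" by (rule walk_in[OF a root_in])
  define A where "A = descendants D a"
  define N where "N = {n \<in> dB D. dt D n \<in> A}"
  define M where "M = {x \<in> dE D. dp D x \<in> N}"
  have e: "ideal D a = (A, M, N)"
    using diagram(2) by (auto simp: ideal_def A_def N_def M_def)
  let ?R = "restrict_diagram D (A, M, N)"
  have Aiff: "c \<in> A \<longleftrightarrow> (\<exists>q. walk D gE a q c)" for c
    unfolding A_def by (rule descendants_iff[OF aI])
  \<comment> \<open>If \<open>a\<close> were an input edge of a node above itself, going round once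
    more would give \<open>a\<close> a second, longer address.\<close>
  have aM: "a \<notin> ds D ` M"
  proof
    assume "a \<in> ds D ` M"
    then obtain x q where x: "x \<in> dE D" "a = ds D x" and q: "walk D gE a q (dt D (dp D x))"
      by (auto simp: M_def N_def Aiff)
    have "walk D gE a (q @ [gE x]) a" using walk_snoc[OF q x(1)] x(2) by simp
    then have "walk D gE root (p @ q @ [gE x]) a" using a unfolding walk_append_iff by blast
    then show False using walk_root_unique[OF a] by blast
  qed
  have walkR: "walk ?R gE a q c \<longleftrightarrow> walk D gE a q c" for q c
  proof (induction q arbitrary: c rule: rev_induct)
    case (snoc f q)
    have "x \<in> M \<and> walk D gE a q (dt D (dp D x)) \<longleftrightarrow> x \<in> dE D \<and> walk D gE a q (dt D (dp D x))" for x
      using diagram(2) by (auto simp: M_def N_def Aiff)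
    then show ?case unfolding walk_snoc_iff snoc.IH restrict_diagram_simps by blast
  qed simp
  have AM: "A = insert a (ds D ` M)"
  proof (intro equalityI subsetI)
    fix c assume "c \<in> A"
    then obtain q where q: "walk ?R gE a q c" by (auto simp: Aiff walkR)
    then show "c \<in> insert a (ds D ` M)"
      by (cases q rule: rev_cases) (auto simp: walk_snoc_iff)
  next
    fix c assume "c \<in> insert a (ds D ` M)"
    then consider "c = a" | x where "x \<in> M" "c = ds D x" by blast
    then show "c \<in> A"
    proof cases
      case 1
      then show ?thesis unfolding Aiff by (auto intro: exI[of _ "[]"])
    next
      case 2
      then obtain q where q: "x \<in> dE D" "walk D gE a q (dt D (dp D x))"
        by (auto simp: M_def N_def Aiff)
      show ?thesis using walk_snoc[OF q(2,1)] 2 unfolding Aiff by blast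
    qed
  qed
  have st: "is_subtree D (A, M, N) \<and> tree_root ?R = a"
  proof (rule subtreeI)
    show "\<exists>q. walk ?R gE a q c" if "c \<in> A" for c using that by (simp add: walkR Aiff)
    show "dt D ` N \<subseteq> A" "N \<subseteq> dB D" by (auto simp: N_def)
  qed (fact M_def AM aI aM)+
  then show "is_subtree D (ideal D a)" by (simp add: e)
  have ra: "tree_root ?R = a" using st by simp
  have "walk D gE a q c \<longleftrightarrow> walk D gE root (p @ q) c" for q c
    using a walk_functional[OF a] unfolding walk_append_iff by metis
  then have "(n \<in> N \<and> walk D gE a q (dt D n)) \<longleftrightarrow> (n \<in> dB D \<and> walk D gE root (p @ q) (dt D n))" for n q
    by (auto simp: N_def Aiff)
  then show "pos_sub (ideal D a) = upper P pos p"
    using gI_walk[OF a]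
    unfolding e position_tree_def ra walkR upper_def by (auto simp: prod_eq_iff)
qed

end

section \<open>Isomorphism classes of \<open>P\<close>-trees\<close>

lemma ptree_isoD:
  assumes "ptree_iso T T' g0 g1 g2"
  shows "bij_betw g0 (dI (shape T)) (dI (shape T'))"
    and "bij_betw g1 (dE (shape T)) (dE (shape T'))"
    and "bij_betw g2 (dB (shape T)) (dB (shape T'))"
    and "\<And>x. x \<in> dE (shape T) \<Longrightarrow> ds (shape T') (g1 x) = g0 (ds (shape T) x)"
    and "\<And>x. x \<in> dE (shape T) \<Longrightarrow> dp (shape T') (g1 x) = g2 (dp (shape T) x)"
    and "\<And>n. n \<in> dB (shape T) \<Longrightarrow> dt (shape T') (g2 n) = g0 (dt (shape T) n)"
    and "\<And>a. a \<in> dI (shape T) \<Longrightarrow> decI T' (g0 a) = decI T a"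
    and "\<And>x. x \<in> dE (shape T) \<Longrightarrow> decE T' (g1 x) = decE T x"
    and "\<And>n. n \<in> dB (shape T) \<Longrightarrow> decB T' (g2 n) = decB T n"
  using assms by (auto simp: ptree_iso_def cartesian_map_def)

definition tree_of :: "('i, 'e, 'b) ptree \<Rightarrow> ('i, 'e, 'b) pos_tree" where
  "tree_of T = position_tree (shape T) (decI T) (decE T) (decB T)"

definition at_pos :: "('i, 'e, 'b) ptree \<Rightarrow> 'e list \<Rightarrow> nat \<Rightarrow> bool" where
  "at_pos T p a \<longleftrightarrow> walk (shape T) (decE T) (tree_root (shape T)) p a"

lemma ptree_decorated: "T \<in> ptrees P \<Longrightarrow> decorated_tree P (shape T) (decI T) (decE T) (decB T)"
  by (simp add: ptrees_def is_ptree_def decorated_tree_def)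

context
  fixes P :: "('i, 'e, 'b, 'i) diagram" and T T' :: "('i, 'e, 'b) ptree" and g0 g1 g2
  assumes T: "T \<in> ptrees P" and T': "T' \<in> ptrees P" and iso: "ptree_iso T T' g0 g1 g2"
begin

interpretation A: decorated_tree P "shape T" "decI T" "decE T" "decB T"
  by (rule ptree_decorated[OF T])
interpretation B: decorated_tree P "shape T'" "decI T'" "decE T'" "decB T'"
  by (rule ptree_decorated[OF T'])

text \<open>The root is characterised as the edge outside the image of \<open>ds\<close>, which
  isomorphisms respect.\<close>

lemma iso_root: "g0 A.root = B.root"
proof -
  obtain a where a: "a \<in> dI (shape T)" "g0 a = B.root"
    using ptree_isoD(1)[OF iso] B.root_in by (metis bij_betw_imp_surj_on imageE)
  have "a = A.root"
  proof (rule ccontr)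
    assume "a \<noteq> A.root"
    then obtain x where x: "x \<in> dE (shape T)" "a = ds (shape T) x" using A.edge_cases[OF a(1)] by blast
    then have "ds (shape T') (g1 x) = B.root" using a ptree_isoD(4)[OF iso] by simp
    then show False using B.ds_neq_root bij_betwE[OF ptree_isoD(2)[OF iso]] x by blast
  qed
  with a show ?thesis by simp
qed

text \<open>Isomorphisms preserve the decorations of slots and hence addresses. Since an address has
  at most one edge, this also determines \<open>g0\<close> on edges.\<close>

lemma iso_at_pos: "at_pos T p a \<Longrightarrow> at_pos T' p (g0 a)"
  unfolding at_pos_def
proof (induction rule: walk.induct)
  case walk_Nil
  then show ?case by (simp add: iso_root)
next
  case (walk_snoc p x)
  note x = \<open>x \<in> dE (shape T)\<close>
  have "walk (shape T') (decE T') B.root p (dt (shape T') (dp (shape T') (g1 x)))"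
    using walk_snoc.IH by (simp add: ptree_isoD(5,6)[OF iso] A.diagram(2) x)
  from walk.walk_snoc[OF this] show ?case
    using bij_betwE[OF ptree_isoD(2)[OF iso]] x by (simp add: ptree_isoD(4,8)[OF iso])
qed

lemma iso_at_pos_iff: "a \<in> dI (shape T) \<Longrightarrow> at_pos T' p (g0 a) \<longleftrightarrow> at_pos T p a"
proof
  assume a: "a \<in> dI (shape T)" and p: "at_pos T' p (g0 a)"
  obtain q where q: "at_pos T q a" using A.walk_exists[OF a] by (auto simp: at_pos_def)
  then have "q = p" using iso_at_pos[OF q] p B.walk_root_unique by (auto simp: at_pos_def)
  with q show "at_pos T p a" by simp
qed (rule iso_at_pos)

lemma iso_tree_of: "tree_of T' = tree_of T"
proof -
  have im: "dB (shape T') = g2 ` dB (shape T)"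
    using ptree_isoD(3)[OF iso] by (simp add: bij_betw_def)
  have "snd (tree_of T') = {(p, decB T' n) | p n. n \<in> dB (shape T') \<and> at_pos T' p (dt (shape T') n)}"
    by (simp add: tree_of_def position_tree_def at_pos_def)
  also have "\<dots> = {(p, decB T' (g2 n)) | p n. n \<in> dB (shape T) \<and> at_pos T' p (dt (shape T') (g2 n))}"
    unfolding im by blast
  also have "\<dots> = {(p, decB T n) | p n. n \<in> dB (shape T) \<and> at_pos T p (dt (shape T) n)}"
    by (rule Collect_cong) (metis iso_at_pos_iff ptree_isoD(6,9)[OF iso] A.diagram(3))
  also have "\<dots> = snd (tree_of T)"
    by (simp add: tree_of_def position_tree_def at_pos_def)
  finally show ?thesis
    using ptree_isoD(7)[OF iso A.root_in] by (simp add: tree_of_def position_tree_def iso_root)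
qed

lemma iso_cut_at:
  "B.cut_at r = (case A.cut_at r of (A, M, N) \<Rightarrow> (g0 ` A, g1 ` M, g2 ` N))"
proof -
  have im: "dI (shape T') = g0 ` dI (shape T)" "dE (shape T') = g1 ` dE (shape T)"
    "dB (shape T') = g2 ` dB (shape T)"
    using ptree_isoD(1-3)[OF iso] by (simp_all add: bij_betw_def)
  have img: "{y \<in> h ` S. Q' y} = h ` {x \<in> S. Q x}" if "\<And>x. x \<in> S \<Longrightarrow> Q' (h x) \<longleftrightarrow> Q x"
    for h :: "nat \<Rightarrow> nat" and S Q Q' using that by blast
  have t: "at_pos T' p (dt (shape T') (g2 n)) \<longleftrightarrow> at_pos T p (dt (shape T) n)"
    if "n \<in> dB (shape T)" for p n
    using that by (simp add: ptree_isoD(6)[OF iso] iso_at_pos_iff A.diagram)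
  show ?thesis
    unfolding A.cut_at_def B.cut_at_def at_pos_def[symmetric] im prod.case
    by (intro arg_cong2[of _ _ _ _ Pair] img)
      (simp_all add: iso_at_pos_iff t ptree_isoD(5)[OF iso] A.diagram)
qed

end

text \<open>Edges are matched by address, nodes by their output edge, and slots by their node and
  decoration. With \<open>iso_tree_of\<close> this makes \<open>tree_of\<close> a complete
  invariant.\<close>

lemma iso_exists:
  assumes T: "T \<in> ptrees P" and T': "T' \<in> ptrees P" and eq: "tree_of T = tree_of T'"
  shows "\<exists>g0 g1 g2. ptree_iso T T' g0 g1 g2"
proof -
  interpret A: decorated_tree P "shape T" "decI T" "decE T" "decB T"
    by (rule ptree_decorated[OF T])
  interpret B: decorated_tree P "shape T'" "decI T'" "decE T'" "decB T'"
    by (rule ptree_decorated[OF T'])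
  let ?D = "shape T" and ?D' = "shape T'"
  have eq': "A.pos = B.pos" using eq by (simp add: tree_of_def)
  have rootI: "decI T A.root = decI T' B.root" using A.pos_fst B.pos_fst eq' by simp
  have ex: "\<exists>b\<in>dI ?D'. \<forall>p. at_pos T p a \<longrightarrow> at_pos T' p b" if a: "a \<in> dI ?D" for a
  proof -
    obtain p where p: "at_pos T p a" using A.walk_exists[OF a] by (auto simp: at_pos_def)
    then have "p \<in> positions P B.pos"
      unfolding eq'[symmetric] A.positions_pos by (auto simp: at_pos_def)
    then obtain b where "at_pos T' p b" unfolding B.positions_pos by (auto simp: at_pos_def)
    then show ?thesis
      using p A.walk_root_unique B.walk_in[OF _ B.root_in] unfolding at_pos_def by blast
  qed
  then obtain g0 where g0: "\<And>a. a \<in> dI ?D \<Longrightarrow> g0 a \<in> dI ?D'"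
    and at0: "\<And>a p. a \<in> dI ?D \<Longrightarrow> at_pos T p a \<Longrightarrow> at_pos T' p (g0 a)" by metis
  have at_eq: "b = g0 a" if "at_pos T p a" "at_pos T' p b" for p a b
    using that at0[OF _ that(1)] A.walk_in[OF _ A.root_in] B.walk_functional
    unfolding at_pos_def by blast
  have at_in: "a \<in> dI ?D" if "at_pos T p a" for p a
    using that A.walk_in[OF _ A.root_in] by (simp add: at_pos_def)
  have bij0: "bij_betw g0 (dI ?D) (dI ?D')"
    unfolding bij_betw_def
  proof
    show "inj_on g0 (dI ?D)"
    proof (rule inj_onI)
      fix a b assume ab: "a \<in> dI ?D" "b \<in> dI ?D" "g0 a = g0 b"
      obtain p q where p: "at_pos T p a" and q: "at_pos T q b"
        using A.walk_exists ab unfolding at_pos_def by blast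
      have "p = q"
        using at0[OF ab(1) p] at0[OF ab(2) q] ab(3) B.walk_root_unique by (simp add: at_pos_def)
      then show "a = b" using p q A.walk_functional by (simp add: at_pos_def)
    qed
    show "g0 ` dI ?D = dI ?D'"
    proof
      show "dI ?D' \<subseteq> g0 ` dI ?D"
      proof
        fix b assume "b \<in> dI ?D'"
        then obtain p where p: "at_pos T' p b" using B.walk_exists unfolding at_pos_def by blast
        then have "p \<in> positions P A.pos" unfolding eq' B.positions_pos by (auto simp: at_pos_def)
        then obtain a where a: "at_pos T p a" unfolding A.positions_pos by (auto simp: at_pos_def)
        show "b \<in> g0 ` dI ?D" using at_eq[OF a p] at_in[OF a] by blast
      qed
    qed (use g0 in blast)
  qed
  have root: "g0 A.root = B.root"
    using at_eq[of "[]" A.root B.root] by (simp add: at_pos_def)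
  have dec0: "decI T' (g0 a) = decI T a" if a: "a \<in> dI ?D" for a
  proof -
    obtain p where p: "at_pos T p a" using A.walk_exists[OF a] by (auto simp: at_pos_def)
    show ?thesis
      using A.gI_walk[OF p[unfolded at_pos_def]] B.gI_walk[OF at0[OF a p, unfolded at_pos_def]] rootI
      by simp
  qed
  have "\<exists>m\<in>dB ?D'. dt ?D' m = g0 (dt ?D n) \<and> decB T' m = decB T n" if n: "n \<in> dB ?D" for n
  proof -
    obtain p where p: "at_pos T p (dt ?D n)"
      using A.walk_exists[OF A.diagram(3)[OF n]] by (auto simp: at_pos_def)
    then have "(p, decB T n) \<in> snd B.pos"
      using n unfolding eq'[symmetric] A.pos_snd_iff by (auto simp: at_pos_def)
    then obtain m where m: "m \<in> dB ?D'" "decB T n = decB T' m" "at_pos T' p (dt ?D' m)"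
      unfolding B.pos_snd_iff by (auto simp: at_pos_def)
    then show ?thesis using at_eq[OF p] by auto
  qed
  then obtain g2 where g2: "\<And>n. n \<in> dB ?D \<Longrightarrow> g2 n \<in> dB ?D'"
    and t2: "\<And>n. n \<in> dB ?D \<Longrightarrow> dt ?D' (g2 n) = g0 (dt ?D n)"
    and dec2: "\<And>n. n \<in> dB ?D \<Longrightarrow> decB T' (g2 n) = decB T n" by metis
  have inj2: "inj_on g2 (dB ?D)"
  proof (rule inj_onI)
    fix n m assume nm: "n \<in> dB ?D" "m \<in> dB ?D" "g2 n = g2 m"
    then have "g0 (dt ?D n) = g0 (dt ?D m)" using t2 by metis
    then have "dt ?D n = dt ?D m"
      using inj_onD[OF bij_betw_imp_inj_on[OF bij0]] A.diagram(3) nm by blast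
    then show "n = m" using inj_onD[OF A.inj_dt] nm by blast
  qed
  have bij2: "bij_betw g2 (dB ?D) (dB ?D')"
    unfolding bij_betw_def
  proof (intro conjI inj2 equalityI subsetI)
    fix m assume m: "m \<in> dB ?D'"
    obtain p where p: "at_pos T' p (dt ?D' m)"
      using B.walk_exists[OF B.diagram(3)[OF m]] by (auto simp: at_pos_def)
    then have "p \<in> Domain (snd A.pos)" using m unfolding eq' B.Domain_pos by (auto simp: at_pos_def)
    then obtain n where n: "n \<in> dB ?D" "at_pos T p (dt ?D n)"
      unfolding A.Domain_pos by (auto simp: at_pos_def)
    have "dt ?D' m = dt ?D' (g2 n)" using at_eq[OF n(2) p] t2[OF n(1)] by simp
    then have "m = g2 n" using inj_onD[OF B.inj_dt _ m g2[OF n(1)]] by blast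
    then show "m \<in> g2 ` dB ?D" using n by blast
  qed (use g2 in blast)
  have "\<exists>y\<in>dE ?D'. ds ?D' y = g0 (ds ?D x) \<and> dp ?D' y = g2 (dp ?D x) \<and> decE T' y = decE T x"
    if x: "x \<in> dE ?D" for x
  proof -
    note n = A.diagram(2)[OF x]
    \<comment> \<open>The matching node of \<open>T'\<close> has the same label, so the pullback
      condition of \<open>T'\<close> provides its slot with the decoration of \<open>x\<close>. That
      the edges of the two slots correspond is then seen from their common address.\<close>
    have "decB T' (g2 (dp ?D x)) = dp P (decE T x)" using dec2[OF n] A.commute(2)[OF x] by simp
    then obtain y where y: "y \<in> dE ?D'" "dp ?D' y = g2 (dp ?D x)" "decE T' y = decE T x"
      using B.slot_exists[OF g2[OF n] A.maps(2)[OF x]] by auto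
    obtain p where p: "at_pos T p (dt ?D (dp ?D x))"
      using A.walk_exists[OF A.diagram(3)[OF n]] by (auto simp: at_pos_def)
    have "at_pos T' p (dt ?D' (dp ?D' y))"
      using at0[OF A.diagram(3)[OF n] p] y(2) t2[OF n] by simp
    then have "at_pos T' (p @ [decE T x]) (ds ?D' y)"
      using walk_snoc[of ?D' "decE T'" B.root p y] y by (simp add: at_pos_def)
    moreover have "at_pos T (p @ [decE T x]) (ds ?D x)"
      using walk_snoc[of ?D "decE T" A.root p x] p x by (simp add: at_pos_def)
    ultimately have "ds ?D' y = g0 (ds ?D x)" using at_eq by blast
    with y show ?thesis by blast
  qed
  then obtain g1 where g1: "\<And>x. x \<in> dE ?D \<Longrightarrow> g1 x \<in> dE ?D'"
    and s1: "\<And>x. x \<in> dE ?D \<Longrightarrow> ds ?D' (g1 x) = g0 (ds ?D x)"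
    and p1: "\<And>x. x \<in> dE ?D \<Longrightarrow> dp ?D' (g1 x) = g2 (dp ?D x)"
    and dec1: "\<And>x. x \<in> dE ?D \<Longrightarrow> decE T' (g1 x) = decE T x" by metis
  have inj1: "inj_on g1 (dE ?D)"
  proof (rule inj_onI)
    fix x y assume xy: "x \<in> dE ?D" "y \<in> dE ?D" "g1 x = g1 y"
    then have "g0 (ds ?D x) = g0 (ds ?D y)" using s1 by metis
    then have "ds ?D x = ds ?D y"
      using inj_onD[OF bij_betw_imp_inj_on[OF bij0]] A.diagram(1) xy by blast
    then show "x = y" using inj_onD[OF A.inj_ds] xy by blast
  qed
  have bij1: "bij_betw g1 (dE ?D) (dE ?D')"
    unfolding bij_betw_def
  proof (intro conjI inj1 equalityI subsetI)
    fix y assume y: "y \<in> dE ?D'"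
    \<comment> \<open>Surjectivity on slots comes from edges: the edge of \<open>y\<close> is not
      the root, so neither is its preimage \<open>a\<close>, and the slot of \<open>a\<close> is
      mapped to \<open>y\<close>.\<close>
    obtain a where a: "a \<in> dI ?D" "g0 a = ds ?D' y"
      using bij0 B.diagram(1)[OF y] by (metis bij_betw_imp_surj_on imageE)
    then have "a \<noteq> A.root" using root B.ds_neq_root[OF y] by metis
    then obtain x where x: "x \<in> dE ?D" "a = ds ?D x" using A.edge_cases[OF a(1)] by blast
    then have "y = g1 x" using inj_onD[OF B.inj_ds _ y g1[OF x(1)]] a s1 by simp
    then show "y \<in> g1 ` dE ?D" using x by blast
  qed (use g1 in blast)
  have "bij_betw (\<lambda>x. (dp ?D x, g1 x)) (dE ?D) {(n, y). n \<in> dB ?D \<and> y \<in> dE ?D' \<and> g2 n = dp ?D' y}"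
    unfolding bij_betw_def
  proof (intro conjI equalityI subsetI)
    show "inj_on (\<lambda>x. (dp ?D x, g1 x)) (dE ?D)" using inj1 by (auto simp: inj_on_def)
    fix z assume "z \<in> {(n, y). n \<in> dB ?D \<and> y \<in> dE ?D' \<and> g2 n = dp ?D' y}"
    then obtain n y where z: "z = (n, y)" "n \<in> dB ?D" "y \<in> dE ?D'" "g2 n = dp ?D' y" by blast
    obtain x where x: "x \<in> dE ?D" "y = g1 x" using bij1 z(3) by (auto simp: bij_betw_def)
    then have "dp ?D x = n" using inj_onD[OF inj2 _ A.diagram(2) z(2)] z(4) p1 by simp
    with x z show "z \<in> (\<lambda>x. (dp ?D x, g1 x)) ` dE ?D" by blast
  qed (use g1 p1 A.diagram in auto)
  then have "cartesian_map ?D ?D' g0 g1 g2"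
    using g0 g1 g2 s1 p1 t2 by (auto simp: cartesian_map_def)
  then show ?thesis
    using bij0 bij1 bij2 dec0 dec1 dec2 unfolding ptree_iso_def by blast
qed

text \<open>Edges, slots and nodes are all named by numbers for positions: a slot by its input edge,
  a node by its output edge. So both \<open>ds\<close> and \<open>dt\<close> are \<open>id\<close>,
  and \<open>dp\<close> drops the last element of the position. The injection \<open>c\<close> into
  the natural numbers exists because there are finitely many positions.\<close>

lemma tree_of_surj:
  fixes P :: "('i, 'e, 'b, 'i) diagram"
  assumes P: "finitary_endo P" and t: "t \<in> pos_trees P"
  shows "\<exists>T\<in>ptrees P. tree_of T = t"
proof -
  let ?E = "positions P t" and ?N = "Domain (snd t)"
  obtain c :: "'e list \<Rightarrow> nat" where c: "inj_on c ?E"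
    using finite_imp_inj_to_nat_seg[OF finite_positions[OF P t]] by blast
  define d where "d = the_inv_into ?E c"
  have dc: "d (c p) = p" if "p \<in> ?E" for p
    unfolding d_def by (rule the_inv_into_f_f[OF c that])
  have NE: "p \<in> ?E" if "(p, b) \<in> snd t" for p b
    using Domain_subset_positions[OF t] that by blast
  define D :: "(nat, nat, nat, nat) diagram" where
    "D = \<lparr>dI = c ` ?E, dE = c ` (?E - {[]}), dB = c ` ?N, dJ = c ` ?E,
      ds = id, dp = (\<lambda>k. c (butlast (d k))), dt = id\<rparr>"
  define T :: "('i, 'e, 'b) ptree" where
    "T = \<lparr>shape = D, decI = (\<lambda>k. colour P (fst t) (d k)), decE = (\<lambda>k. last (d k)),
      decB = (\<lambda>k. THE b. (d k, b) \<in> snd t)\<rparr>"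
  have D: "dI D = c ` ?E" "dE D = c ` (?E - {[]})" "dB D = c ` ?N" "dJ D = c ` ?E" "ds D = id"
    "dp D = (\<lambda>k. c (butlast (d k)))" "dt D = id" by (simp_all add: D_def)
  have decE: "decE T (c p) = last p" and decI: "decI T (c p) = colour P (fst t) p" if "p \<in> ?E" for p
    using dc[OF that] by (simp_all add: T_def)
  have decB: "decB T (c p) = b" if "(p, b) \<in> snd t" for p b
  proof -
    have "(THE b. (p, b) \<in> snd t) = b"
      by (rule the_equality, rule that) (rule pos_treeD(5)[OF t _ that])
    then show ?thesis by (simp add: T_def dc[OF NE[OF that]])
  qed
  have slot_cases: "\<exists>p e. x = c (p @ [e]) \<and> e \<in> dE P \<and> (p, dp P e) \<in> snd t \<and> p @ [e] \<in> ?E"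
    if x: "x \<in> dE D" for x
  proof -
    obtain q where q: "x = c q" "q \<in> ?E" "q \<noteq> []" using x by (auto simp: D)
    then obtain p e where "q = p @ [e]" by (cases q rule: rev_cases) auto
    then show ?thesis using q by (metis position_snoc)
  qed
  have dp: "dp D (c (p @ [e])) = c p" if "p @ [e] \<in> ?E" for p e
    using dc[OF that] by (simp add: D)
  have walkT: "walk D (decE T) (c []) p (c p)" if "p \<in> ?E" for p
    using that
  proof (induction p rule: rev_induct)
    case (snoc e p)
    then have "p \<in> ?E" using NE by (auto simp: position_snoc)
    then have "walk D (decE T) (c []) p (dt D (dp D (c (p @ [e]))))"
      using snoc by (simp add: D dc)
    from walk_snoc[OF this] show ?case using snoc.prems by (simp add: D decE)
  qed simp
  have compl: "dI D - ds D ` dE D = {c []}"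
    using inj_onD[OF c _ _ Nil_position] by (auto simp: D)
  have r: "tree_root D = c []" by (rule tree_rootI[OF compl])
  have dBE: "?N \<subseteq> ?E" using Domain_subset_positions[OF t] by blast
  have "is_tree D"
  proof (rule is_treeI[OF _ _ _ _ _ _ _ compl])
    have "ds D x \<in> dI D \<and> dp D x \<in> dB D" if xE: "x \<in> dE D" for x
    proof -
      obtain p e where x: "x = c (p @ [e])" "(p, dp P e) \<in> snd t" "p @ [e] \<in> ?E"
        using slot_cases[OF xE] by blast
      have "c p \<in> c ` ?N" using x(2) by blast
      then show ?thesis using x(3) dp[OF x(3)] by (simp add: D(1,3,5) x(1))
    qed
    then show "is_diagram D" using dBE by (auto simp: is_diagram_def D)
    show "\<exists>p. walk D (decE T) (c []) p a" if "a \<in> dI D" for a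
      using that walkT by (auto simp: D)
  qed (use finite_positions[OF P t] pos_treeD(2)[OF t] in \<open>auto simp: D finite_Domain\<close>)
  moreover have "cartesian_map D P (decI T) (decE T) (decB T)"
    unfolding cartesian_map_def
  proof (intro conjI ballI)
    have "colour P (fst t) p \<in> dI P" if "p \<in> ?E" for p
      using pos_treeD(1)[OF upper_pos_tree[OF P t that]] by (simp add: upper_def)
    then show "decI T \<in> dI D \<rightarrow> dI P" by (auto simp: D decI)
    show "decE T \<in> dE D \<rightarrow> dE P"
    proof
      fix x assume "x \<in> dE D"
      then obtain p e where "x = c (p @ [e])" "e \<in> dE P" "p @ [e] \<in> ?E" using slot_cases by blast
      then show "decE T x \<in> dE P" using decE[of "p @ [e]"] by simp
    qed
    show "decB T \<in> dB D \<rightarrow> dB P"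
      using pos_treeD(3)[OF t] decB by (auto simp: D)
    fix x assume "x \<in> dE D"
    then obtain p e where x: "x = c (p @ [e])" "e \<in> dE P" "(p, dp P e) \<in> snd t" "p @ [e] \<in> ?E"
      using slot_cases by blast
    show "ds P (decE T x) = decI T (ds D x)"
      using decE[OF x(4)] decI[OF x(4)] by (simp add: x(1) D colour_def)
    show "dp P (decE T x) = decB T (dp D x)"
      using decE[OF x(4)] dp[OF x(4)] decB[OF x(3)] by (simp add: x(1))
  next
    fix n assume "n \<in> dB D"
    then obtain p b where n: "n = c p" "(p, b) \<in> snd t" by (auto simp: D)
    then show "dt P (decB T n) = decI T (dt D n)"
      using pos_treeD(4)[OF t n(2)] decB[OF n(2)] decI[OF NE[OF n(2)]] by (simp add: D)
  next
    show "bij_betw (\<lambda>x. (dp D x, decE T x)) (dE D) {(n, y). n \<in> dB D \<and> y \<in> dE P \<and> decB T n = dp P y}"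
      unfolding bij_betw_def
    proof (intro conjI equalityI subsetI inj_onI)
      fix x y assume "x \<in> dE D" "y \<in> dE D" and eq: "(dp D x, decE T x) = (dp D y, decE T y)"
      then obtain p e q f where x: "x = c (p @ [e])" "(p, dp P e) \<in> snd t" "p @ [e] \<in> ?E"
        and y: "y = c (q @ [f])" "(q, dp P f) \<in> snd t" "q @ [f] \<in> ?E"
        using slot_cases by metis
      have "c p = c q" "e = f"
        using eq dp[OF x(3)] dp[OF y(3)] decE[OF x(3)] decE[OF y(3)] by (simp_all add: x(1) y(1))
      then show "x = y" using inj_onD[OF c _ NE[OF x(2)] NE[OF y(2)]] by (simp add: x(1) y(1))
    next
      fix z assume "z \<in> (\<lambda>x. (dp D x, decE T x)) ` dE D"
      then obtain x where z: "z = (dp D x, decE T x)" and "x \<in> dE D" by blast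
      then obtain p e where x: "x = c (p @ [e])" "e \<in> dE P" "(p, dp P e) \<in> snd t" "p @ [e] \<in> ?E"
        using slot_cases by blast
      have "c p \<in> dB D" using x(3) by (auto simp: D)
      then show "z \<in> {(n, y). n \<in> dB D \<and> y \<in> dE P \<and> decB T n = dp P y}"
        using x(2) dp[OF x(4)] decE[OF x(4)] decB[OF x(3)] by (simp add: z x(1))
    next
      fix z assume "z \<in> {(n, y). n \<in> dB D \<and> y \<in> dE P \<and> decB T n = dp P y}"
      then obtain n y where z: "z = (n, y)" "n \<in> dB D" "y \<in> dE P" "decB T n = dp P y" by blast
      then obtain p b where n: "n = c p" "(p, b) \<in> snd t" by (auto simp: D)
      then have "(p, dp P y) \<in> snd t" using z(4) decB by metis
      then have py: "p @ [y] \<in> ?E" using z(3) by (simp add: position_snoc)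
      have "c (p @ [y]) \<in> dE D" using py by (auto simp: D)
      then show "z \<in> (\<lambda>x. (dp D x, decE T x)) ` dE D"
        using dp[OF py] decE[OF py] by (auto simp: z(1) n(1) intro!: image_eqI[of _ _ "c (p @ [y])"])
    qed
  qed
  ultimately have T: "T \<in> ptrees P" by (simp add: ptrees_def is_ptree_def T_def)
  interpret decorated_tree P D "decI T" "decE T" "decB T"
    using ptree_decorated[OF T] by (simp add: T_def)
  have walk_iff: "walk D (decE T) root p (c q) \<longleftrightarrow> p = q" if "q \<in> ?E" for p q
    using walkT[OF that] walk_root_unique unfolding r by blast
  have "(p, b) \<in> snd pos \<longleftrightarrow> (p, b) \<in> snd t" for p b
  proof
    assume "(p, b) \<in> snd pos"
    then obtain n where n: "n \<in> dB D" "b = decB T n" "walk D (decE T) root p (dt D n)"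
      unfolding pos_snd_iff by blast
    from n(1) obtain q b' where q: "(q, b') \<in> snd t" "n = c q" by (auto simp: D)
    have "p = q" using n(3) walk_iff[OF NE[OF q(1)]] by (simp add: q(2) D(7))
    then show "(p, b) \<in> snd t" using q n(2) decB[OF q(1)] by simp
  next
    assume pb: "(p, b) \<in> snd t"
    have "c p \<in> dB D" using pb by (auto simp: D)
    moreover have "walk D (decE T) root p (dt D (c p))" using walk_iff[OF NE[OF pb]] by (simp add: D(7))
    ultimately show "(p, b) \<in> snd pos" unfolding pos_snd_iff using decB[OF pb] by metis
  qed
  then have "snd pos = snd t" by auto
  moreover have "fst pos = fst t" using decI[of "[]"] by (simp add: pos_fst r)
  moreover have "tree_of T = pos" by (simp add: tree_of_def T_def)
  ultimately have "tree_of T = t" by (simp add: prod_eq_iff)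
  with T show ?thesis by blast
qed

section \<open>Isomorphism classes described by their position trees\<close>

lemma tree_of_sub_ptree:
  "tree_of (sub_ptree T S) = position_tree (restrict_diagram (shape T) S) (decI T) (decE T) (decB T)"
  by (simp add: tree_of_def sub_ptree_def)

definition tree_class :: "('i, 'e, 'b, 'i) diagram \<Rightarrow> ('i, 'e, 'b) pos_tree \<Rightarrow> ('i, 'e, 'b) tclass" where
  "tree_class P t = {T \<in> ptrees P. tree_of T = t}"

definition cut_class ::
  "('i, 'e, 'b, 'i) diagram \<Rightarrow> ('i, 'e, 'b) pos_tree \<Rightarrow> ('i, 'e, 'b) pos_tree \<Rightarrow> ('i, 'e, 'b) cclass" where
  "cut_class P r t = {(T, S) \<in> cuts P. tree_of (sub_ptree T S) = r \<and> tree_of T = t}"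

definition pcut_class :: "('i, 'e, 'b, 'i) diagram \<Rightarrow> ('i, 'e, 'b) pos_tree \<Rightarrow> ('i, 'e, 'b) pos_tree \<Rightarrow>
    'e list \<Rightarrow> ('i, 'e, 'b) pclass" where
  "pcut_class P r t p = {(T, S, a). (T, S, a) \<in> pcuts P \<and> (T, S) \<in> cut_class P r t \<and> at_pos T p a}"

lemma tree_of_in: "T \<in> ptrees P \<Longrightarrow> tree_of T \<in> pos_trees P"
  using decorated_tree.pos_in[OF ptree_decorated] by (simp add: tree_of_def)

lemma sub_ptree_in:
  assumes "T \<in> ptrees P" and S: "is_subtree (shape T) S"
  shows "sub_ptree T S \<in> ptrees P"
proof -
  obtain A M N where e: "S = (A, M, N)" by (cases S)
  have "decorated_tree P (restrict_diagram (shape T) S) (decI T) (decE T) (decB T)"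
    using decorated_tree.subtreeD(6)[OF ptree_decorated[OF assms(1)] S[unfolded e]] by (simp add: e)
  then show ?thesis
    by (simp add: decorated_tree_def ptrees_def is_ptree_def sub_ptree_def)
qed

lemma ptree_rel_iff:
  "(T, T') \<in> ptree_rel P \<longleftrightarrow> T \<in> ptrees P \<and> T' \<in> ptrees P \<and> tree_of T = tree_of T'"
  using iso_tree_of[of T P T'] iso_exists[of T P T'] by (auto simp: ptree_rel_def)

lemma ptree_rel_Image: "T \<in> ptrees P \<Longrightarrow> ptree_rel P `` {T} = tree_class P (tree_of T)"
  by (auto simp: ptree_rel_iff tree_class_def)

lemma cuts_iff: "(T, S) \<in> cuts P \<longleftrightarrow> T \<in> ptrees P \<and> is_cut (shape T) S"
  by (simp add: cuts_def)

lemma cut_sub_ptree_in: "(T, S) \<in> cuts P \<Longrightarrow> sub_ptree T S \<in> ptrees P"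
  by (intro sub_ptree_in) (auto simp: cuts_iff is_cut_def)

lemma cut_lower_tree_of:
  assumes "(T, S) \<in> cuts P"
  shows "lower P (tree_of (sub_ptree T S)) (tree_of T)"
  using decorated_tree.cut_lower(1)[OF ptree_decorated, of T P S] assms
  unfolding tree_of_sub_ptree cuts_iff by (simp add: tree_of_def)

text \<open>A cut is determined by its position tree, and \<open>cut_at\<close> commutes with
  isomorphisms. So any isomorphism of the ambient trees carries \<open>S\<close> to
  \<open>S'\<close> once their position trees agree, and no special choice of it has to be
  made.\<close>

lemma cut_iso_iff:
  assumes TS: "(T, S) \<in> cuts P" and TS': "(T', S') \<in> cuts P" and iso: "ptree_iso T T' g0 g1 g2"
  shows "S' = (case S of (A, M, N) \<Rightarrow> (g0 ` A, g1 ` M, g2 ` N)) \<longleftrightarrow>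
    tree_of (sub_ptree T S) = tree_of (sub_ptree T' S')"
proof -
  have T: "T \<in> ptrees P" and T': "T' \<in> ptrees P" and S: "is_cut (shape T) S" and S': "is_cut (shape T') S'"
    using TS TS' by (auto simp: cuts_iff)
  interpret A: decorated_tree P "shape T" "decI T" "decE T" "decB T" by (rule ptree_decorated[OF T])
  interpret B: decorated_tree P "shape T'" "decI T'" "decE T'" "decB T'" by (rule ptree_decorated[OF T'])
  have eq: "B.pos = A.pos" using iso_tree_of[OF T T' iso] by (simp add: tree_of_def)
  have c: "(case S of (A, M, N) \<Rightarrow> (g0 ` A, g1 ` M, g2 ` N)) = B.cut_at (A.pos_sub S)"
    using iso_cut_at[OF T T' iso, of "A.pos_sub S"] A.cut_lower(2)[OF S] by simp
  have "B.pos_sub (B.cut_at (A.pos_sub S)) = A.pos_sub S"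
    by (rule B.cut_at_cut(2)) (use A.cut_lower(1)[OF S] eq in simp)
  then show ?thesis
    using B.cut_lower(2)[OF S'] unfolding c tree_of_sub_ptree by metis
qed

lemma cut_rel_iff:
  "((T, S), (T', S')) \<in> cut_rel P \<longleftrightarrow> (T, S) \<in> cuts P \<and> (T', S') \<in> cuts P \<and>
     tree_of T = tree_of T' \<and> tree_of (sub_ptree T S) = tree_of (sub_ptree T' S')"
proof -
  have "((T, S), (T', S')) \<in> cut_rel P \<longleftrightarrow> (T, S) \<in> cuts P \<and> (T', S') \<in> cuts P \<and>
      (\<exists>g0 g1 g2. ptree_iso T T' g0 g1 g2 \<and> S' = (case S of (A, M, N) \<Rightarrow> (g0 ` A, g1 ` M, g2 ` N)))"
    by (cases S) (auto simp: cut_rel_def)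
  moreover have "T \<in> ptrees P" "T' \<in> ptrees P" if "(T, S) \<in> cuts P" "(T', S') \<in> cuts P"
    using that by (auto simp: cuts_iff)
  ultimately show ?thesis
    using cut_iso_iff[of T S P T' S'] iso_tree_of[of T P T'] iso_exists[of T P T'] by metis
qed

lemma cut_rel_Image:
  assumes "(T, S) \<in> cuts P"
  shows "cut_rel P `` {(T, S)} = cut_class P (tree_of (sub_ptree T S)) (tree_of T)"
  using assms by (auto simp: cut_rel_iff cut_class_def)

lemma leaf_at_pos:
  assumes "(T, S) \<in> cuts P"
  shows "a \<in> leaves (restrict_diagram (shape T) S) \<longleftrightarrow>
    (\<exists>p\<in>leaf_positions P (tree_of (sub_ptree T S)). at_pos T p a)"
proof -
  obtain A M N where e: "S = (A, M, N)" by (cases S)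
  have T: "T \<in> ptrees P" and S: "is_cut (shape T) S" using assms by (auto simp: cuts_iff)
  interpret A: decorated_tree P "shape T" "decI T" "decE T" "decB T" by (rule ptree_decorated[OF T])
  interpret R: decorated_tree P "restrict_diagram (shape T) S" "decI T" "decE T" "decB T"
    using A.subtreeD(6)[of A M N] S by (simp add: is_cut_def e)
  have r: "R.root = A.root" using S by (simp add: is_cut_def)
  have w: "walk (restrict_diagram (shape T) S) (decE T) R.root p a \<longleftrightarrow> at_pos T p a \<and> a \<in> A" for p a
    using A.walk_restrict_cut[OF S[unfolded e]] by (simp add: at_pos_def r e[symmetric])
  have lA: "a \<in> leaves (restrict_diagram (shape T) S) \<Longrightarrow> a \<in> A" by (simp add: leaves_def e)
  show ?thesis
  proof
    assume a: "a \<in> leaves (restrict_diagram (shape T) S)"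
    then have "a \<in> dI (restrict_diagram (shape T) S)" by (simp add: leaves_def)
    then obtain p where p: "walk (restrict_diagram (shape T) S) (decE T) R.root p a"
      using R.walk_exists by blast
    then show "\<exists>p\<in>leaf_positions P (tree_of (sub_ptree T S)). at_pos T p a"
      using a R.leaf_positions_pos[OF p] w by (auto simp: tree_of_sub_ptree)
  next
    assume "\<exists>p\<in>leaf_positions P (tree_of (sub_ptree T S)). at_pos T p a"
    then obtain p where p: "p \<in> leaf_positions P R.pos" "at_pos T p a"
      by (auto simp: tree_of_sub_ptree)
    then obtain b where b: "walk (restrict_diagram (shape T) S) (decE T) R.root p b"
      using R.positions_pos by (auto simp: leaf_positions_def)
    then have "b = a" using p(2) w A.walk_functional unfolding at_pos_def by blast
    then show "a \<in> leaves (restrict_diagram (shape T) S)"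
      using R.leaf_positions_pos[OF b] p(1) by simp
  qed
qed

lemma pcuts_iff:
  "(T, S, a) \<in> pcuts P \<longleftrightarrow>
     (T, S) \<in> cuts P \<and> (\<exists>p\<in>leaf_positions P (tree_of (sub_ptree T S)). at_pos T p a)"
  using leaf_at_pos[of T S P a] by (auto simp: pcuts_def)

lemma at_pos_unique: "T \<in> ptrees P \<Longrightarrow> at_pos T p a \<Longrightarrow> at_pos T q a \<Longrightarrow> p = q"
  unfolding at_pos_def by (rule decorated_tree.walk_root_unique[OF ptree_decorated])

lemma at_pos_functional: "T \<in> ptrees P \<Longrightarrow> at_pos T p a \<Longrightarrow> at_pos T p b \<Longrightarrow> a = b"
  unfolding at_pos_def by (rule decorated_tree.walk_functional[OF ptree_decorated])

text \<open>Any isomorphism matches the marked leaves as soon as they have the same address, because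
  an address leads to only one edge.\<close>

lemma pcut_rel_Image:
  assumes c: "(T, S, a) \<in> pcuts P" and p: "at_pos T p a"
  shows "pcut_rel P `` {(T, S, a)} = pcut_class P (tree_of (sub_ptree T S)) (tree_of T) p"
proof -
  have TS: "(T, S) \<in> cuts P" and T: "T \<in> ptrees P" using c by (auto simp: pcuts_iff cuts_iff)
  have "((T, S, a), (T', S', a')) \<in> pcut_rel P \<longleftrightarrow>
      (T', S', a') \<in> pcut_class P (tree_of (sub_ptree T S)) (tree_of T) p" (is "?l \<longleftrightarrow> ?r") for T' S' a'
  proof -
    have l: "?l \<longleftrightarrow> (T', S', a') \<in> pcuts P \<and> (\<exists>g0 g1 g2. ptree_iso T T' g0 g1 g2 \<and>
        S' = (case S of (A, M, N) \<Rightarrow> (g0 ` A, g1 ` M, g2 ` N)) \<and> a' = g0 a)"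
      using c by (cases S) (auto simp: pcut_rel_def)
    show ?thesis
    proof
      assume ?l
      then obtain g0 g1 g2 where c': "(T', S', a') \<in> pcuts P" and iso: "ptree_iso T T' g0 g1 g2"
        and S': "S' = (case S of (A, M, N) \<Rightarrow> (g0 ` A, g1 ` M, g2 ` N))" and a': "a' = g0 a"
        unfolding l by blast
      have TS': "(T', S') \<in> cuts P" and T': "T' \<in> ptrees P" using c' by (auto simp: pcuts_iff cuts_iff)
      show ?r
        using c' TS' cut_iso_iff[OF TS TS' iso] S' iso_tree_of[OF T T' iso] iso_at_pos[OF T T' iso p] a'
        by (simp add: pcut_class_def cut_class_def)
    next
      assume ?r
      then have c': "(T', S', a') \<in> pcuts P" and TS': "(T', S') \<in> cuts P" and p': "at_pos T' p a'"
        and eq: "tree_of T = tree_of T'" "tree_of (sub_ptree T S) = tree_of (sub_ptree T' S')"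
        by (auto simp: pcut_class_def cut_class_def)
      have T': "T' \<in> ptrees P" using TS' by (simp add: cuts_iff)
      obtain g0 g1 g2 where iso: "ptree_iso T T' g0 g1 g2" using iso_exists[OF T T' eq(1)] by blast
      have "a' = g0 a" by (rule at_pos_functional[OF T' p' iso_at_pos[OF T T' iso p]])
      then show ?l using c' iso cut_iso_iff[OF TS TS' iso] eq(2) unfolding l by blast
    qed
  qed
  then show ?thesis by auto
qed

lemma sub_ptree_ideal:
  assumes "T \<in> ptrees P" and "at_pos T p a"
  shows "sub_ptree T (ideal (shape T) a) \<in> ptrees P"
    and "tree_of (sub_ptree T (ideal (shape T) a)) = upper P (tree_of T) p"
proof -
  note D = ptree_decorated[OF assms(1)]
  note i = decorated_tree.ideal_subtree[OF D assms(2)[unfolded at_pos_def]]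
  show "sub_ptree T (ideal (shape T) a) \<in> ptrees P" by (rule sub_ptree_in[OF assms(1) i(1)])
  show "tree_of (sub_ptree T (ideal (shape T) a)) = upper P (tree_of T) p"
    using i(2) unfolding tree_of_sub_ptree by (simp add: tree_of_def)
qed

section \<open>The index sets and the structure maps in terms of position trees\<close>

context
  fixes P :: "('i, 'e, 'b, 'i) diagram"
  assumes P: "finitary_endo P"
begin

lemma tree_class_nonempty: "t \<in> pos_trees P \<Longrightarrow> tree_class P t \<noteq> {}"
  using tree_of_surj[OF P, of t] by (auto simp: tree_class_def)

lemma TT_eq: "TT P = tree_class P ` pos_trees P"
proof
  show "TT P \<subseteq> tree_class P ` pos_trees P"
    using tree_of_in by (auto simp: TT_def quotient_def ptree_rel_Image)
  show "tree_class P ` pos_trees P \<subseteq> TT P"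
  proof clarify
    fix i G assume "(i, G) \<in> pos_trees P"
    then obtain T where "T \<in> ptrees P" "tree_of T = (i, G)" using tree_of_surj[OF P] by blast
    then show "tree_class P (i, G) \<in> TT P"
      using ptree_rel_Image[of T P] by (auto simp: TT_def quotient_def)
  qed
qed

definition class_tree :: "('i, 'e, 'b) tclass \<Rightarrow> ('i, 'e, 'b) pos_tree" where
  "class_tree c = tree_of (SOME T. T \<in> c)"

lemma class_tree [simp]: "t \<in> pos_trees P \<Longrightarrow> class_tree (tree_class P t) = t"
  using some_in_eq[of "tree_class P t"] tree_class_nonempty
  by (auto simp: class_tree_def tree_class_def)

lemma class_tree_in: "j \<in> TT P \<Longrightarrow> class_tree j \<in> pos_trees P"
  and tree_class_class_tree: "j \<in> TT P \<Longrightarrow> tree_class P (class_tree j) = j"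
  unfolding TT_eq by auto

lemma tree_class_in: "t \<in> pos_trees P \<Longrightarrow> tree_class P t \<in> TT P"
  by (simp add: TT_eq)

lemma cut_class_member:
  assumes "lower P r t"
  obtains T S where "(T, S) \<in> cut_class P r t"
proof -
  obtain T where T: "T \<in> ptrees P" and t: "tree_of T = t"
    using tree_of_surj[OF P lowerD(2)[OF assms]] by blast
  have "lower P r (position_tree (shape T) (decI T) (decE T) (decB T))"
    using assms t by (simp add: tree_of_def)
  from decorated_tree.cut_at_cut[OF ptree_decorated[OF T] this] show ?thesis
    using T t that by (auto simp: cut_class_def cuts_iff tree_of_sub_ptree)
qed

lemma pcut_class_member:
  assumes r: "lower P r t" and p: "p \<in> leaf_positions P r"
  obtains T S a where "(T, S, a) \<in> pcut_class P r t p"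
proof -
  obtain T S where TS: "(T, S) \<in> cut_class P r t" using cut_class_member[OF r] .
  then have c: "(T, S) \<in> cuts P" "tree_of (sub_ptree T S) = r" "tree_of T = t"
    by (auto simp: cut_class_def)
  have "p \<in> positions P (tree_of T)"
    using positions_mono[OF r] p c by (simp add: leaf_positions_def)
  then obtain a where "at_pos T p a"
    using decorated_tree.positions_pos[OF ptree_decorated, of T P p] c
    by (auto simp: tree_of_def at_pos_def cuts_iff)
  then have "(T, S, a) \<in> pcut_class P r t p"
    using TS c p by (auto simp: pcut_class_def pcuts_iff)
  then show ?thesis by (rule that)
qed

lemma TTcut_eq: "TTcut P = {cut_class P r t | r t. lower P r t}"
proof
  show "TTcut P \<subseteq> {cut_class P r t | r t. lower P r t}"
  proof
    fix c assume "c \<in> TTcut P"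
    then obtain T S where c: "(T, S) \<in> cuts P" "c = cut_rel P `` {(T, S)}"
      by (auto simp: TTcut_def quotient_def)
    then show "c \<in> {cut_class P r t | r t. lower P r t}"
      using cut_lower_tree_of[OF c(1)] cut_rel_Image[OF c(1)] by blast
  qed
  show "{cut_class P r t | r t. lower P r t} \<subseteq> TTcut P"
  proof clarify
    fix i G i' G' assume "lower P (i, G) (i', G')"
    then obtain T S where "(T, S) \<in> cut_class P (i, G) (i', G')" using cut_class_member by blast
    then show "cut_class P (i, G) (i', G') \<in> TTcut P"
      using cut_rel_Image[of T S P] by (auto simp: TTcut_def quotient_def cut_class_def)
  qed
qed

lemma TTpcut_eq: "TTpcut P = {pcut_class P r t p | r t p. lower P r t \<and> p \<in> leaf_positions P r}"
proof
  show "TTpcut P \<subseteq> {pcut_class P r t p | r t p. lower P r t \<and> p \<in> leaf_positions P r}"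
  proof
    fix c assume "c \<in> TTpcut P"
    then obtain T S a where c: "(T, S, a) \<in> pcuts P" "c = pcut_rel P `` {(T, S, a)}"
      by (auto simp: TTpcut_def quotient_def)
    then obtain p where p: "(T, S) \<in> cuts P" "p \<in> leaf_positions P (tree_of (sub_ptree T S))" "at_pos T p a"
      by (auto simp: pcuts_iff)
    then show "c \<in> {pcut_class P r t p | r t p. lower P r t \<and> p \<in> leaf_positions P r}"
      using pcut_rel_Image[OF c(1) p(3)] cut_lower_tree_of[OF p(1)] c(2) by blast
  qed
  show "{pcut_class P r t p | r t p. lower P r t \<and> p \<in> leaf_positions P r} \<subseteq> TTpcut P"
  proof
    fix c assume "c \<in> {pcut_class P r t p | r t p. lower P r t \<and> p \<in> leaf_positions P r}"
    then obtain r t p where c: "c = pcut_class P r t p" "lower P r t" "p \<in> leaf_positions P r" by blast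
    obtain T S a where m: "(T, S, a) \<in> pcut_class P r t p" using pcut_class_member[OF c(2,3)] .
    then have "pcut_rel P `` {(T, S, a)} = c"
      using pcut_rel_Image[of T S a P p] by (auto simp: pcut_class_def cut_class_def c(1))
    then show "c \<in> TTpcut P" using m by (auto simp: TTpcut_def quotient_def pcut_class_def)
  qed
qed

text \<open>Evaluates a map out of a quotient on a class whose members all give the same result. An
  empty class would give the empty union, hence the need for the members constructed by
  \<open>cut_class_member\<close> and \<open>pcut_class_member\<close>.\<close>

lemma UN_const_on: "c \<noteq> {} \<Longrightarrow> (\<And>x. x \<in> c \<Longrightarrow> h x = k) \<Longrightarrow> (\<Union>x\<in>c. h x) = k"
  by auto

lemma cut_class_nonempty: "lower P r t \<Longrightarrow> cut_class P r t \<noteq> {}"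
  by (metis cut_class_member empty_iff)

lemma pcut_class_nonempty: "lower P r t \<Longrightarrow> p \<in> leaf_positions P r \<Longrightarrow> pcut_class P r t p \<noteq> {}"
  by (metis pcut_class_member empty_iff)

lemma m_map_class:
  assumes "lower P r t"
  shows "m_map P (cut_class P r t) = tree_class P t"
  unfolding m_map_def
proof (rule UN_const_on[OF cut_class_nonempty[OF assms]], clarify)
  fix T A M N assume "(T, A, M, N) \<in> cut_class P r t"
  then show "ptree_rel P `` {T} = tree_class P t"
    by (simp add: cut_class_def cuts_iff ptree_rel_Image)
qed

lemma r_map_class:
  assumes "lower P r t"
  shows "r_map P (cut_class P r t) = tree_class P r"
  unfolding r_map_def
proof (rule UN_const_on[OF cut_class_nonempty[OF assms]], clarify)
  fix T A M N assume "(T, A, M, N) \<in> cut_class P r t"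
  then show "ptree_rel P `` {sub_ptree T (A, M, N)} = tree_class P r"
    using cut_sub_ptree_in[of T "(A, M, N)" P] by (simp add: cut_class_def ptree_rel_Image)
qed

lemma p_map_class:
  assumes "lower P r t" "p \<in> leaf_positions P r"
  shows "p_map P (pcut_class P r t p) = cut_class P r t"
  unfolding p_map_def
proof (rule UN_const_on[OF pcut_class_nonempty[OF assms]], clarify)
  fix T A M N a assume "(T, (A, M, N), a) \<in> pcut_class P r t p"
  then have "(T, A, M, N) \<in> cuts P" "tree_of (sub_ptree T (A, M, N)) = r" "tree_of T = t"
    by (simp_all add: pcut_class_def cut_class_def)
  then show "cut_rel P `` {(T, A, M, N)} = cut_class P r t"
    using cut_rel_Image[of T "(A, M, N)" P] by simp
qed

lemma f_map_class:
  assumes "lower P r t" "p \<in> leaf_positions P r"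
  shows "f_map P (pcut_class P r t p) = tree_class P (upper P t p)"
  unfolding f_map_def
proof (rule UN_const_on[OF pcut_class_nonempty[OF assms]], clarify)
  fix T A M N a assume "(T, (A, M, N), a) \<in> pcut_class P r t p"
  then have "T \<in> ptrees P" "tree_of T = t" "at_pos T p a"
    by (simp_all add: pcut_class_def cut_class_def cuts_iff)
  then show "ptree_rel P `` {sub_ptree T (ideal (shape T) a)} = tree_class P (upper P t p)"
    using sub_ptree_ideal[of T P p a] by (simp add: ptree_rel_Image)
qed

lemma e_map_class:
  assumes i: "i \<in> dI P"
  shows "e_map P i = tree_class P (i, {})" and "(i, {}) \<in> pos_trees P"
proof -
  let ?T = "trivial_ptree i :: ('i, 'e, 'b) ptree"
  have compl: "dI (shape ?T) - ds (shape ?T) ` dE (shape ?T) = {0}"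
    by (simp add: trivial_ptree_def)
  have "is_tree (shape ?T)"
    by (rule is_treeI[OF _ _ _ _ _ _ _ compl, where g = "decE ?T"])
      (auto simp: trivial_ptree_def is_diagram_def intro: exI[of _ "[]"])
  then have T: "?T \<in> ptrees P"
    using i by (simp add: ptrees_def is_ptree_def cartesian_map_def trivial_ptree_def bij_betw_def)
  have "tree_of ?T = (i, {})"
    by (simp add: tree_of_def position_tree_def trivial_ptree_def)
  then show "e_map P i = tree_class P (i, {})" "(i, {}) \<in> pos_trees P"
    using ptree_rel_Image[OF T] tree_of_in[OF T] by (simp_all add: e_map_def)
qed

end

section \<open>The tensor product of families indexed by tree classes\<close>

text \<open>\<open>code S\<close> is a chosen injection if there is one, and an infinite type has
  finite subsets of every cardinality.\<close>

lemma inj_on_code: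
  assumes "finite S"
  shows "inj_on (code S :: 'a \<Rightarrow> 'u::infinite) S"
proof -
  obtain U :: "'u set" where U: "finite U" "card U = card S"
    using infinite_arbitrarily_large[OF infinite_UNIV] by blast
  then obtain c :: "'a \<Rightarrow> 'u" where "inj_on c S"
    using finite_same_card_bij[OF assms U(1)] by (auto simp: bij_betw_def)
  then show ?thesis unfolding code_def by (rule someI[of "\<lambda>c. inj_on c S"])
qed

text \<open>This and the next three definitions have the form that \<open>transport\<close> produces
  from position trees with \<open>g\<close> taken as \<open>tree_class P\<close> and
  \<open>h\<close> as \<open>class_tree\<close>.\<close>

definition class_le :: "('i, 'e, 'b, 'i) diagram \<Rightarrow> ('i, 'e, 'b) tclass \<Rightarrow> ('i, 'e, 'b) tclass \<Rightarrow> bool" where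
  "class_le P a b \<longleftrightarrow> a \<in> TT P \<and> b \<in> TT P \<and> lower P (class_tree a) (class_tree b)"

definition class_leaves :: "('i, 'e, 'b, 'i) diagram \<Rightarrow> ('i, 'e, 'b) tclass \<Rightarrow> 'e list set" where
  "class_leaves P a = leaf_positions P (class_tree a)"

definition class_upper ::
  "('i, 'e, 'b, 'i) diagram \<Rightarrow> ('i, 'e, 'b) tclass \<Rightarrow> 'e list \<Rightarrow> ('i, 'e, 'b) tclass" where
  "class_upper P a p = tree_class P (upper P (class_tree a) p)"

definition trivial_classes :: "('i, 'e, 'b, 'i) diagram \<Rightarrow> ('i, 'e, 'b) tclass set" where
  "trivial_classes P = tree_class P ` {t \<in> pos_trees P. snd t = {}}"

definition le_cut :: "('i, 'e, 'b, 'i) diagram \<Rightarrow> ('i, 'e, 'b) tclass \<Rightarrow> ('i, 'e, 'b) tclass \<Rightarrow>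
    ('i, 'e, 'b) cclass" where
  "le_cut P r t = cut_class P (class_tree r) (class_tree t)"

definition le_pcut :: "('i, 'e, 'b, 'i) diagram \<Rightarrow> ('i, 'e, 'b) tclass \<Rightarrow> ('i, 'e, 'b) tclass \<Rightarrow>
    'e list \<Rightarrow> ('i, 'e, 'b) pclass" where
  "le_pcut P r t p = pcut_class P (class_tree r) (class_tree t) p"

text \<open>All members of a class of pointed cuts have their marked leaf at the same address, so
  the choice is harmless.\<close>

definition pcut_pos :: "('i, 'e, 'b) pclass \<Rightarrow> 'e list" where
  "pcut_pos c = (SOME p. \<exists>T S a. (T, S, a) \<in> c \<and> at_pos T p a)"

text \<open>Translates a term into an element of the sum of products for \<open>M_diagram P\<close>:
  in the fibre over a cut, the \<open>Inl\<close> elements are its leaves and the only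
  \<open>Inr\<close> element is the cut itself.\<close>

definition cut_decoration :: "('i, 'e, 'b, 'i) diagram \<Rightarrow> ('i, 'e, 'b) tclass \<Rightarrow>
    ('i, 'e, 'b) tclass \<times> ('e list \<Rightarrow> 'u) \<times> 'u \<Rightarrow>
    ('i, 'e, 'b) cclass \<times> (('i, 'e, 'b) pclass + ('i, 'e, 'b) cclass \<Rightarrow> 'u)" where
  "cut_decoration P t = (\<lambda>(r, x, y). (le_cut P r t,
     \<lambda>e\<in>fib_E (M_diagram P) (le_cut P r t). case e of Inl a \<Rightarrow> x (pcut_pos a) | Inr _ \<Rightarrow> y))"

definition term_code :: "('i, 'e, 'b, 'i) diagram \<Rightarrow> (('i, 'e, 'b) tclass, 'u::infinite) family \<Rightarrow>
    (('i, 'e, 'b) tclass, 'u) family \<Rightarrow> ('i, 'e, 'b) tclass \<Rightarrow>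
    ('i, 'e, 'b) tclass \<times> ('e list \<Rightarrow> 'u) \<times> 'u \<Rightarrow> 'u" where
  "term_code P X Y t v =
     code (sum_prod (M_diagram P) (pair_family (TT P) (TT P) X Y) t) (cut_decoration P t v)"

context
  fixes P :: "('i, 'e, 'b, 'i) diagram"
  assumes P: "finitary_endo P"
begin

section \<open>The fibres of the diagram of the tensor product\<close>

lemma cut_structure_classes:
  "cut_structure (TT P) (class_le P) (class_leaves P) (class_upper P) (trivial_classes P)"
  using cut_structure.transport[OF cut_structure_pos_trees[OF P], of class_tree "tree_class P"]
  unfolding TT_eq[OF P, symmetric] class_le_def[abs_def] class_leaves_def[abs_def]
    class_upper_def[abs_def] trivial_classes_def
  by (simp add: class_tree[OF P])

interpretation CS: cut_structure "TT P" "class_le P" "class_leaves P" "class_upper P" "trivial_classes P"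
  by (rule cut_structure_classes)

lemma class_leD: "class_le P r t \<Longrightarrow> lower P (class_tree r) (class_tree t)"
  by (simp add: class_le_def)

lemma class_leI: "lower P r t \<Longrightarrow> class_le P (tree_class P r) (tree_class P t)"
  by (simp add: class_le_def tree_class_in[OF P] class_tree[OF P] lowerD(1,2))

lemma le_cut_tree_class: "lower P r t \<Longrightarrow> le_cut P (tree_class P r) (tree_class P t) = cut_class P r t"
  by (simp add: le_cut_def class_tree[OF P] lowerD(1,2))

lemma TTcut_le: "TTcut P = {le_cut P r t | r t. class_le P r t}"
proof
  show "TTcut P \<subseteq> {le_cut P r t | r t. class_le P r t}"
    unfolding TTcut_eq[OF P] using class_leI le_cut_tree_class by blast
  show "{le_cut P r t | r t. class_le P r t} \<subseteq> TTcut P"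
    unfolding TTcut_eq[OF P] le_cut_def using class_leD by blast
qed

lemma TTpcut_le: "TTpcut P = {le_pcut P r t p | r t p. class_le P r t \<and> p \<in> class_leaves P r}"
proof
  show "TTpcut P \<subseteq> {le_pcut P r t p | r t p. class_le P r t \<and> p \<in> class_leaves P r}"
  proof
    fix c assume "c \<in> TTpcut P"
    then obtain r t p where c: "c = pcut_class P r t p" "lower P r t" "p \<in> leaf_positions P r"
      unfolding TTpcut_eq[OF P] by blast
    then have "c = le_pcut P (tree_class P r) (tree_class P t) p" "p \<in> class_leaves P (tree_class P r)"
      by (simp_all add: le_pcut_def class_leaves_def class_tree[OF P] lowerD(1,2))
    then show "c \<in> {le_pcut P r t p | r t p. class_le P r t \<and> p \<in> class_leaves P r}"
      using class_leI[OF c(2)] by blast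
  qed
  show "{le_pcut P r t p | r t p. class_le P r t \<and> p \<in> class_leaves P r} \<subseteq> TTpcut P"
    unfolding TTpcut_eq[OF P] le_pcut_def class_leaves_def using class_leD by blast
qed

lemma m_le_cut: "class_le P r t \<Longrightarrow> m_map P (le_cut P r t) = t"
  and r_le_cut: "class_le P r t \<Longrightarrow> r_map P (le_cut P r t) = r"
  using tree_class_class_tree[OF P]
  by (auto simp: le_cut_def class_le_def m_map_class[OF P] r_map_class[OF P])

lemma p_le_pcut:
    "class_le P r t \<Longrightarrow> p \<in> class_leaves P r \<Longrightarrow> p_map P (le_pcut P r t p) = le_cut P r t"
  and f_le_pcut:
    "class_le P r t \<Longrightarrow> p \<in> class_leaves P r \<Longrightarrow> f_map P (le_pcut P r t p) = class_upper P t p"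
  by (simp_all add: le_pcut_def le_cut_def class_le_def class_leaves_def class_upper_def
      p_map_class[OF P] f_map_class[OF P])

lemma pcut_pos:
  assumes "class_le P r t" "p \<in> class_leaves P r"
  shows "pcut_pos (le_pcut P r t p) = p"
proof -
  obtain T S a where m: "(T, S, a) \<in> le_pcut P r t p"
    using pcut_class_member[OF P class_leD[OF assms(1)]] assms(2)
    unfolding le_pcut_def class_leaves_def by blast
  show ?thesis
    unfolding pcut_pos_def
  proof (rule some_equality)
    show "\<exists>T S a. (T, S, a) \<in> le_pcut P r t p \<and> at_pos T p a"
      using m unfolding le_pcut_def pcut_class_def by blast
    fix q assume "\<exists>T S a. (T, S, a) \<in> le_pcut P r t p \<and> at_pos T q a"
    then show "q = p"
      using at_pos_unique by (auto simp: le_pcut_def pcut_class_def cut_class_def cuts_iff)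
  qed
qed

lemma M_diagram_simps:
  "dI (M_diagram P) = TT P <+> TT P" "dE (M_diagram P) = TTpcut P <+> TTcut P"
  "dB (M_diagram P) = TTcut P" "dJ (M_diagram P) = TT P"
  "ds (M_diagram P) (Inl a) = Inl (f_map P a)" "ds (M_diagram P) (Inr c) = Inr (r_map P c)"
  "dp (M_diagram P) (Inl a) = p_map P a" "dp (M_diagram P) (Inr c) = c" "dt (M_diagram P) = m_map P"
  by (simp_all add: M_diagram_def)

lemma fib_B_M: "fib_B (M_diagram P) t = (\<lambda>r. le_cut P r t) ` {r. class_le P r t}"
  by (auto simp: fib_B_def M_diagram_simps TTcut_le m_le_cut)

text \<open>A class of pointed cuts lying over the given cut comes from a pair with the same values
  of \<open>r_map\<close> and \<open>m_map\<close>, hence from the same \<open>r\<close> and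
  \<open>t\<close>; only the leaf can vary.\<close>

lemma fib_E_M:
  assumes rt: "class_le P r t"
  shows "fib_E (M_diagram P) (le_cut P r t) =
    insert (Inr (le_cut P r t)) ((\<lambda>p. Inl (le_pcut P r t p)) ` class_leaves P r)"
proof (intro equalityI subsetI)
  fix e assume e: "e \<in> fib_E (M_diagram P) (le_cut P r t)"
  show "e \<in> insert (Inr (le_cut P r t)) ((\<lambda>p. Inl (le_pcut P r t p)) ` class_leaves P r)"
  proof (cases e)
    case (Inl a)
    with e have "a \<in> TTpcut P" and pa: "p_map P a = le_cut P r t"
      by (auto simp: fib_E_def M_diagram_simps)
    then obtain r' t' p where a: "a = le_pcut P r' t' p" "class_le P r' t'" "p \<in> class_leaves P r'"
      unfolding TTpcut_le by blast
    then have "le_cut P r' t' = le_cut P r t" using pa p_le_pcut by simp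
    then have "r' = r" "t' = t" using m_le_cut r_le_cut a(2) rt by metis+
    then show ?thesis using a Inl by simp
  qed (use e in \<open>auto simp: fib_E_def M_diagram_simps\<close>)
next
  fix e assume e: "e \<in> insert (Inr (le_cut P r t)) ((\<lambda>p. Inl (le_pcut P r t p)) ` class_leaves P r)"
  have "le_cut P r t \<in> TTcut P" using rt by (auto simp: TTcut_le)
  moreover have "le_pcut P r t p \<in> TTpcut P" if "p \<in> class_leaves P r" for p
    using rt that by (auto simp: TTpcut_le)
  ultimately show "e \<in> fib_E (M_diagram P) (le_cut P r t)"
    using e by (auto simp: fib_E_def M_diagram_simps p_le_pcut[OF rt])
qed

lemma finite_fibre_M: "finite_fibre_diagram (M_diagram P)"
  unfolding finite_fibre_diagram_def
proof (intro conjI ballI)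
  have "f_map P a \<in> TT P \<and> p_map P a \<in> TTcut P" if aT: "a \<in> TTpcut P" for a
  proof -
    obtain r t p where a: "a = le_pcut P r t p" "class_le P r t" "p \<in> class_leaves P r"
      using aT unfolding TTpcut_le by blast
    then show ?thesis
      using CS.sub_closed[OF a(2,3)] by (auto simp: p_le_pcut f_le_pcut TTcut_le)
  qed
  moreover have "r_map P c \<in> TT P \<and> m_map P c \<in> TT P" if "c \<in> TTcut P" for c
    using that CS.le_closed by (auto simp: TTcut_le r_le_cut m_le_cut)
  ultimately show "is_diagram (M_diagram P)"
    by (auto simp: is_diagram_def M_diagram_simps)
  fix b assume "b \<in> dB (M_diagram P)"
  then obtain r t where b: "b = le_cut P r t" and rt: "class_le P r t"
    unfolding M_diagram_simps TTcut_le by blast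
  show "finite (fib_E (M_diagram P) b)"
    using CS.finite_lv CS.le_closed[OF rt] by (simp add: b fib_E_M[OF rt])
next
  fix t assume "t \<in> dJ (M_diagram P)"
  then show "finite (fib_B (M_diagram P) t)"
    by (simp add: M_diagram_simps fib_B_M CS.finite_le)
qed

lemma pair_family_ds:
  assumes "class_le P r t"
  shows "pair_family (TT P) (TT P) X Y (ds (M_diagram P) (Inr (le_cut P r t))) = Y r"
    and "p \<in> class_leaves P r \<Longrightarrow>
      pair_family (TT P) (TT P) X Y (ds (M_diagram P) (Inl (le_pcut P r t p))) = X (class_upper P t p)"
  using assms CS.le_closed[OF assms] CS.sub_closed[OF assms]
  by (auto simp: M_diagram_simps r_le_cut f_le_pcut pair_family_def)

lemma cut_decoration_apply:
  assumes "class_le P r t"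
  shows "snd (cut_decoration P t (r, x, y)) (Inr (le_cut P r t)) = y"
    and "p \<in> class_leaves P r \<Longrightarrow> snd (cut_decoration P t (r, x, y)) (Inl (le_pcut P r t p)) = x p"
  using assms by (simp_all add: cut_decoration_def fib_E_M pcut_pos)

text \<open>Over a cut, the product ranges over its leaves and one further factor, which gives
  \<open>x\<close> and \<open>y\<close>; the cut itself gives back \<open>r\<close> through
  \<open>r_map\<close>.\<close>

lemma cut_decoration_bij:
  assumes t: "t \<in> TT P"
  shows "bij_betw (cut_decoration P t) (CS.cut_terms X Y t)
    (sum_prod (M_diagram P) (pair_family (TT P) (TT P) X Y) t)"
proof (rule bij_betw_imageI)
  let ?S = "sum_prod (M_diagram P) (pair_family (TT P) (TT P) X Y) t"
  show "inj_on (cut_decoration P t) (CS.cut_terms X Y t)"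
  proof (rule inj_onI)
    fix v v' assume v: "v \<in> CS.cut_terms X Y t" and v': "v' \<in> CS.cut_terms X Y t"
      and eq: "cut_decoration P t v = cut_decoration P t v'"
    obtain r x y where e: "v = (r, x, y)" and r: "class_le P r t"
      and x: "x \<in> (\<Pi>\<^sub>E p\<in>class_leaves P r. X (class_upper P t p))"
      using v by (auto simp: CS.cut_terms_def)
    obtain r' x' y' where e': "v' = (r', x', y')" and r': "class_le P r' t"
      and x': "x' \<in> (\<Pi>\<^sub>E p\<in>class_leaves P r'. X (class_upper P t p))"
      using v' by (auto simp: CS.cut_terms_def)
    have "le_cut P r t = le_cut P r' t"
      using eq by (simp add: e e' cut_decoration_def)
    then have rr: "r = r'" using r_le_cut r r' by metis
    have "y = y'"
      using cut_decoration_apply(1)[OF r, of x y] cut_decoration_apply(1)[OF r', of x' y'] eq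
      by (simp add: e e' rr)
    moreover have "x = x'"
    proof (rule PiE_ext[OF x])
      show "x' \<in> (\<Pi>\<^sub>E p\<in>class_leaves P r. X (class_upper P t p))" using x' rr by simp
      fix p assume p: "p \<in> class_leaves P r"
      then show "x p = x' p"
        using cut_decoration_apply(2)[OF r, of p x y] cut_decoration_apply(2)[OF r', of p x' y'] eq
        by (simp add: e e' rr)
    qed
    ultimately show "v = v'" by (simp add: e e' rr)
  qed
  show "cut_decoration P t ` CS.cut_terms X Y t = ?S"
  proof (intro equalityI subsetI)
    fix s assume "s \<in> cut_decoration P t ` CS.cut_terms X Y t"
    then obtain r x y where s: "s = cut_decoration P t (r, x, y)" and r: "class_le P r t"
      and x: "x \<in> (\<Pi>\<^sub>E p\<in>class_leaves P r. X (class_upper P t p))" and y: "y \<in> Y r"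
      by (auto simp: CS.cut_terms_def)
    have "snd s \<in> (\<Pi>\<^sub>E e\<in>fib_E (M_diagram P) (le_cut P r t).
        pair_family (TT P) (TT P) X Y (ds (M_diagram P) e))"
    proof (rule PiE_I)
      fix e assume "e \<in> fib_E (M_diagram P) (le_cut P r t)"
      then consider "e = Inr (le_cut P r t)"
        | p where "p \<in> class_leaves P r" "e = Inl (le_pcut P r t p)"
        unfolding fib_E_M[OF r] by blast
      then show "snd s e \<in> pair_family (TT P) (TT P) X Y (ds (M_diagram P) e)"
        using y PiE_mem[OF x]
        by cases (simp_all add: s cut_decoration_apply[OF r] pair_family_ds[OF r])
    qed (simp add: s cut_decoration_def)
    then show "s \<in> ?S"
      using r by (auto simp: sum_prod_def fib_B_M s cut_decoration_def)
  next
    fix s assume "s \<in> ?S"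
    then obtain r \<phi> where s: "s = (le_cut P r t, \<phi>)" and r: "class_le P r t"
      and \<phi>: "\<phi> \<in> (\<Pi>\<^sub>E e\<in>fib_E (M_diagram P) (le_cut P r t).
        pair_family (TT P) (TT P) X Y (ds (M_diagram P) e))"
      by (auto simp: sum_prod_def fib_B_M)
    define x where "x = (\<lambda>p\<in>class_leaves P r. \<phi> (Inl (le_pcut P r t p)))"
    define y where "y = \<phi> (Inr (le_cut P r t))"
    have "(r, x, y) \<in> CS.cut_terms X Y t"
      using PiE_mem[OF \<phi>, unfolded fib_E_M[OF r]] r pair_family_ds[OF r, where X = X and Y = Y]
      by (auto simp: CS.cut_terms_def x_def y_def)
    moreover have "cut_decoration P t (r, x, y) = s"
    proof -
      have "snd (cut_decoration P t (r, x, y)) = \<phi>"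
      proof (rule extensionalityI[of _ "fib_E (M_diagram P) (le_cut P r t)"])
        fix e assume "e \<in> fib_E (M_diagram P) (le_cut P r t)"
        then consider "e = Inr (le_cut P r t)"
          | p where "p \<in> class_leaves P r" "e = Inl (le_pcut P r t p)"
          unfolding fib_E_M[OF r] by blast
        then show "snd (cut_decoration P t (r, x, y)) e = \<phi> e"
          by cases (simp_all add: cut_decoration_apply[OF r] x_def y_def)
      qed (use \<phi> in \<open>simp_all add: cut_decoration_def PiE_iff\<close>)
      then show ?thesis by (simp add: s cut_decoration_def)
    qed
    ultimately show "s \<in> cut_decoration P t ` CS.cut_terms X Y t" by blast
  qed
qed

lemma sum_prod_eq:
  "t \<in> TT P \<Longrightarrow> sum_prod (M_diagram P) (pair_family (TT P) (TT P) X Y) t =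
    cut_decoration P t ` CS.cut_terms X Y t"
  using cut_decoration_bij[of t X Y] by (simp add: bij_betw_def)

text \<open>The codes are faithful because the sum is finite, being in bijection with the
  terms.\<close>

lemma inj_on_code_sum_prod:
  assumes "X \<in> families (TT P)" "Y \<in> families (TT P)" "t \<in> TT P"
  shows "inj_on (code (sum_prod (M_diagram P) (pair_family (TT P) (TT P) X Y) t) :: _ \<Rightarrow> 'u::infinite)
    (sum_prod (M_diagram P) (pair_family (TT P) (TT P) X Y) t)"
  by (rule inj_on_code) (simp add: sum_prod_eq assms CS.finite_cut_terms)

lemma on_obj_M:
  "on_obj (M_functor P) (X, Y) = (\<lambda>t\<in>TT P. term_code P X Y t ` CS.cut_terms X Y t)"
  by (rule ext)
    (simp add: M_functor_def fctr_comp_def pairing_def poly_functor_def poly_obj_def M_diagram_simps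
      sum_prod_eq image_image term_code_def restrict_def)

lemma inj_on_term_code:
  assumes "X \<in> families (TT P)" "Y \<in> families (TT P)" "t \<in> TT P"
  shows "inj_on (term_code P X Y t) (CS.cut_terms X Y t)"
  using comp_inj_on[OF bij_betw_imp_inj_on[OF cut_decoration_bij[OF assms(3)]], of _ X Y]
    inj_on_code_sum_prod[OF assms] sum_prod_eq[OF assms(3), of X Y]
  by (simp add: term_code_def[abs_def] comp_def)

lemma on_obj_M_families:
  assumes "X \<in> families (TT P)" "Y \<in> families (TT P)"
  shows "on_obj (M_functor P) (X, Y) \<in> families (TT P)"
  unfolding on_obj_M families_def[of "TT P"]
  by (simp add: PiE_iff CS.finite_cut_terms[OF assms])

section \<open>The tensor product on arrows\<close>

definition M_action where
  "M_action \<chi> Z Z' t u = (case decode (sum_prod (M_diagram P) Z t) u of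
     (b, x) \<Rightarrow> code (sum_prod (M_diagram P) Z' t)
       (b, \<lambda>e\<in>fib_E (M_diagram P) b. \<chi> (ds (M_diagram P) e) (x e)))"

lemma on_arr_M:
  "on_arr (M_functor P) ((X, \<phi>, X'), (Y, \<psi>, Y')) =
     mk_arr (TT P) (on_obj (M_functor P) (X, Y))
       (M_action (pair_family (TT P) (TT P) \<phi> \<psi>) (pair_family (TT P) (TT P) X Y)
         (pair_family (TT P) (TT P) X' Y'))
       (on_obj (M_functor P) (X', Y'))"
  by (simp add: M_functor_def fctr_comp_def pairing_def poly_functor_def mk_arr_def
      M_diagram_simps M_action_def)

text \<open>Decoding gives back the decorated cut, by injectivity of the code. The action then keeps
  the cut and is computed separately at the leaves (\<open>Inl\<close>) and at the cut itself
  (\<open>Inr\<close>).\<close>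

lemma M_action_term_code:
  fixes X Y X' Y' :: "(('i, 'e, 'b) tclass, 'u::infinite) family"
  assumes XY: "X \<in> families (TT P)" "Y \<in> families (TT P)" and v: "(r, x, y) \<in> CS.cut_terms X Y t"
  shows "M_action (pair_family (TT P) (TT P) \<phi> \<psi>) (pair_family (TT P) (TT P) X Y)
      (pair_family (TT P) (TT P) X' Y') t (term_code P X Y t (r, x, y)) =
    term_code P X' Y' t (r, \<lambda>p\<in>class_leaves P r. \<phi> (class_upper P t p) (x p), \<psi> r y)"
proof -
  have r: "class_le P r t" using v by (simp add: CS.cut_terms_def)
  then have t: "t \<in> TT P" using CS.le_closed by blast
  let ?S = "sum_prod (M_diagram P) (pair_family (TT P) (TT P) X Y) t"
  have "cut_decoration P t (r, x, y) \<in> ?S" using v sum_prod_eq[OF t] by blast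
  then have "decode ?S (term_code P X Y t (r, x, y)) = cut_decoration P t (r, x, y)"
    unfolding decode_def term_code_def by (rule the_inv_into_f_f[OF inj_on_code_sum_prod[OF XY t]])
  moreover have "(\<lambda>e\<in>fib_E (M_diagram P) (le_cut P r t).
        pair_family (TT P) (TT P) \<phi> \<psi> (ds (M_diagram P) e) (snd (cut_decoration P t (r, x, y)) e)) =
      snd (cut_decoration P t (r, \<lambda>p\<in>class_leaves P r. \<phi> (class_upper P t p) (x p), \<psi> r y))"
    (is "?l = snd ?r")
  proof (rule extensionalityI[of _ "fib_E (M_diagram P) (le_cut P r t)"])
    fix e assume e: "e \<in> fib_E (M_diagram P) (le_cut P r t)"
    then consider "e = Inr (le_cut P r t)"
      | p where "p \<in> class_leaves P r" "e = Inl (le_pcut P r t p)"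
      unfolding fib_E_M[OF r] by blast
    then show "?l e = snd ?r e"
      using e by cases (simp_all add: cut_decoration_apply[OF r] pair_family_ds[OF r])
  qed (simp_all add: cut_decoration_def)
  ultimately show ?thesis
    by (simp add: M_action_def term_code_def) (simp add: cut_decoration_def)
qed

lemma arrow_cases:
  assumes "f \<in> hom_set (family_cat J) X X'"
  obtains \<phi> where "f = (X, \<phi>, X')" and "app f = \<phi>"
  using assms by (auto simp: hom_set_family_cat app_def)

section \<open>The unit object\<close>

lemma trivial_classes_iff:
  assumes "j \<in> TT P"
  shows "j \<in> trivial_classes P \<longleftrightarrow> snd (class_tree j) = {}"
  using assms class_tree_in[OF P assms] tree_class_class_tree[OF P assms]
  by (auto simp: trivial_classes_def class_tree[OF P] intro!: image_eqI[of _ _ "class_tree j"])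

text \<open>\<open>e_map P\<close> is injective on colours with the trivial classes as its image: a
  trivial tree is determined by the colour of its edge.\<close>

lemma fib_B_U:
  assumes "j \<in> TT P"
  shows "fib_B (U_diagram P) j = (if j \<in> trivial_classes P then {fst (class_tree j)} else {})"
proof -
  have "i \<in> dI P \<and> e_map P i = j \<longleftrightarrow> class_tree j = (i, {})" for i
    using e_map_class[OF P, of i] class_tree[OF P] tree_class_class_tree[OF P assms]
      pos_treeD(1)[OF class_tree_in[OF P assms]] by (metis fst_conv)
  then show ?thesis
    by (auto simp: fib_B_def U_diagram_def trivial_classes_iff[OF assms] prod_eq_iff)
qed

lemma finite_fibre_U: "finite_fibre_diagram (U_diagram P)"
proof -
  have "fib_E (U_diagram P) b = {}" for b by (simp add: fib_E_def U_diagram_def)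
  moreover have "is_diagram (U_diagram P)"
    using e_map_class[OF P] tree_class_in[OF P] by (auto simp: is_diagram_def U_diagram_def)
  moreover have "dJ (U_diagram P) = TT P" by (simp add: U_diagram_def)
  ultimately show ?thesis by (simp add: finite_fibre_diagram_def fib_B_U)
qed

text \<open>The product over an empty fibre has one element, the extensional function
  \<open>\<lambda>_. undefined\<close>. So the unit has as many elements at \<open>j\<close> as
  there are colours in the fibre over \<open>j\<close>, namely one or none.\<close>

lemma U_object_apply:
  "(U_object P :: (('i, 'e, 'b) tclass, 'u::infinite) family) j = (if j \<in> TT P then
     code (sum_prod (U_diagram P) (\<lambda>_. undefined :: 'u set) j) `
       (fib_B (U_diagram P) j \<times> {\<lambda>_. undefined :: 'u})
   else undefined)"
proof -
  have "sum_prod (U_diagram P) (\<lambda>_. undefined :: 'u set) j =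
      fib_B (U_diagram P) j \<times> {\<lambda>_. undefined :: 'u}"
    by (auto simp: sum_prod_def fib_E_def U_diagram_def)
  moreover have "dJ (U_diagram P) = TT P" by (simp add: U_diagram_def)
  ultimately show ?thesis
    by (simp only: U_object_def poly_functor_def poly_obj_def restrict_def fctr.simps)
qed

lemma cut_tensor_M:
  "cut_tensor (TT P) (class_le P) (class_leaves P) (class_upper P) (trivial_classes P)
     (M_functor P) (term_code P) (U_object P) (\<lambda>j. the_elem (U_object P j))"
proof
  fix X Y :: "(('i, 'e, 'b) tclass, 'u::infinite) family" and t
  assume XY: "X \<in> families (TT P)" "Y \<in> families (TT P)"
  then show "t \<in> TT P \<Longrightarrow> inj_on (term_code P X Y t) (CS.cut_terms X Y t)"
    by (rule inj_on_term_code)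
  show "on_obj (M_functor P) (X, Y) = (\<lambda>t\<in>TT P. term_code P X Y t ` CS.cut_terms X Y t)"
    by (rule on_obj_M)
next
  fix f g :: "(('i, 'e, 'b) tclass, 'u::infinite) family_map" and X X' Y Y'
  assume f: "f \<in> hom_set (family_cat (TT P)) X X'" and g: "g \<in> hom_set (family_cat (TT P)) Y Y'"
  obtain \<phi> where fe: "f = (X, \<phi>, X')" and af: "app f = \<phi>" using arrow_cases[OF f] .
  obtain \<psi> where ge: "g = (Y, \<psi>, Y')" and ag: "app g = \<psi>" using arrow_cases[OF g] .
  note X = hom_families[OF f] and Y = hom_families[OF g]
  note act = M_action_term_code[OF X(1) Y(1), of _ _ _ _ \<phi> \<psi> X' Y']
  show "on_arr (M_functor P) (f, g) \<in> hom_set (family_cat (TT P))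
      (on_obj (M_functor P) (X, Y)) (on_obj (M_functor P) (X', Y'))"
    unfolding fe ge on_arr_M
  proof (rule mk_arr_hom)
    fix t u assume t: "t \<in> TT P" and u: "u \<in> on_obj (M_functor P) (X, Y) t"
    then obtain r x y where e: "u = term_code P X Y t (r, x, y)" and v: "(r, x, y) \<in> CS.cut_terms X Y t"
      by (auto simp: on_obj_M)
    have "(r, \<lambda>p\<in>class_leaves P r. \<phi> (class_upper P t p) (x p), \<psi> r y) \<in> CS.cut_terms X' Y' t"
      using v CS.sub_closed[of r t] CS.le_closed[of r t] app_in[OF f] app_in[OF g]
      by (auto simp: CS.cut_terms_def af ag PiE_iff)
    then show "M_action (pair_family (TT P) (TT P) \<phi> \<psi>) (pair_family (TT P) (TT P) X Y)
        (pair_family (TT P) (TT P) X' Y') t u \<in> on_obj (M_functor P) (X', Y') t"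
      using t unfolding e act[OF v] by (simp add: on_obj_M)
  qed (intro on_obj_M_families X Y)+
  fix r x y t assume v: "(r, x, y) \<in> CS.cut_terms X Y t"
  then have "t \<in> TT P" using CS.le_closed by (auto simp: CS.cut_terms_def)
  moreover from this have "term_code P X Y t (r, x, y) \<in> on_obj (M_functor P) (X, Y) t"
    using v by (simp add: on_obj_M)
  ultimately show "app (on_arr (M_functor P) (f, g)) t (term_code P X Y t (r, x, y)) =
      term_code P X' Y' t (r, \<lambda>p\<in>class_leaves P r. app f (class_upper P t p) (x p), app g r y)"
    unfolding af ag unfolding fe ge on_arr_M by (simp add: act[OF v])
next
  fix t
  show "t \<in> trivial_classes P \<Longrightarrow> U_object P t = {the_elem (U_object P t)}"
    using CS.trivial_closed[of t] by (simp add: U_object_apply[of t] fib_B_U)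
  show "t \<in> TT P \<Longrightarrow> t \<notin> trivial_classes P \<Longrightarrow> U_object P t = {}"
    by (simp add: U_object_apply fib_B_U)
next
  show "U_object P \<in> families (TT P)"
    unfolding families_def by (rule PiE_I) (simp_all add: U_object_apply fib_B_U)
qed

end

theorem mainTheorem1:
  fixes P :: "('i, 'e, 'b, 'i) diagram"
  assumes "finitary_endo P"
  shows "finite_fibre_diagram (M_diagram P) \<and> finite_fibre_diagram (U_diagram P) \<and>
    (\<exists>assoc lunit runit.
       monoidal_category
         (family_cat (TT P) :: ((('i, 'e, 'b) tclass, 'u::infinite) family,
                                (('i, 'e, 'b) tclass, 'u) family_map) cat)
         (M_functor P) (U_object P) assoc lunit runit)"
  using finite_fibre_M[OF assms] finite_fibre_U[OF assms] cut_tensor.monoidal[OF cut_tensor_M[OF assms]]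
  by blast

end
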